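(* Let $k$ be a commutative artinian ring, let $n\ge1$, and let $(\mathscr{C},\mathbb{E},\mathfrak{s})$ be an $\mathrm{Ext}$-finite, Krull-Schmidt and $k$-linear $n$-exangulated category having Auslander-Reiten-Serre duality. Assume that for all composable morphisms $f\in\mathscr{C}(A,B)$, $g\in\mathscr{C}(B,C)$: if $g\circ f$ is a deflation then so is $g$, and if $g\circ f$ is an inflation then so is $f$. Let $X,Y\in\mathscr{C}$. Then ${}_X[\rightarrow Y\rangle_{\rm def}={}^{\tau_n^-X}[\rightarrow Y\rangle_{\rm def}$, and the triangle formed by the maps $$\xi_{X,Y}\colon {}_X[\rightarrow Y\rangle_{\rm def}={}^{\tau_n^-X}[\rightarrow Y\rangle_{\rm def}\to\mathrm{sub}_{\mathrm{End}_{\mathscr{C}}(X)}\mathbb{E}(Y,X),$$ $$\Upsilon_{X,Y}\colon\mathrm{sub}_{\mathrm{End}_{\mathscr{C}}(X)}\mathbb{E}(Y,X)\to\mathrm{sub}_{\mathrm{End}_{\mathscr{C}}(\tau_n^-X)^{\mathrm{op}}}\underline{\mathscr{C}}(\tau_n^-X,Y),$$ $$\eta_{\tau_n^-X,Y}\colon{}^{\tau_n^-X}[\rightarrow Y\rangle_{\rm def}\to\mathrm{sub}_{\mathrm{End}_{\mathscr{C}}(\tau_n^-X)^{\mathrm{op}}}\underline{\mathscr{C}}(\tau_n^-X,Y)$$ is commutative, i.e. $\eta_{\tau_n^-X,Y}=\Upsilon_{X,Y}\circ\xi_{X,Y}$. In particular, the restricted Auslander bijection at $Y$ relative to $\tau_n^-X$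 holds: the map $$\eta_{\tau_n^-X,Y}\colon{}^{\tau_n^-X}[\rightarrow Y\rangle_{\rm def}\to\mathrm{sub}_{\mathrm{End}_{\mathscr{C}}(\tau_n^-X)^{\mathrm{op}}}\underline{\mathscr{C}}(\tau_n^-X,Y)$$ is an isomorphism of posets.
   Context: **$n$-exangulated categories.** Let $\mathscr{C}$ be an additive category and $\mathbb{E}\colon\mathscr{C}^{\mathrm{op}}\times\mathscr{C}\to\mathrm{Ab}$ an additive bifunctor. Elements $\delta\in\mathbb{E}(C,A)$ are called extensions. For $a\in\mathscr{C}(A,A')$, $c\in\mathscr{C}(C',C)$ put $a_*\delta=\mathbb{E}(C,a)(\delta)$ and $c^*\delta=\mathbb{E}(c,A)(\delta)$. A morphism of extensions from $\delta\in\mathbb{E}(C,A)$ to $\rho\in\mathbb{E}(D,B)$ is a pair $(a,c)$, $a\in\mathscr{C}(A,B)$, $c\in\mathscr{C}(C,D)$, with $a_*\delta=c^*\rho$. Let $\mathbf{C}^{n+2}_{\mathscr{C}}$ be the category of complexes $X_\bullet\colon X_0\xrightarrow{d_0^X}X_1\to\cdots\to X_n\xrightarrow{d_n^X}X_{n+1}$ in $\mathscr{C}$. For $\delta\in\mathbb{E}(C,A)$ define $\delta_\sharp\colon\mathscr{C}(-,C)\to\mathbb{E}(-,A)$, $f\mapsto f^*\delta$, and $\delta^\sharp\colon\mathscr{C}(A,-)\to\mathbb{E}(C,-)$, $g\mapsto g_*\delta$. A pair $\langle X_\bullet,\delta\rangle$ with $\delta\in\mathbb{E}(X_{n+1},X_0)$,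 $(d_0^X)_*\delta=0$, $(d_n^X)^*\delta=0$ is an $n$-exangle if the sequences of functors $\mathscr{C}(-,X_0)\to\cdots\to\mathscr{C}(-,X_{n+1})\xrightarrow{\delta_\sharp}\mathbb{E}(-,X_0)$ and $\mathscr{C}(X_{n+1},-)\to\cdots\to\mathscr{C}(X_0,-)\xrightarrow{\delta^\sharp}\mathbb{E}(X_{n+1},-)$ are exact. For fixed $A,C$, consider complexes with $X_0=A$, $X_{n+1}=C$ and morphisms $f_\bullet$ with $f_0=\mathrm{id}_A$, $f_{n+1}=\mathrm{id}_C$; two such are homotopic if they differ by a chain homotopy $(\varphi_i\colon X_i\to Y_{i-1})_{1\le i\le n+1}$, and $[X_\bullet]$ denotes the resulting homotopy equivalence class. An exact realization $\mathfrak{s}$ of $\mathbb{E}$ assigns to each $\delta\in\mathbb{E}(C,A)$ such a class $\mathfrak{s}(\delta)=[X_\bullet]$ with $X_0=A$, $X_{n+1}=C$, such that: (R0) for $\mathfrak{s}(\delta)=[X_\bullet]$, $\mathfrak{s}(\rho)=[Y_\bullet]$, every morphism of extensions $(a,c)\colon\delta\to\rho$ has a lift $f_\bullet=(a,f_1,\dots,f_n,c)\colon X_\bullet\to Y_\bullet$; (R1) $\langle X_\bullet,\delta\rangle$ is an $n$-exangle whenever $\mathfrak{s}(\delta)=[X_\bullet]$; (R2) $0\in\mathbb{E}(0,A)$ is realized by $A\xrightarrow{\mathrm{id}}A\to0\to\cdots\to0$ and $0\in\mathbb{E}(A,0)$ is realized by $0\to\cdots\to0\to A\xrightarrow{\mathrm{id}}A$.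 If $\mathfrak{s}(\delta)=[X_\bullet]$, then $\langle X_\bullet,\delta\rangle$ is called a distinguished $n$-exangle, written $X_0\xrightarrow{d_0}X_1\to\cdots\to X_n\xrightarrow{d_n}X_{n+1}\overset{\delta}{\dashrightarrow}$; then $d_0$ is called an inflation and $d_n$ a deflation. The triple $(\mathscr{C},\mathbb{E},\mathfrak{s})$ is an $n$-exangulated category if: (EA1) inflations are closed under composition and deflations are closed under composition; (EA2) for $\rho\in\mathbb{E}(D,A)$, $c\in\mathscr{C}(C,D)$ and distinguished $\langle X_\bullet,c^*\rho\rangle$, $\langle Y_\bullet,\rho\rangle$, the pair $(\mathrm{id}_A,c)$ has a lift $f_\bullet\colon X_\bullet\to Y_\bullet$ whose mapping cone $X_1\to X_2\oplus Y_1\to\cdots\to X_{n+1}\oplus Y_n\to Y_{n+1}$, with differentials $\begin{bmatrix}-d_1^X\\ f_1\end{bmatrix}$, $\begin{bmatrix}-d_{i+1}^X&0\\ f_{i+1}&d_i^Y\end{bmatrix}$ ($1\le i\le n-1$), $\begin{bmatrix}f_{n+1}&d_n^Y\end{bmatrix}$, together with $(d_0^X)_*\rho$ is a distinguished $n$-exangle; (EA2$^{\mathrm{op}}$) the dual of (EA2). **Linearity and finiteness.** $\mathscr{C}$ is $k$-linear if all $\mathscr{C}(A,B)$ and $\mathbb{E}(A,B)$ are $k$-modules and the compositions $\mathscr{C}(A,B)\times\mathscr{C}(B,C)\to\mathscr{C}(A,C)$ and $\mathscr{C}(A,B)\times\mathbb{E}(B,C)\times\mathscr{C}(C,D)\to\mathbb{E}(A,D)$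 are $k$-linear in each variable; $\mathrm{Ext}$-finite if each $\mathbb{E}(A,B)$ is a finitely generated $k$-module; Krull-Schmidt if each object is a finite direct sum of objects with local endomorphism rings. $D=\mathrm{Hom}_k(-,J)$, where $J$ is the minimal injective cogenerator of $k$. **Stable categories.** $f\colon X\to Y$ is $n$-projectively trivial if $\mathbb{E}(f,Z)\colon\mathbb{E}(Y,Z)\to\mathbb{E}(X,Z)$ is zero for all $Z$; $g\colon X\to Y$ is $n$-injectively trivial if $\mathbb{E}(Z,g)\colon\mathbb{E}(Z,X)\to\mathbb{E}(Z,Y)$ is zero for all $Z$. Let $\mathcal{P}(A,B)$ (resp. $\mathcal{I}(A,B)$) be the set of $n$-projectively (resp. $n$-injectively) trivial morphisms $A\to B$. The categories $\underline{\mathscr{C}}$, $\overline{\mathscr{C}}$ have the objects of $\mathscr{C}$ and morphisms $\underline{\mathscr{C}}(A,B)=\mathscr{C}(A,B)/\mathcal{P}(A,B)$, $\overline{\mathscr{C}}(A,B)=\mathscr{C}(A,B)/\mathcal{I}(A,B)$. **Auslander-Reiten-Serre duality.** $\mathscr{C}$ has Auslander-Reiten-Serre duality if there is a $k$-linear equivalence $\tau_n\colon\underline{\mathscr{C}}\to\overline{\mathscr{C}}$ with a $k$-linear isomorphism $\Phi_{X,Y}\colon D\mathbb{E}(X,Y)\to\overline{\mathscr{C}}(Y,\tau_nX)$, natural in $X,Y$. Let $\tau_n^-$ be a quasi-inverse of $\tau_n$; $(\tau_n^-,\tau_n)$ is an adjoint pair, with counit $\theta\colon\tau_n^-\tau_n\to\mathrm{Id}_{\underline{\mathscr{C}}}$.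 Let $\vartheta_{X,Y}\colon\overline{\mathscr{C}}(Y,\tau_nX)\to\underline{\mathscr{C}}(\tau_n^-Y,X)$, $f\mapsto\theta_X\tau_n^-(f)$ be the adjunction isomorphism and $\Psi_{X,Y}=\vartheta_{X,Y}\circ\Phi_{X,Y}\colon D\mathbb{E}(X,Y)\to\underline{\mathscr{C}}(\tau_n^-Y,X)$. **Right equivalence and determined morphisms.** Morphisms $f\colon W\to Y$, $f'\colon W'\to Y$ are right equivalent if each factors through the other; $[f\rangle$ is the right equivalence class of $f$; $[f_1\rangle\le[f_2\rangle$ if $f_1$ factors through $f_2$; $[\rightarrow Y\rangle$ is the resulting poset of classes of morphisms ending at $Y$. $f\in\mathscr{C}(W,Y)$ is right $C$-determined if every $g\in\mathscr{C}(L,Y)$ (for any $L$) such that $g\circ h$ factors through $f$ for each $h\in\mathscr{C}(C,L)$ itself factors through $f$; this depends only on $[f\rangle$. Put $[\rightarrow Y\rangle_{\rm def}=\{[f\rangle\mid f\text{ is a deflation}\}$ and let ${}^C[\rightarrow Y\rangle_{\rm def}$ be the subset of those classes in it that are right $C$-determined. Let ${}_X[\rightarrow Y\rangle_{\rm def}$ be the subset of those classes in $[\rightarrow Y\rangle_{\rm def}$ having a representative $f$ for which there is a distinguished $n$-exangle $X_0\to X_1\to\cdots\to X_{n-1}\to W\xrightarrow{f}Y\overset{\delta_f}{\dashrightarrow}$ with $X_0\in\mathrm{add}\,X$ (the direct summands of finite direct sums of copies of $X$). **The three maps.** $\mathrm{sub}_R M$ denotes the poset (under inclusion) of finitely generated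 $R$-submodules of $M$. - $\eta_{C,Y}([f\rangle)=\mathrm{Im}\,\mathscr{C}(C,f)/\mathcal{P}(C,Y)\subseteq\underline{\mathscr{C}}(C,Y)$ (for $f$ a deflation one has $\mathcal{P}(C,Y)\subseteq\mathrm{Im}\,\mathscr{C}(C,f)$). - $\xi_{X,Y}([f\rangle)=\mathrm{Im}\big((\delta_f^\sharp)_X\colon\mathscr{C}(Z_0,X)\to\mathbb{E}(Y,X),\ g\mapsto g_*\delta_f\big)$, where $Z_0\to Z_1\to\cdots\to W\xrightarrow{f}Y\overset{\delta_f}{\dashrightarrow}$ is a distinguished $n$-exangle; this is well defined on right equivalence classes. - For an $\mathrm{End}_{\mathscr{C}}(X)$-submodule $F\subseteq\mathbb{E}(Y,X)$ with inclusion $i$, $\Upsilon_{X,Y}(F)=H$ is defined by the exact sequence $0\to H\to\underline{\mathscr{C}}(\tau_n^-X,Y)\xrightarrow{D(i)\Psi_{Y,X}^{-1}}DF\to0$. Here the $\mathrm{End}_{\mathscr{C}}(\tau_n^-X)^{\mathrm{op}}$-submodules of $\underline{\mathscr{C}}(\tau_n^-X,Y)$ are identified with its $\mathrm{End}_{\mathscr{C}}(X)^{\mathrm{op}}$-submodules via the equivalence $\tau_n^-$. *)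

theory Defs
  imports "HOL-Algebra.Module" "HOL-Algebra.QuotRing"
begin

section \<open>Modules and rings\<close>

definition artinian_ring :: "'k ring \<Rightarrow> bool" where
  "artinian_ring k \<longleftrightarrow> ring k \<and>
    (\<forall>I :: nat \<Rightarrow> 'k set. (\<forall>i. ideal (I i) k) \<and> (\<forall>i. I (Suc i) \<subseteq> I i) \<longrightarrow>
       (\<exists>m. \<forall>i\<ge>m. I i = I m))"

definition local_ring :: "'a ring \<Rightarrow> bool" where
  "local_ring R \<longleftrightarrow> ring R \<and> \<one>\<^bsub>R\<^esub> \<noteq> \<zero>\<^bsub>R\<^esub> \<and>
    (\<forall>a \<in> carrier R - Units R. \<forall>b \<in> carrier R - Units R. a \<oplus>\<^bsub>R\<^esub> b \<notin> Units R)"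

definition op_ring :: "'a ring \<Rightarrow> 'a ring" where
  "op_ring R = R\<lparr>monoid.mult := \<lambda>x y. y \<otimes>\<^bsub>R\<^esub> x\<rparr>"

definition linear_map :: "'k ring \<Rightarrow> ('k, 'a) module \<Rightarrow> ('k, 'b) module \<Rightarrow> ('a \<Rightarrow> 'b) \<Rightarrow> bool" where
  "linear_map k M N f \<longleftrightarrow>
    f \<in> carrier M \<rightarrow> carrier N \<and>
    (\<forall>x\<in>carrier M. \<forall>y\<in>carrier M. f (x \<oplus>\<^bsub>M\<^esub> y) = f x \<oplus>\<^bsub>N\<^esub> f y) \<and>
    (\<forall>r\<in>carrier k. \<forall>x\<in>carrier M. f (r \<odot>\<^bsub>M\<^esub> x) = r \<odot>\<^bsub>N\<^esub> f x)"

text \<open>The record type of modules extends that of rings; the fields \<open>mult\<close> and \<open>one\<close> play no role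
  for a module and are left \<open>undefined\<close> in the constructions below.\<close>

text \<open>The locale \<^locale>\<open>submodule\<close> does not require the ring to be commutative, so it also applies to
  modules over endomorphism rings.\<close>

definition finitely_generated :: "'r ring \<Rightarrow> ('r, 'a) module \<Rightarrow> 'a set \<Rightarrow> bool" where
  "finitely_generated R M H \<longleftrightarrow>
    (\<exists>G. finite G \<and> G \<subseteq> H \<and> (\<forall>K. submodule K R M \<and> G \<subseteq> K \<longrightarrow> H \<subseteq> K))"

definition fg_submodules :: "'r ring \<Rightarrow> ('r, 'a) module \<Rightarrow> 'a set set" where
  "fg_submodules R M = {H. submodule H R M \<and> finitely_generated R M H}"

definition quotient_module :: "('k, 'a) module \<Rightarrow> 'a set \<Rightarrow> ('k, 'a set) module" where
  "quotient_module M N =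
    \<lparr>carrier = a_rcosets\<^bsub>M\<^esub> N, monoid.mult = undefined, monoid.one = undefined,
     ring.zero = N, ring.add = set_add M,
     smult = (\<lambda>r U. \<Union>x\<in>U. N +>\<^bsub>M\<^esub> (r \<odot>\<^bsub>M\<^esub> x))\<rparr>"

subsection \<open>The duality given by the minimal injective cogenerator\<close>

text \<open>HOL cannot quantify over all modules on all types, so the test modules range over the modules
  carried by subsets of \<^typ>\<open>'k set\<close>. Up to isomorphism these include all ideals and all cyclic
  modules \<open>k/I\<close>; by Baer's criterion this gives injectivity against modules on every type, and
  for an injective module the cogenerator property against modules on every type follows
  from the one against cyclic modules.\<close>

definition injective_module :: "'k ring \<Rightarrow> ('k, 'j) module \<Rightarrow> bool" where
  "injective_module k J \<longleftrightarrow> module k J \<and>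
    (\<forall>(M :: ('k, 'k set) module) (N :: ('k, 'k set) module) i f.
       module k M \<and> module k N \<and> linear_map k M N i \<and> inj_on i (carrier M) \<and> linear_map k M J f \<longrightarrow>
       (\<exists>g. linear_map k N J g \<and> (\<forall>x\<in>carrier M. g (i x) = f x)))"

definition cogenerator_module :: "'k ring \<Rightarrow> ('k, 'j) module \<Rightarrow> bool" where
  "cogenerator_module k J \<longleftrightarrow> module k J \<and>
    (\<forall>(M :: ('k, 'k set) module). module k M \<longrightarrow>
       (\<forall>x\<in>carrier M. x \<noteq> \<zero>\<^bsub>M\<^esub> \<longrightarrow> (\<exists>f. linear_map k M J f \<and> f x \<noteq> \<zero>\<^bsub>J\<^esub>)))"

definition injective_cogenerator :: "'k ring \<Rightarrow> ('k, 'j) module \<Rightarrow> bool" where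
  "injective_cogenerator k J \<longleftrightarrow> injective_module k J \<and> cogenerator_module k J"

definition minimal_injective_cogenerator :: "'k ring \<Rightarrow> ('k, 'j) module \<Rightarrow> bool" where
  "minimal_injective_cogenerator k J \<longleftrightarrow> injective_cogenerator k J \<and>
    (\<forall>H. submodule H k J \<and> injective_cogenerator k (J\<lparr>carrier := H\<rparr>) \<longrightarrow> H = carrier J)"

definition dual_module :: "'k ring \<Rightarrow> ('k, 'j) module \<Rightarrow> ('k, 'a) module \<Rightarrow> ('k, 'a \<Rightarrow> 'j) module" where
  "dual_module k J M =
    \<lparr>carrier = {f \<in> extensional (carrier M). linear_map k M J f},
     monoid.mult = undefined, monoid.one = undefined,
     ring.zero = (\<lambda>x\<in>carrier M. \<zero>\<^bsub>J\<^esub>),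
     ring.add = (\<lambda>f g. \<lambda>x\<in>carrier M. f x \<oplus>\<^bsub>J\<^esub> g x),
     smult = (\<lambda>r f. \<lambda>x\<in>carrier M. r \<odot>\<^bsub>J\<^esub> f x)\<rparr>"

section \<open>Additive and linear categories\<close>

text \<open>\<open>mor C X Y\<close> is the group (or \<open>k\<close>-module) of morphisms from \<open>X\<close> to \<open>Y\<close>, and
  \<open>cmp C X Y Z g f\<close> is the composite \<open>g \<circ> f\<close> of \<open>f : X \<rightarrow> Y\<close> and \<open>g : Y \<rightarrow> Z\<close>. Hom-sets for
  different pairs of objects need not be disjoint, whence the object arguments. Scalar
  multiplication is only used once \<open>linear_category\<close> is assumed.\<close>

record ('o, 'm, 'k) cat =
  obj :: "'o set"
  mor :: "'o \<Rightarrow> 'o \<Rightarrow> ('k, 'm) module"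
  cmp :: "'o \<Rightarrow> 'o \<Rightarrow> 'o \<Rightarrow> 'm \<Rightarrow> 'm \<Rightarrow> 'm"
  idm :: "'o \<Rightarrow> 'm"

abbreviation Mor :: "('o, 'm, 'k) cat \<Rightarrow> 'o \<Rightarrow> 'o \<Rightarrow> 'm set" where
  "Mor C X Y \<equiv> carrier (mor C X Y)"

abbreviation zmor :: "('o, 'm, 'k) cat \<Rightarrow> 'o \<Rightarrow> 'o \<Rightarrow> 'm" where
  "zmor C X Y \<equiv> ring.zero (mor C X Y)"

locale preadditive_category =
  fixes C :: "('o, 'm, 'k) cat"
  assumes mor_group: "\<lbrakk>X \<in> obj C; Y \<in> obj C\<rbrakk> \<Longrightarrow> abelian_group (mor C X Y)"
    and idm_closed: "X \<in> obj C \<Longrightarrow> idm C X \<in> Mor C X X"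
    and cmp_closed: "\<lbrakk>X \<in> obj C; Y \<in> obj C; Z \<in> obj C; f \<in> Mor C X Y; g \<in> Mor C Y Z\<rbrakk>
      \<Longrightarrow> cmp C X Y Z g f \<in> Mor C X Z"
    and cmp_idm_right: "\<lbrakk>X \<in> obj C; Y \<in> obj C; f \<in> Mor C X Y\<rbrakk> \<Longrightarrow> cmp C X X Y f (idm C X) = f"
    and cmp_idm_left: "\<lbrakk>X \<in> obj C; Y \<in> obj C; f \<in> Mor C X Y\<rbrakk> \<Longrightarrow> cmp C X Y Y (idm C Y) f = f"
    and cmp_assoc: "\<lbrakk>W \<in> obj C; X \<in> obj C; Y \<in> obj C; Z \<in> obj C;
        f \<in> Mor C W X; g \<in> Mor C X Y; h \<in> Mor C Y Z\<rbrakk>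
      \<Longrightarrow> cmp C W X Z (cmp C X Y Z h g) f = cmp C W Y Z h (cmp C W X Y g f)"
    and cmp_add_left: "\<lbrakk>X \<in> obj C; Y \<in> obj C; Z \<in> obj C;
        f \<in> Mor C X Y; g \<in> Mor C Y Z; g' \<in> Mor C Y Z\<rbrakk>
      \<Longrightarrow> cmp C X Y Z (g \<oplus>\<^bsub>mor C Y Z\<^esub> g') f = cmp C X Y Z g f \<oplus>\<^bsub>mor C X Z\<^esub> cmp C X Y Z g' f"
    and cmp_add_right: "\<lbrakk>X \<in> obj C; Y \<in> obj C; Z \<in> obj C;
        f \<in> Mor C X Y; f' \<in> Mor C X Y; g \<in> Mor C Y Z\<rbrakk>
      \<Longrightarrow> cmp C X Y Z g (f \<oplus>\<^bsub>mor C X Y\<^esub> f') = cmp C X Y Z g f \<oplus>\<^bsub>mor C X Z\<^esub> cmp C X Y Z g f'"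

definition is_zero_object :: "('o, 'm, 'k) cat \<Rightarrow> 'o \<Rightarrow> bool" where
  "is_zero_object C Z \<longleftrightarrow> Z \<in> obj C \<and>
    (\<forall>A\<in>obj C. (\<exists>!f. f \<in> Mor C Z A) \<and> (\<exists>!f. f \<in> Mor C A Z))"

definition is_biproduct ::
  "('o, 'm, 'k) cat \<Rightarrow> 'o \<Rightarrow> 'o \<Rightarrow> 'o \<Rightarrow> 'm \<Rightarrow> 'm \<Rightarrow> 'm \<Rightarrow> 'm \<Rightarrow> bool" where
  "is_biproduct C A B S i1 i2 p1 p2 \<longleftrightarrow>
    A \<in> obj C \<and> B \<in> obj C \<and> S \<in> obj C \<and>
    i1 \<in> Mor C A S \<and> i2 \<in> Mor C B S \<and> p1 \<in> Mor C S A \<and> p2 \<in> Mor C S B \<and>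
    cmp C A S A p1 i1 = idm C A \<and> cmp C B S B p2 i2 = idm C B \<and>
    cmp C B S A p1 i2 = zmor C B A \<and> cmp C A S B p2 i1 = zmor C A B \<and>
    cmp C S A S i1 p1 \<oplus>\<^bsub>mor C S S\<^esub> cmp C S B S i2 p2 = idm C S"

definition is_direct_sum ::
  "('o, 'm, 'k) cat \<Rightarrow> nat \<Rightarrow> (nat \<Rightarrow> 'o) \<Rightarrow> 'o \<Rightarrow> (nat \<Rightarrow> 'm) \<Rightarrow> (nat \<Rightarrow> 'm) \<Rightarrow> bool" where
  "is_direct_sum C m A S \<iota> \<pi> \<longleftrightarrow>
    S \<in> obj C \<and>
    (\<forall>i<m. A i \<in> obj C \<and> \<iota> i \<in> Mor C (A i) S \<and> \<pi> i \<in> Mor C S (A i)) \<and>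
    (\<forall>i<m. \<forall>j<m. cmp C (A i) S (A j) (\<pi> j) (\<iota> i) =
       (if i = j then idm C (A i) else zmor C (A i) (A j))) \<and>
    finsum (mor C S S) (\<lambda>i. cmp C S (A i) S (\<iota> i) (\<pi> i)) {..<m} = idm C S"

locale additive_category = preadditive_category +
  assumes ex_zero_object: "\<exists>Z. is_zero_object C Z"
    and ex_biproduct: "\<lbrakk>A \<in> obj C; B \<in> obj C\<rbrakk> \<Longrightarrow> \<exists>S i1 i2 p1 p2. is_biproduct C A B S i1 i2 p1 p2"

locale linear_category = preadditive_category C
  for k :: "'k ring" and C :: "('o, 'm, 'k) cat" +
  assumes mor_module: "\<lbrakk>X \<in> obj C; Y \<in> obj C\<rbrakk> \<Longrightarrow> module k (mor C X Y)"
    and cmp_smult_left: "\<lbrakk>X \<in> obj C; Y \<in> obj C; Z \<in> obj C;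
        f \<in> Mor C X Y; g \<in> Mor C Y Z; r \<in> carrier k\<rbrakk>
      \<Longrightarrow> cmp C X Y Z (r \<odot>\<^bsub>mor C Y Z\<^esub> g) f = r \<odot>\<^bsub>mor C X Z\<^esub> cmp C X Y Z g f"
    and cmp_smult_right: "\<lbrakk>X \<in> obj C; Y \<in> obj C; Z \<in> obj C;
        f \<in> Mor C X Y; g \<in> Mor C Y Z; r \<in> carrier k\<rbrakk>
      \<Longrightarrow> cmp C X Y Z g (r \<odot>\<^bsub>mor C X Y\<^esub> f) = r \<odot>\<^bsub>mor C X Z\<^esub> cmp C X Y Z g f"

definition End_ring :: "('o, 'm, 'k) cat \<Rightarrow> 'o \<Rightarrow> 'm ring" where
  "End_ring C X = \<lparr>carrier = Mor C X X, monoid.mult = cmp C X X X, monoid.one = idm C X,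
                   ring.zero = zmor C X X, ring.add = ring.add (mor C X X)\<rparr>"

definition krull_schmidt :: "('o, 'm, 'k) cat \<Rightarrow> bool" where
  "krull_schmidt C \<longleftrightarrow> (\<forall>X\<in>obj C. \<exists>m A \<iota> \<pi>. is_direct_sum C m A X \<iota> \<pi> \<and>
     (\<forall>i<m. local_ring (End_ring C (A i))))"

definition add_closure :: "('o, 'm, 'k) cat \<Rightarrow> 'o \<Rightarrow> 'o set" where
  "add_closure C X = {A. \<exists>m S \<iota> \<pi> B i1 i2 p1 p2.
     is_direct_sum C m (\<lambda>_. X) S \<iota> \<pi> \<and> is_biproduct C A B S i1 i2 p1 p2}"

definition is_iso :: "('o, 'm, 'k) cat \<Rightarrow> 'o \<Rightarrow> 'o \<Rightarrow> 'm \<Rightarrow> bool" where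
  "is_iso C X Y f \<longleftrightarrow> f \<in> Mor C X Y \<and>
    (\<exists>g\<in>Mor C Y X. cmp C X Y X g f = idm C X \<and> cmp C Y X Y f g = idm C Y)"

text \<open>The quotient of \<open>C\<close> by a family of subgroups \<open>N X Y\<close> of the morphism groups (in the
  applications an ideal of \<open>C\<close>); morphisms are cosets.\<close>

definition quotient_cat :: "('o, 'm, 'k) cat \<Rightarrow> ('o \<Rightarrow> 'o \<Rightarrow> 'm set) \<Rightarrow> ('o, 'm set, 'k) cat" where
  "quotient_cat C N =
    \<lparr>obj = obj C,
     mor = (\<lambda>X Y. quotient_module (mor C X Y) (N X Y)),
     cmp = (\<lambda>X Y Z V U. \<Union>g\<in>V. \<Union>f\<in>U. N X Z +>\<^bsub>mor C X Z\<^esub> cmp C X Y Z g f),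
     idm = (\<lambda>X. N X X +>\<^bsub>mor C X X\<^esub> idm C X)\<rparr>"

subsection \<open>Functors, equivalences and adjunctions\<close>

record ('o, 'm, 'p, 'l) fun_data =
  fob :: "'o \<Rightarrow> 'p"
  fmor :: "'o \<Rightarrow> 'o \<Rightarrow> 'm \<Rightarrow> 'l"

definition id_functor :: "('o, 'm, 'o, 'm) fun_data" where
  "id_functor = \<lparr>fob = (\<lambda>X. X), fmor = (\<lambda>X Y f. f)\<rparr>"

definition comp_functor ::
  "('p, 'l, 'q, 's) fun_data \<Rightarrow> ('o, 'm, 'p, 'l) fun_data \<Rightarrow> ('o, 'm, 'q, 's) fun_data" where
  "comp_functor G F = \<lparr>fob = (\<lambda>X. fob G (fob F X)),
     fmor = (\<lambda>X Y f. fmor G (fob F X) (fob F Y) (fmor F X Y f))\<rparr>"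

definition is_functor ::
  "('o, 'm, 'k) cat \<Rightarrow> ('p, 'l, 'k) cat \<Rightarrow> ('o, 'm, 'p, 'l) fun_data \<Rightarrow> bool" where
  "is_functor A B F \<longleftrightarrow>
    (\<forall>X\<in>obj A. fob F X \<in> obj B) \<and>
    (\<forall>X\<in>obj A. \<forall>Y\<in>obj A. fmor F X Y \<in> Mor A X Y \<rightarrow> Mor B (fob F X) (fob F Y)) \<and>
    (\<forall>X\<in>obj A. fmor F X X (idm A X) = idm B (fob F X)) \<and>
    (\<forall>X\<in>obj A. \<forall>Y\<in>obj A. \<forall>Z\<in>obj A. \<forall>f\<in>Mor A X Y. \<forall>g\<in>Mor A Y Z.
       fmor F X Z (cmp A X Y Z g f) =
       cmp B (fob F X) (fob F Y) (fob F Z) (fmor F Y Z g) (fmor F X Y f))"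

definition is_linear_functor ::
  "'k ring \<Rightarrow> ('o, 'm, 'k) cat \<Rightarrow> ('p, 'l, 'k) cat \<Rightarrow> ('o, 'm, 'p, 'l) fun_data \<Rightarrow> bool" where
  "is_linear_functor k A B F \<longleftrightarrow> is_functor A B F \<and>
    (\<forall>X\<in>obj A. \<forall>Y\<in>obj A. linear_map k (mor A X Y) (mor B (fob F X) (fob F Y)) (fmor F X Y))"

definition nat_transformation ::
  "('o, 'm, 'k) cat \<Rightarrow> ('p, 'l, 'k) cat \<Rightarrow> ('o, 'm, 'p, 'l) fun_data \<Rightarrow> ('o, 'm, 'p, 'l) fun_data
   \<Rightarrow> ('o \<Rightarrow> 'l) \<Rightarrow> bool" where
  "nat_transformation A B F G t \<longleftrightarrow>
    (\<forall>X\<in>obj A. t X \<in> Mor B (fob F X) (fob G X)) \<and>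
    (\<forall>X\<in>obj A. \<forall>Y\<in>obj A. \<forall>f\<in>Mor A X Y.
       cmp B (fob F X) (fob F Y) (fob G Y) (t Y) (fmor F X Y f) =
       cmp B (fob F X) (fob G X) (fob G Y) (fmor G X Y f) (t X))"

definition naturally_isomorphic ::
  "('o, 'm, 'k) cat \<Rightarrow> ('p, 'l, 'k) cat \<Rightarrow> ('o, 'm, 'p, 'l) fun_data \<Rightarrow> ('o, 'm, 'p, 'l) fun_data
   \<Rightarrow> bool" where
  "naturally_isomorphic A B F G \<longleftrightarrow>
    (\<exists>t. nat_transformation A B F G t \<and> (\<forall>X\<in>obj A. is_iso B (fob F X) (fob G X) (t X)))"

definition quasi_inverse ::
  "('o, 'm, 'k) cat \<Rightarrow> ('p, 'l, 'k) cat \<Rightarrow> ('o, 'm, 'p, 'l) fun_data \<Rightarrow> ('p, 'l, 'o, 'm) fun_data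
   \<Rightarrow> bool" where
  "quasi_inverse A B F G \<longleftrightarrow> is_functor B A G \<and>
    naturally_isomorphic A A (comp_functor G F) id_functor \<and>
    naturally_isomorphic B B id_functor (comp_functor F G)"

definition linear_equivalence ::
  "'k ring \<Rightarrow> ('o, 'm, 'k) cat \<Rightarrow> ('p, 'l, 'k) cat \<Rightarrow> ('o, 'm, 'p, 'l) fun_data \<Rightarrow> bool" where
  "linear_equivalence k A B F \<longleftrightarrow> is_linear_functor k A B F \<and> (\<exists>G. quasi_inverse A B F G)"

text \<open>\<open>L : A \<rightarrow> B\<close> is left adjoint to \<open>R : B \<rightarrow> A\<close> with unit \<open>u\<close> and counit \<open>e\<close>.\<close>

definition adjunction ::
  "('o, 'm, 'k) cat \<Rightarrow> ('p, 'l, 'k) cat \<Rightarrow> ('o, 'm, 'p, 'l) fun_data \<Rightarrow> ('p, 'l, 'o, 'm) fun_data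
   \<Rightarrow> ('o \<Rightarrow> 'm) \<Rightarrow> ('p \<Rightarrow> 'l) \<Rightarrow> bool" where
  "adjunction A B L R u e \<longleftrightarrow>
    is_functor A B L \<and> is_functor B A R \<and>
    nat_transformation A A id_functor (comp_functor R L) u \<and>
    nat_transformation B B (comp_functor L R) id_functor e \<and>
    (\<forall>X\<in>obj A. cmp B (fob L X) (fob L (fob R (fob L X))) (fob L X)
        (e (fob L X)) (fmor L X (fob R (fob L X)) (u X)) = idm B (fob L X)) \<and>
    (\<forall>Y\<in>obj B. cmp A (fob R Y) (fob R (fob L (fob R Y))) (fob R Y)
        (fmor R (fob L (fob R Y)) Y (e Y)) (u (fob R Y)) = idm A (fob R Y))"

section \<open>Extensions\<close>

text \<open>\<open>ext E C A\<close> is the group of extensions \<open>\<bbbE>(C, A)\<close>;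
  \<open>push E C A A' a : \<bbbE>(C, A) \<rightarrow> \<bbbE>(C, A')\<close> is \<open>\<delta> \<mapsto> a\<^sub>*\<delta>\<close> for \<open>a : A \<rightarrow> A'\<close> and
  \<open>pull E C' C A c : \<bbbE>(C, A) \<rightarrow> \<bbbE>(C', A)\<close> is \<open>\<delta> \<mapsto> c\<^sup>*\<delta>\<close> for \<open>c : C' \<rightarrow> C\<close>.\<close>

record ('o, 'm, 'k, 'e) ext_data =
  ext :: "'o \<Rightarrow> 'o \<Rightarrow> ('k, 'e) module"
  push :: "'o \<Rightarrow> 'o \<Rightarrow> 'o \<Rightarrow> 'm \<Rightarrow> 'e \<Rightarrow> 'e"
  pull :: "'o \<Rightarrow> 'o \<Rightarrow> 'o \<Rightarrow> 'm \<Rightarrow> 'e \<Rightarrow> 'e"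

abbreviation Ext :: "('o, 'm, 'k, 'e) ext_data \<Rightarrow> 'o \<Rightarrow> 'o \<Rightarrow> 'e set" where
  "Ext E X Y \<equiv> carrier (ext E X Y)"

abbreviation zext :: "('o, 'm, 'k, 'e) ext_data \<Rightarrow> 'o \<Rightarrow> 'o \<Rightarrow> 'e" where
  "zext E X Y \<equiv> ring.zero (ext E X Y)"

locale additive_bifunctor = preadditive_category C
  for C :: "('o, 'm, 'k) cat" and E :: "('o, 'm, 'k, 'e) ext_data" +
  assumes ext_group: "\<lbrakk>X \<in> obj C; A \<in> obj C\<rbrakk> \<Longrightarrow> abelian_group (ext E X A)"
    and push_closed: "\<lbrakk>X \<in> obj C; A \<in> obj C; B \<in> obj C; a \<in> Mor C A B; \<delta> \<in> Ext E X A\<rbrakk>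
      \<Longrightarrow> push E X A B a \<delta> \<in> Ext E X B"
    and pull_closed: "\<lbrakk>X \<in> obj C; Y \<in> obj C; A \<in> obj C; c \<in> Mor C X Y; \<delta> \<in> Ext E Y A\<rbrakk>
      \<Longrightarrow> pull E X Y A c \<delta> \<in> Ext E X A"
    and push_idm: "\<lbrakk>X \<in> obj C; A \<in> obj C; \<delta> \<in> Ext E X A\<rbrakk> \<Longrightarrow> push E X A A (idm C A) \<delta> = \<delta>"
    and pull_idm: "\<lbrakk>X \<in> obj C; A \<in> obj C; \<delta> \<in> Ext E X A\<rbrakk> \<Longrightarrow> pull E X X A (idm C X) \<delta> = \<delta>"
    and push_cmp: "\<lbrakk>X \<in> obj C; A \<in> obj C; B \<in> obj C; D \<in> obj C;
        a \<in> Mor C A B; b \<in> Mor C B D; \<delta> \<in> Ext E X A\<rbrakk>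
      \<Longrightarrow> push E X A D (cmp C A B D b a) \<delta> = push E X B D b (push E X A B a \<delta>)"
    and pull_cmp: "\<lbrakk>X \<in> obj C; Y \<in> obj C; Z \<in> obj C; A \<in> obj C;
        c \<in> Mor C X Y; d \<in> Mor C Y Z; \<delta> \<in> Ext E Z A\<rbrakk>
      \<Longrightarrow> pull E X Z A (cmp C X Y Z d c) \<delta> = pull E X Y A c (pull E Y Z A d \<delta>)"
    and push_pull: "\<lbrakk>X \<in> obj C; Y \<in> obj C; A \<in> obj C; B \<in> obj C;
        c \<in> Mor C X Y; a \<in> Mor C A B; \<delta> \<in> Ext E Y A\<rbrakk>
      \<Longrightarrow> push E X A B a (pull E X Y A c \<delta>) = pull E X Y B c (push E Y A B a \<delta>)"
    and push_add_ext: "\<lbrakk>X \<in> obj C; A \<in> obj C; B \<in> obj C;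
        a \<in> Mor C A B; \<delta> \<in> Ext E X A; \<delta>' \<in> Ext E X A\<rbrakk>
      \<Longrightarrow> push E X A B a (\<delta> \<oplus>\<^bsub>ext E X A\<^esub> \<delta>') = push E X A B a \<delta> \<oplus>\<^bsub>ext E X B\<^esub> push E X A B a \<delta>'"
    and pull_add_ext: "\<lbrakk>X \<in> obj C; Y \<in> obj C; A \<in> obj C;
        c \<in> Mor C X Y; \<delta> \<in> Ext E Y A; \<delta>' \<in> Ext E Y A\<rbrakk>
      \<Longrightarrow> pull E X Y A c (\<delta> \<oplus>\<^bsub>ext E Y A\<^esub> \<delta>') = pull E X Y A c \<delta> \<oplus>\<^bsub>ext E X A\<^esub> pull E X Y A c \<delta>'"
    and push_add_mor: "\<lbrakk>X \<in> obj C; A \<in> obj C; B \<in> obj C;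
        a \<in> Mor C A B; a' \<in> Mor C A B; \<delta> \<in> Ext E X A\<rbrakk>
      \<Longrightarrow> push E X A B (a \<oplus>\<^bsub>mor C A B\<^esub> a') \<delta> = push E X A B a \<delta> \<oplus>\<^bsub>ext E X B\<^esub> push E X A B a' \<delta>"
    and pull_add_mor: "\<lbrakk>X \<in> obj C; Y \<in> obj C; A \<in> obj C;
        c \<in> Mor C X Y; c' \<in> Mor C X Y; \<delta> \<in> Ext E Y A\<rbrakk>
      \<Longrightarrow> pull E X Y A (c \<oplus>\<^bsub>mor C X Y\<^esub> c') \<delta> = pull E X Y A c \<delta> \<oplus>\<^bsub>ext E X A\<^esub> pull E X Y A c' \<delta>"

text \<open>The composite of \<open>f : A \<rightarrow> B\<close>, \<open>\<delta> \<in> \<bbbE>(B, X)\<close> and \<open>g : X \<rightarrow> Y\<close> is \<open>g\<^sub>*f\<^sup>*\<delta> \<in> \<bbbE>(A, Y)\<close>.\<close>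

locale linear_bifunctor = linear_category k C + additive_bifunctor C E
  for k :: "'k ring" and C :: "('o, 'm, 'k) cat" and E :: "('o, 'm, 'k, 'e) ext_data" +
  assumes ext_module: "\<lbrakk>X \<in> obj C; A \<in> obj C\<rbrakk> \<Longrightarrow> module k (ext E X A)"
    and smult_pull: "\<lbrakk>A \<in> obj C; B \<in> obj C; X \<in> obj C; Y \<in> obj C;
        f \<in> Mor C A B; \<delta> \<in> Ext E B X; g \<in> Mor C X Y; r \<in> carrier k\<rbrakk>
      \<Longrightarrow> push E A X Y g (pull E A B X (r \<odot>\<^bsub>mor C A B\<^esub> f) \<delta>) =
          r \<odot>\<^bsub>ext E A Y\<^esub> push E A X Y g (pull E A B X f \<delta>)"
    and smult_ext: "\<lbrakk>A \<in> obj C; B \<in> obj C; X \<in> obj C; Y \<in> obj C;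
        f \<in> Mor C A B; \<delta> \<in> Ext E B X; g \<in> Mor C X Y; r \<in> carrier k\<rbrakk>
      \<Longrightarrow> push E A X Y g (pull E A B X f (r \<odot>\<^bsub>ext E B X\<^esub> \<delta>)) =
          r \<odot>\<^bsub>ext E A Y\<^esub> push E A X Y g (pull E A B X f \<delta>)"
    and smult_push: "\<lbrakk>A \<in> obj C; B \<in> obj C; X \<in> obj C; Y \<in> obj C;
        f \<in> Mor C A B; \<delta> \<in> Ext E B X; g \<in> Mor C X Y; r \<in> carrier k\<rbrakk>
      \<Longrightarrow> push E A X Y (r \<odot>\<^bsub>mor C X Y\<^esub> g) (pull E A B X f \<delta>) =
          r \<odot>\<^bsub>ext E A Y\<^esub> push E A X Y g (pull E A B X f \<delta>)"

definition ext_finite :: "'k ring \<Rightarrow> ('o, 'm, 'k) cat \<Rightarrow> ('o, 'm, 'k, 'e) ext_data \<Rightarrow> bool" where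
  "ext_finite k C E \<longleftrightarrow>
    (\<forall>X\<in>obj C. \<forall>Y\<in>obj C. finitely_generated k (ext E X Y) (Ext E X Y))"

section \<open>Complexes with \<open>n + 2\<close> terms\<close>

text \<open>A complex \<open>X\<^sub>0 \<rightarrow> X\<^sub>1 \<rightarrow> \<dots> \<rightarrow> X\<^bsub>n+1\<^esub>\<close> is stored in functions on \<^typ>\<open>nat\<close>, of which only the
  objects \<open>Ob X i\<close> with \<open>i \<le> n + 1\<close> and the differentials \<open>dif X i : X\<^sub>i \<rightarrow> X\<^bsub>i+1\<^esub>\<close> with \<open>i \<le> n\<close>
  are relevant; the same holds for morphisms of complexes.\<close>

record ('o, 'm) cplx =
  Ob :: "nat \<Rightarrow> 'o"
  dif :: "nat \<Rightarrow> 'm"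

definition is_complex :: "nat \<Rightarrow> ('o, 'm, 'k) cat \<Rightarrow> ('o, 'm) cplx \<Rightarrow> bool" where
  "is_complex n C X \<longleftrightarrow>
    (\<forall>i\<le>n+1. Ob X i \<in> obj C) \<and>
    (\<forall>i\<le>n. dif X i \<in> Mor C (Ob X i) (Ob X (i+1))) \<and>
    (\<forall>i<n. cmp C (Ob X i) (Ob X (i+1)) (Ob X (i+2)) (dif X (i+1)) (dif X i) =
       zmor C (Ob X i) (Ob X (i+2)))"

definition chain_map ::
  "nat \<Rightarrow> ('o, 'm, 'k) cat \<Rightarrow> ('o, 'm) cplx \<Rightarrow> ('o, 'm) cplx \<Rightarrow> (nat \<Rightarrow> 'm) \<Rightarrow> bool" where
  "chain_map n C X Y f \<longleftrightarrow>
    (\<forall>i\<le>n+1. f i \<in> Mor C (Ob X i) (Ob Y i)) \<and>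
    (\<forall>i\<le>n. cmp C (Ob X i) (Ob X (i+1)) (Ob Y (i+1)) (f (i+1)) (dif X i) =
       cmp C (Ob X i) (Ob Y i) (Ob Y (i+1)) (dif Y i) (f i))"

definition end_fixing_map ::
  "nat \<Rightarrow> ('o, 'm, 'k) cat \<Rightarrow> ('o, 'm) cplx \<Rightarrow> ('o, 'm) cplx \<Rightarrow> (nat \<Rightarrow> 'm) \<Rightarrow> bool" where
  "end_fixing_map n C X Y f \<longleftrightarrow> chain_map n C X Y f \<and>
    Ob X 0 = Ob Y 0 \<and> Ob X (n+1) = Ob Y (n+1) \<and>
    f 0 = idm C (Ob X 0) \<and> f (n+1) = idm C (Ob X (n+1))"

text \<open>The homotopy has components \<open>\<phi> i : X\<^sub>i \<rightarrow> Y\<^bsub>i-1\<^esub>\<close> for \<open>1 \<le> i \<le> n + 1\<close> only; in the end degrees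
  \<open>f\<close> and \<open>g\<close> agree, so the homotopy relation there reads \<open>0 = \<phi>\<^sub>1 d\<^sub>0\<close> and \<open>0 = d\<^sub>n \<phi>\<^bsub>n+1\<^esub>\<close>.\<close>

definition homotopic ::
  "nat \<Rightarrow> ('o, 'm, 'k) cat \<Rightarrow> ('o, 'm) cplx \<Rightarrow> ('o, 'm) cplx \<Rightarrow> (nat \<Rightarrow> 'm) \<Rightarrow> (nat \<Rightarrow> 'm) \<Rightarrow> bool"
  where
  "homotopic n C X Y f g \<longleftrightarrow> (\<exists>\<phi>.
    (\<forall>i\<in>{1..n+1}. \<phi> i \<in> Mor C (Ob X i) (Ob Y (i-1))) \<and>
    cmp C (Ob X 0) (Ob X 1) (Ob Y 0) (\<phi> 1) (dif X 0) = zmor C (Ob X 0) (Ob Y 0) \<and>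
    (\<forall>i\<in>{1..n}. f i \<ominus>\<^bsub>mor C (Ob X i) (Ob Y i)\<^esub> g i =
       cmp C (Ob X i) (Ob Y (i-1)) (Ob Y i) (dif Y (i-1)) (\<phi> i)
       \<oplus>\<^bsub>mor C (Ob X i) (Ob Y i)\<^esub>
       cmp C (Ob X i) (Ob X (i+1)) (Ob Y i) (\<phi> (i+1)) (dif X i)) \<and>
    cmp C (Ob X (n+1)) (Ob Y n) (Ob Y (n+1)) (dif Y n) (\<phi> (n+1)) =
      zmor C (Ob X (n+1)) (Ob Y (n+1)))"

definition homotopy_equivalent ::
  "nat \<Rightarrow> ('o, 'm, 'k) cat \<Rightarrow> ('o, 'm) cplx \<Rightarrow> ('o, 'm) cplx \<Rightarrow> bool" where
  "homotopy_equivalent n C X Y \<longleftrightarrow> (\<exists>f g.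
    end_fixing_map n C X Y f \<and> end_fixing_map n C Y X g \<and>
    homotopic n C X X (\<lambda>i. cmp C (Ob X i) (Ob Y i) (Ob X i) (g i) (f i)) (\<lambda>i. idm C (Ob X i)) \<and>
    homotopic n C Y Y (\<lambda>i. cmp C (Ob Y i) (Ob X i) (Ob Y i) (f i) (g i)) (\<lambda>i. idm C (Ob Y i)))"

definition homotopy_class :: "nat \<Rightarrow> ('o, 'm, 'k) cat \<Rightarrow> ('o, 'm) cplx \<Rightarrow> ('o, 'm) cplx set" where
  "homotopy_class n C X = {Y. is_complex n C Y \<and> homotopy_equivalent n C X Y}"

definition is_exangle ::
  "nat \<Rightarrow> ('o, 'm, 'k) cat \<Rightarrow> ('o, 'm, 'k, 'e) ext_data \<Rightarrow> ('o, 'm) cplx \<Rightarrow> 'e \<Rightarrow> bool" where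
  "is_exangle n C E X \<delta> \<longleftrightarrow>
    is_complex n C X \<and> \<delta> \<in> Ext E (Ob X (n+1)) (Ob X 0) \<and>
    push E (Ob X (n+1)) (Ob X 0) (Ob X 1) (dif X 0) \<delta> = zext E (Ob X (n+1)) (Ob X 1) \<and>
    pull E (Ob X n) (Ob X (n+1)) (Ob X 0) (dif X n) \<delta> = zext E (Ob X n) (Ob X 0) \<and>
    (\<forall>Z\<in>obj C.
      (\<forall>i\<in>{1..n}.
        {f \<in> Mor C Z (Ob X i). cmp C Z (Ob X i) (Ob X (i+1)) (dif X i) f = zmor C Z (Ob X (i+1))} =
        cmp C Z (Ob X (i-1)) (Ob X i) (dif X (i-1)) ` Mor C Z (Ob X (i-1))) \<and>
      {f \<in> Mor C Z (Ob X (n+1)). pull E Z (Ob X (n+1)) (Ob X 0) f \<delta> = zext E Z (Ob X 0)} =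
        cmp C Z (Ob X n) (Ob X (n+1)) (dif X n) ` Mor C Z (Ob X n)) \<and>
    (\<forall>Z\<in>obj C.
      (\<forall>i\<in>{1..n}.
        {f \<in> Mor C (Ob X i) Z. cmp C (Ob X (i-1)) (Ob X i) Z f (dif X (i-1)) = zmor C (Ob X (i-1)) Z} =
        (\<lambda>g. cmp C (Ob X i) (Ob X (i+1)) Z g (dif X i)) ` Mor C (Ob X (i+1)) Z) \<and>
      {f \<in> Mor C (Ob X 0) Z. push E (Ob X (n+1)) (Ob X 0) Z f \<delta> = zext E (Ob X (n+1)) Z} =
        (\<lambda>g. cmp C (Ob X 0) (Ob X 1) Z g (dif X 0)) ` Mor C (Ob X 1) Z)"

section \<open>\<open>n\<close>-exangulated categories\<close>

definition left_trivial_complex :: "('o, 'm, 'k) cat \<Rightarrow> 'o \<Rightarrow> 'o \<Rightarrow> ('o, 'm) cplx" where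
  "left_trivial_complex C Z A =
    (let ob = (\<lambda>i. if i \<le> 1 then A else Z)
     in \<lparr>Ob = ob, dif = (\<lambda>i. if i = 0 then idm C A else zmor C (ob i) (ob (i+1)))\<rparr>)"

definition right_trivial_complex :: "nat \<Rightarrow> ('o, 'm, 'k) cat \<Rightarrow> 'o \<Rightarrow> 'o \<Rightarrow> ('o, 'm) cplx" where
  "right_trivial_complex n C Z A =
    (let ob = (\<lambda>i. if i < n then Z else A)
     in \<lparr>Ob = ob, dif = (\<lambda>i. if i = n then idm C A else zmor C (ob i) (ob (i+1)))\<rparr>)"

text \<open>\<open>s C A \<delta>\<close> is the homotopy class realizing \<open>\<delta> \<in> \<bbbE>(C, A)\<close>.\<close>

type_synonym ('o, 'm, 'e) realization = "'o \<Rightarrow> 'o \<Rightarrow> 'e \<Rightarrow> ('o, 'm) cplx set"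

locale exact_realization = additive_category C + additive_bifunctor C E
  for n :: nat and C :: "('o, 'm, 'k) cat" and E :: "('o, 'm, 'k, 'e) ext_data"
    and s :: "('o, 'm, 'e) realization" +
  assumes realization_class: "\<lbrakk>A \<in> obj C; D \<in> obj C; \<delta> \<in> Ext E D A\<rbrakk> \<Longrightarrow>
      \<exists>X. is_complex n C X \<and> Ob X 0 = A \<and> Ob X (n+1) = D \<and> s D A \<delta> = homotopy_class n C X"
    and R0: "\<lbrakk>A \<in> obj C; B \<in> obj C; D \<in> obj C; F \<in> obj C; \<delta> \<in> Ext E D A; \<rho> \<in> Ext E F B;
        a \<in> Mor C A B; c \<in> Mor C D F; push E D A B a \<delta> = pull E D F B c \<rho>;
        X \<in> s D A \<delta>; Y \<in> s F B \<rho>\<rbrakk> \<Longrightarrow>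
      \<exists>f. chain_map n C X Y f \<and> f 0 = a \<and> f (n+1) = c"
    and R1: "\<lbrakk>A \<in> obj C; D \<in> obj C; \<delta> \<in> Ext E D A; X \<in> s D A \<delta>\<rbrakk> \<Longrightarrow> is_exangle n C E X \<delta>"
    and R2_left: "\<lbrakk>is_zero_object C Z; A \<in> obj C\<rbrakk> \<Longrightarrow>
      s Z A (zext E Z A) = homotopy_class n C (left_trivial_complex C Z A)"
    and R2_right: "\<lbrakk>is_zero_object C Z; A \<in> obj C\<rbrakk> \<Longrightarrow>
      s A Z (zext E A Z) = homotopy_class n C (right_trivial_complex n C Z A)"

definition distinguished ::
  "nat \<Rightarrow> ('o, 'm, 'k) cat \<Rightarrow> ('o, 'm, 'k, 'e) ext_data \<Rightarrow> ('o, 'm, 'e) realization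
   \<Rightarrow> ('o, 'm) cplx \<Rightarrow> 'e \<Rightarrow> bool" where
  "distinguished n C E s X \<delta> \<longleftrightarrow>
    Ob X 0 \<in> obj C \<and> Ob X (n+1) \<in> obj C \<and>
    \<delta> \<in> Ext E (Ob X (n+1)) (Ob X 0) \<and> X \<in> s (Ob X (n+1)) (Ob X 0) \<delta>"

definition inflation ::
  "nat \<Rightarrow> ('o, 'm, 'k) cat \<Rightarrow> ('o, 'm, 'k, 'e) ext_data \<Rightarrow> ('o, 'm, 'e) realization
   \<Rightarrow> 'o \<Rightarrow> 'o \<Rightarrow> 'm \<Rightarrow> bool" where
  "inflation n C E s A B f \<longleftrightarrow>
    (\<exists>X \<delta>. distinguished n C E s X \<delta> \<and> Ob X 0 = A \<and> Ob X 1 = B \<and> dif X 0 = f)"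

definition deflation ::
  "nat \<Rightarrow> ('o, 'm, 'k) cat \<Rightarrow> ('o, 'm, 'k, 'e) ext_data \<Rightarrow> ('o, 'm, 'e) realization
   \<Rightarrow> 'o \<Rightarrow> 'o \<Rightarrow> 'm \<Rightarrow> bool" where
  "deflation n C E s A B f \<longleftrightarrow>
    (\<exists>X \<delta>. distinguished n C E s X \<delta> \<and> Ob X n = A \<and> Ob X (n+1) = B \<and> dif X n = f)"

text \<open>The matrix entry \<open>p \<circ> d \<circ> i\<close> of \<open>d : S \<rightarrow> T\<close>, for \<open>i : A \<rightarrow> S\<close> and \<open>p : T \<rightarrow> B\<close>.\<close>

abbreviation entry ::
  "('o, 'm, 'k) cat \<Rightarrow> 'o \<Rightarrow> 'o \<Rightarrow> 'o \<Rightarrow> 'o \<Rightarrow> 'm \<Rightarrow> 'm \<Rightarrow> 'm \<Rightarrow> 'm" where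
  "entry C A S T B p d i \<equiv> cmp C A T B p (cmp C A S T d i)"

text \<open>Mapping cones are only determined up to the choice of the biproducts \<open>X\<^bsub>i+1\<^esub> \<oplus> Y\<^sub>i\<close>; different
  choices give isomorphic complexes, by isomorphisms that are the identity at both ends. The
  differentials are described by their matrix entries.\<close>

definition is_mapping_cone ::
  "nat \<Rightarrow> ('o, 'm, 'k) cat \<Rightarrow> ('o, 'm) cplx \<Rightarrow> ('o, 'm) cplx \<Rightarrow> (nat \<Rightarrow> 'm) \<Rightarrow> ('o, 'm) cplx \<Rightarrow> bool"
  where
  "is_mapping_cone n C X Y f M \<longleftrightarrow>
    is_complex n C M \<and> Ob M 0 = Ob X 1 \<and> Ob M (n+1) = Ob Y (n+1) \<and>
    (\<exists>i1 i2 p1 p2 :: nat \<Rightarrow> 'm.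
      (\<forall>i\<in>{1..n}. is_biproduct C (Ob X (i+1)) (Ob Y i) (Ob M i) (i1 i) (i2 i) (p1 i) (p2 i)) \<and>
      cmp C (Ob M 0) (Ob M 1) (Ob X 2) (p1 1) (dif M 0) = \<ominus>\<^bsub>mor C (Ob X 1) (Ob X 2)\<^esub> dif X 1 \<and>
      cmp C (Ob M 0) (Ob M 1) (Ob Y 1) (p2 1) (dif M 0) = f 1 \<and>
      (\<forall>i\<in>{1..<n}.
        entry C (Ob X (i+1)) (Ob M i) (Ob M (i+1)) (Ob X (i+2)) (p1 (i+1)) (dif M i) (i1 i) =
          \<ominus>\<^bsub>mor C (Ob X (i+1)) (Ob X (i+2))\<^esub> dif X (i+1) \<and>
        entry C (Ob Y i) (Ob M i) (Ob M (i+1)) (Ob X (i+2)) (p1 (i+1)) (dif M i) (i2 i) =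
          zmor C (Ob Y i) (Ob X (i+2)) \<and>
        entry C (Ob X (i+1)) (Ob M i) (Ob M (i+1)) (Ob Y (i+1)) (p2 (i+1)) (dif M i) (i1 i) =
          f (i+1) \<and>
        entry C (Ob Y i) (Ob M i) (Ob M (i+1)) (Ob Y (i+1)) (p2 (i+1)) (dif M i) (i2 i) =
          dif Y i) \<and>
      cmp C (Ob X (n+1)) (Ob M n) (Ob M (n+1)) (dif M n) (i1 n) = f (n+1) \<and>
      cmp C (Ob Y n) (Ob M n) (Ob M (n+1)) (dif M n) (i2 n) = dif Y n)"

text \<open>The mapping cocone of \<open>f : X \<rightarrow> Y\<close> is the mapping cone formed in the opposite category, that is
  the complex \<open>X\<^sub>0 \<rightarrow> X\<^sub>1 \<oplus> Y\<^sub>0 \<rightarrow> \<dots> \<rightarrow> X\<^sub>n \<oplus> Y\<^bsub>n-1\<^esub> \<rightarrow> Y\<^sub>n\<close>. Dualizing puts the signs on the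
  differentials of \<open>Y\<close>. For odd \<open>n\<close>, putting them on those of \<open>X\<close> instead would change the extension
  realized by the cocone into its negative.\<close>

definition is_mapping_cocone ::
  "nat \<Rightarrow> ('o, 'm, 'k) cat \<Rightarrow> ('o, 'm) cplx \<Rightarrow> ('o, 'm) cplx \<Rightarrow> (nat \<Rightarrow> 'm) \<Rightarrow> ('o, 'm) cplx \<Rightarrow> bool"
  where
  "is_mapping_cocone n C X Y f N \<longleftrightarrow>
    is_complex n C N \<and> Ob N 0 = Ob X 0 \<and> Ob N (n+1) = Ob Y n \<and>
    (\<exists>i1 i2 p1 p2 :: nat \<Rightarrow> 'm.
      (\<forall>i\<in>{1..n}. is_biproduct C (Ob X i) (Ob Y (i-1)) (Ob N i) (i1 i) (i2 i) (p1 i) (p2 i)) \<and>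
      cmp C (Ob N 0) (Ob N 1) (Ob X 1) (p1 1) (dif N 0) = dif X 0 \<and>
      cmp C (Ob N 0) (Ob N 1) (Ob Y 0) (p2 1) (dif N 0) = f 0 \<and>
      (\<forall>i\<in>{1..<n}.
        entry C (Ob X i) (Ob N i) (Ob N (i+1)) (Ob X (i+1)) (p1 (i+1)) (dif N i) (i1 i) =
          dif X i \<and>
        entry C (Ob Y (i-1)) (Ob N i) (Ob N (i+1)) (Ob X (i+1)) (p1 (i+1)) (dif N i) (i2 i) =
          zmor C (Ob Y (i-1)) (Ob X (i+1)) \<and>
        entry C (Ob X i) (Ob N i) (Ob N (i+1)) (Ob Y i) (p2 (i+1)) (dif N i) (i1 i) =
          f i \<and>
        entry C (Ob Y (i-1)) (Ob N i) (Ob N (i+1)) (Ob Y i) (p2 (i+1)) (dif N i) (i2 i) =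
          \<ominus>\<^bsub>mor C (Ob Y (i-1)) (Ob Y i)\<^esub> dif Y (i-1)) \<and>
      cmp C (Ob X n) (Ob N n) (Ob N (n+1)) (dif N n) (i1 n) = f n \<and>
      cmp C (Ob Y (n-1)) (Ob N n) (Ob N (n+1)) (dif N n) (i2 n) =
        \<ominus>\<^bsub>mor C (Ob Y (n-1)) (Ob Y n)\<^esub> dif Y (n-1))"

locale n_exangulated_category = exact_realization n C E s
  for n :: nat and C :: "('o, 'm, 'k) cat" and E :: "('o, 'm, 'k, 'e) ext_data"
    and s :: "('o, 'm, 'e) realization" +
  assumes EA1_inflation: "\<lbrakk>inflation n C E s A B f; inflation n C E s B D g\<rbrakk> \<Longrightarrow>
      inflation n C E s A D (cmp C A B D g f)"
    and EA1_deflation: "\<lbrakk>deflation n C E s A B f; deflation n C E s B D g\<rbrakk> \<Longrightarrow>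
      deflation n C E s A D (cmp C A B D g f)"
    and EA2: "\<lbrakk>A \<in> obj C; B \<in> obj C; D \<in> obj C; \<rho> \<in> Ext E D A; c \<in> Mor C B D;
        distinguished n C E s X (pull E B D A c \<rho>); Ob X 0 = A; Ob X (n+1) = B;
        distinguished n C E s Y \<rho>; Ob Y 0 = A; Ob Y (n+1) = D\<rbrakk> \<Longrightarrow>
      \<exists>f M. chain_map n C X Y f \<and> f 0 = idm C A \<and> f (n+1) = c \<and>
        is_mapping_cone n C X Y f M \<and>
        distinguished n C E s M (push E D A (Ob X 1) (dif X 0) \<rho>)"
    and EA2_op: "\<lbrakk>A \<in> obj C; B \<in> obj C; D \<in> obj C; \<rho> \<in> Ext E D A; a \<in> Mor C A B;
        distinguished n C E s X \<rho>; Ob X 0 = A; Ob X (n+1) = D;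
        distinguished n C E s Y (push E D A B a \<rho>); Ob Y 0 = B; Ob Y (n+1) = D\<rbrakk> \<Longrightarrow>
      \<exists>f N. chain_map n C X Y f \<and> f 0 = a \<and> f (n+1) = idm C D \<and>
        is_mapping_cocone n C X Y f N \<and>
        distinguished n C E s N (pull E (Ob Y n) D A (dif Y n) \<rho>)"

section \<open>Stable categories and Auslander-Reiten-Serre duality\<close>

definition proj_trivial ::
  "('o, 'm, 'k) cat \<Rightarrow> ('o, 'm, 'k, 'e) ext_data \<Rightarrow> 'o \<Rightarrow> 'o \<Rightarrow> 'm set" where
  "proj_trivial C E X Y =
    {f \<in> Mor C X Y. \<forall>Z\<in>obj C. \<forall>\<delta>\<in>Ext E Y Z. pull E X Y Z f \<delta> = zext E X Z}"

definition inj_trivial ::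
  "('o, 'm, 'k) cat \<Rightarrow> ('o, 'm, 'k, 'e) ext_data \<Rightarrow> 'o \<Rightarrow> 'o \<Rightarrow> 'm set" where
  "inj_trivial C E X Y =
    {g \<in> Mor C X Y. \<forall>Z\<in>obj C. \<forall>\<delta>\<in>Ext E Z X. push E Z X Y g \<delta> = zext E Z Y}"

abbreviation proj_stable ::
  "('o, 'm, 'k) cat \<Rightarrow> ('o, 'm, 'k, 'e) ext_data \<Rightarrow> ('o, 'm set, 'k) cat" where
  "proj_stable C E \<equiv> quotient_cat C (proj_trivial C E)"

abbreviation inj_stable ::
  "('o, 'm, 'k) cat \<Rightarrow> ('o, 'm, 'k, 'e) ext_data \<Rightarrow> ('o, 'm set, 'k) cat" where
  "inj_stable C E \<equiv> quotient_cat C (inj_trivial C E)"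

abbreviation proj_class ::
  "('o, 'm, 'k) cat \<Rightarrow> ('o, 'm, 'k, 'e) ext_data \<Rightarrow> 'o \<Rightarrow> 'o \<Rightarrow> 'm \<Rightarrow> 'm set" where
  "proj_class C E X Y f \<equiv> a_r_coset (mor C X Y) (proj_trivial C E X Y) f"

abbreviation inj_class ::
  "('o, 'm, 'k) cat \<Rightarrow> ('o, 'm, 'k, 'e) ext_data \<Rightarrow> 'o \<Rightarrow> 'o \<Rightarrow> 'm \<Rightarrow> 'm set" where
  "inj_class C E X Y f \<equiv> a_r_coset (mor C X Y) (inj_trivial C E X Y) f"

text \<open>\<open>\<Phi> X Y\<close> maps the dual of \<open>\<bbbE>(X, Y)\<close> to the morphisms \<open>Y \<rightarrow> \<tau>X\<close> of \<open>inj_stable C E\<close>. The dual of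
  \<open>\<bbbE>\<close> is covariant in \<open>X\<close> and contravariant in \<open>Y\<close>; the last two clauses are naturality.\<close>

definition ARS_duality ::
  "'k ring \<Rightarrow> ('k, 'j) module \<Rightarrow> ('o, 'm, 'k) cat \<Rightarrow> ('o, 'm, 'k, 'e) ext_data
   \<Rightarrow> ('o, 'm set, 'o, 'm set) fun_data \<Rightarrow> ('o \<Rightarrow> 'o \<Rightarrow> ('e \<Rightarrow> 'j) \<Rightarrow> 'm set) \<Rightarrow> bool" where
  "ARS_duality k J C E \<tau> \<Phi> \<longleftrightarrow>
    linear_equivalence k (proj_stable C E) (inj_stable C E) \<tau> \<and>
    (\<forall>X\<in>obj C. \<forall>Y\<in>obj C.
      linear_map k (dual_module k J (ext E X Y)) (mor (inj_stable C E) Y (fob \<tau> X)) (\<Phi> X Y) \<and>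
      bij_betw (\<Phi> X Y) (carrier (dual_module k J (ext E X Y))) (Mor (inj_stable C E) Y (fob \<tau> X))) \<and>
    (\<forall>X\<in>obj C. \<forall>X'\<in>obj C. \<forall>Y\<in>obj C. \<forall>x\<in>Mor C X X'.
      \<forall>\<phi>\<in>carrier (dual_module k J (ext E X Y)).
        \<Phi> X' Y (\<lambda>\<delta>\<in>Ext E X' Y. \<phi> (pull E X X' Y x \<delta>)) =
        cmp (inj_stable C E) Y (fob \<tau> X) (fob \<tau> X') (fmor \<tau> X X' (proj_class C E X X' x)) (\<Phi> X Y \<phi>)) \<and>
    (\<forall>X\<in>obj C. \<forall>Y\<in>obj C. \<forall>Y'\<in>obj C. \<forall>y\<in>Mor C Y Y'.
      \<forall>\<phi>\<in>carrier (dual_module k J (ext E X Y')).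
        \<Phi> X Y (\<lambda>\<delta>\<in>Ext E X Y. \<phi> (push E X Y Y' y \<delta>)) =
        cmp (inj_stable C E) Y Y' (fob \<tau> X) (\<Phi> X Y' \<phi>) (inj_class C E Y Y' y))"

text \<open>\<open>\<tau>'\<close> stands for the quasi-inverse \<open>\<tau>\<^sup>-\<close> and \<open>\<theta>\<close> for the counit \<open>\<tau>\<^sup>-\<tau> \<rightarrow> Id\<close>.\<close>

definition adj_iso ::
  "('o, 'm, 'k) cat \<Rightarrow> ('o, 'm, 'k, 'e) ext_data
   \<Rightarrow> ('o, 'm set, 'o, 'm set) fun_data \<Rightarrow> ('o, 'm set, 'o, 'm set) fun_data \<Rightarrow> ('o \<Rightarrow> 'm set)
   \<Rightarrow> 'o \<Rightarrow> 'o \<Rightarrow> 'm set \<Rightarrow> 'm set" where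
  "adj_iso C E \<tau> \<tau>' \<theta> X Y f =
    cmp (proj_stable C E) (fob \<tau>' Y) (fob \<tau>' (fob \<tau> X)) X (\<theta> X) (fmor \<tau>' Y (fob \<tau> X) f)"

definition Psi ::
  "('o, 'm, 'k) cat \<Rightarrow> ('o, 'm, 'k, 'e) ext_data
   \<Rightarrow> ('o, 'm set, 'o, 'm set) fun_data \<Rightarrow> ('o, 'm set, 'o, 'm set) fun_data \<Rightarrow> ('o \<Rightarrow> 'm set)
   \<Rightarrow> ('o \<Rightarrow> 'o \<Rightarrow> ('e \<Rightarrow> 'j) \<Rightarrow> 'm set) \<Rightarrow> 'o \<Rightarrow> 'o \<Rightarrow> ('e \<Rightarrow> 'j) \<Rightarrow> 'm set" where
  "Psi C E \<tau> \<tau>' \<theta> \<Phi> X Y = adj_iso C E \<tau> \<tau>' \<theta> X Y \<circ> \<Phi> X Y"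

section \<open>Right equivalence and determined morphisms\<close>

text \<open>Morphisms ending at \<open>Y\<close> are pairs \<open>(W, f)\<close> with \<open>f : W \<rightarrow> Y\<close>.\<close>

definition factors_through ::
  "('o, 'm, 'k) cat \<Rightarrow> 'o \<Rightarrow> 'o \<times> 'm \<Rightarrow> 'o \<times> 'm \<Rightarrow> bool" where
  "factors_through C Y = (\<lambda>(W, f) (W', f'). \<exists>g\<in>Mor C W W'. f = cmp C W W' Y f' g)"

definition right_class :: "('o, 'm, 'k) cat \<Rightarrow> 'o \<Rightarrow> 'o \<times> 'm \<Rightarrow> ('o \<times> 'm) set" where
  "right_class C Y p = {q. fst q \<in> obj C \<and> snd q \<in> Mor C (fst q) Y \<and>
     factors_through C Y p q \<and> factors_through C Y q p}"

definition right_class_le ::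
  "('o, 'm, 'k) cat \<Rightarrow> 'o \<Rightarrow> ('o \<times> 'm) set \<Rightarrow> ('o \<times> 'm) set \<Rightarrow> bool" where
  "right_class_le C Y c c' \<longleftrightarrow> (\<exists>p\<in>c. \<exists>q\<in>c'. factors_through C Y p q)"

definition right_determined :: "('o, 'm, 'k) cat \<Rightarrow> 'o \<Rightarrow> 'o \<Rightarrow> 'o \<times> 'm \<Rightarrow> bool" where
  "right_determined C K Y p \<longleftrightarrow>
    (\<forall>L\<in>obj C. \<forall>g\<in>Mor C L Y.
       (\<forall>h\<in>Mor C K L. factors_through C Y (K, cmp C K L Y g h) p) \<longrightarrow>
       factors_through C Y (L, g) p)"

definition def_classes ::
  "nat \<Rightarrow> ('o, 'm, 'k) cat \<Rightarrow> ('o, 'm, 'k, 'e) ext_data \<Rightarrow> ('o, 'm, 'e) realization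
   \<Rightarrow> 'o \<Rightarrow> ('o \<times> 'm) set set" where
  "def_classes n C E s Y = {right_class C Y (W, f) | W f. deflation n C E s W Y f}"

definition determined_def_classes ::
  "nat \<Rightarrow> ('o, 'm, 'k) cat \<Rightarrow> ('o, 'm, 'k, 'e) ext_data \<Rightarrow> ('o, 'm, 'e) realization
   \<Rightarrow> 'o \<Rightarrow> 'o \<Rightarrow> ('o \<times> 'm) set set" where
  "determined_def_classes n C E s K Y =
    {c \<in> def_classes n C E s Y. \<exists>p\<in>c. right_determined C K Y p}"

definition add_def_classes ::
  "nat \<Rightarrow> ('o, 'm, 'k) cat \<Rightarrow> ('o, 'm, 'k, 'e) ext_data \<Rightarrow> ('o, 'm, 'e) realization
   \<Rightarrow> 'o \<Rightarrow> 'o \<Rightarrow> ('o \<times> 'm) set set" where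
  "add_def_classes n C E s X Y =
    {c \<in> def_classes n C E s Y. \<exists>Z \<delta>. distinguished n C E s Z \<delta> \<and> Ob Z (n+1) = Y \<and>
       (Ob Z n, dif Z n) \<in> c \<and> Ob Z 0 \<in> add_closure C X}"

section \<open>The three maps\<close>

text \<open>\<open>\<bbbE>(Y, X)\<close> as a module over \<open>End(X)\<close>.\<close>

definition ext_End_module ::
  "('o, 'm, 'k, 'e) ext_data \<Rightarrow> 'o \<Rightarrow> 'o \<Rightarrow> ('m, 'e) module" where
  "ext_End_module E Y X =
    \<lparr>carrier = Ext E Y X, monoid.mult = undefined, monoid.one = undefined,
     ring.zero = zext E Y X, ring.add = ring.add (ext E Y X), smult = push E Y X X\<rparr>"

text \<open>The morphisms from \<open>K\<close> to \<open>Y\<close> in the stable category as a module over the opposite of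
  \<open>End(K)\<close>, acting by precomposition.\<close>

definition stable_End_module ::
  "('o, 'm, 'k) cat \<Rightarrow> ('o, 'm, 'k, 'e) ext_data \<Rightarrow> 'o \<Rightarrow> 'o \<Rightarrow> ('m, 'm set) module" where
  "stable_End_module C E K Y =
    \<lparr>carrier = Mor (proj_stable C E) K Y, monoid.mult = undefined, monoid.one = undefined,
     ring.zero = zmor (proj_stable C E) K Y, ring.add = ring.add (mor (proj_stable C E) K Y),
     smult = (\<lambda>a U. cmp (proj_stable C E) K K Y U (proj_class C E K K a))\<rparr>"

abbreviation sub_ext ::
  "('o, 'm, 'k) cat \<Rightarrow> ('o, 'm, 'k, 'e) ext_data \<Rightarrow> 'o \<Rightarrow> 'o \<Rightarrow> 'e set set" where
  "sub_ext C E Y X \<equiv> fg_submodules (End_ring C X) (ext_End_module E Y X)"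

abbreviation sub_stable ::
  "('o, 'm, 'k) cat \<Rightarrow> ('o, 'm, 'k, 'e) ext_data \<Rightarrow> 'o \<Rightarrow> 'o \<Rightarrow> 'm set set set" where
  "sub_stable C E K Y \<equiv> fg_submodules (op_ring (End_ring C K)) (stable_End_module C E K Y)"

text \<open>\<open>\<eta>\<close> and \<open>\<xi>\<close> are functions on right equivalence classes; the value at a class is the common value
  at its representatives.\<close>

definition eta ::
  "('o, 'm, 'k) cat \<Rightarrow> ('o, 'm, 'k, 'e) ext_data \<Rightarrow> 'o \<Rightarrow> 'o \<Rightarrow> ('o \<times> 'm) set \<Rightarrow> 'm set set" where
  "eta C E K Y c = (THE H. \<exists>W f. (W, f) \<in> c \<and>
     H = proj_class C E K Y ` (cmp C K W Y f ` Mor C K W))"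

definition xi ::
  "nat \<Rightarrow> ('o, 'm, 'k) cat \<Rightarrow> ('o, 'm, 'k, 'e) ext_data \<Rightarrow> ('o, 'm, 'e) realization
   \<Rightarrow> 'o \<Rightarrow> 'o \<Rightarrow> ('o \<times> 'm) set \<Rightarrow> 'e set" where
  "xi n C E s X Y c = (THE F. \<exists>Z \<delta>. distinguished n C E s Z \<delta> \<and> Ob Z (n+1) = Y \<and>
     (Ob Z n, dif Z n) \<in> c \<and>
     F = (\<lambda>g. push E Y (Ob Z 0) X g \<delta>) ` Mor C (Ob Z 0) X)"

text \<open>The kernel of \<open>D(i) \<Psi>\<^sup>-\<^sup>1\<close>, where \<open>D(i)\<close> restricts functionals on \<open>\<bbbE>(Y, X)\<close> to \<open>F\<close>. As sets of
  stable morphisms, the submodules over the opposites of \<open>End(X)\<close> and of \<open>End(\<tau>\<^sup>-X)\<close> are the same, so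
  no translation between them is needed.\<close>

definition Upsilon ::
  "'k ring \<Rightarrow> ('k, 'j) module \<Rightarrow> ('o, 'm, 'k) cat \<Rightarrow> ('o, 'm, 'k, 'e) ext_data
   \<Rightarrow> ('o, 'm set, 'o, 'm set) fun_data \<Rightarrow> ('o, 'm set, 'o, 'm set) fun_data \<Rightarrow> ('o \<Rightarrow> 'm set)
   \<Rightarrow> ('o \<Rightarrow> 'o \<Rightarrow> ('e \<Rightarrow> 'j) \<Rightarrow> 'm set) \<Rightarrow> 'o \<Rightarrow> 'o \<Rightarrow> 'e set \<Rightarrow> 'm set set" where
  "Upsilon k J C E \<tau> \<tau>' \<theta> \<Phi> X Y F =
    {h \<in> Mor (proj_stable C E) (fob \<tau>' X) Y.
       restrict (inv_into (carrier (dual_module k J (ext E Y X))) (Psi C E \<tau> \<tau>' \<theta> \<Phi> Y X) h) F =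
       \<zero>\<^bsub>dual_module k J ((ext E Y X)\<lparr>carrier := F\<rparr>)\<^esub>}"

end

theory Submission
  imports Defs
begin

text \<open>Write \<open>K X\<close> for \<open>\<tau>\<^sup>-X\<close>. Auslander-Reiten-Serre duality is used through a single functional \<open>t\<close> on
\<open>\<bbbE>(K X, X)\<close> for every object \<open>X\<close>, the one that \<open>\<Psi>\<close> sends to the identity of \<open>K X\<close>. Naturality of \<open>\<Psi>\<close>
shows that \<open>\<langle>h, \<delta>\<rangle> = t(h\<^sup>*\<delta>)\<close> is a pairing of the stable morphisms \<open>h : K X \<rightarrow> Y\<close> with \<open>\<bbbE>(Y, X)\<close> by
which every functional on \<open>\<bbbE>(Y, X)\<close> is \<open>\<langle>h, -\<rangle>\<close> for exactly one stable \<open>h\<close>. Naturality in the other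
variable, and fullness of \<open>\<tau>\<^sup>-\<close>, make each \<open>e : K X \<rightarrow> K X'\<close> adjoint to some \<open>g : X \<rightarrow> X'\<close>, in the sense
that \<open>\<langle>h e, \<delta>\<rangle> = \<langle>h, g\<^sub>*\<delta>\<rangle>\<close>. The locale \<open>serre_trace\<close> records these facts, and the rest of the
argument takes place there.

In these terms \<open>\<Upsilon>(F)\<close> is the annihilator of \<open>F\<close>. Since \<open>J\<close> is an injective cogenerator, \<open>F\<close> is
recovered from its annihilator (\<open>coann_ann\<close>). Conversely, an \<open>End(K X)\<close>-submodule \<open>H\<close> is recovered
from the extensions that it annihilates, and it is finitely generated
(\<open>right_submodule_closed_and_finite\<close>): by the descending chain condition in \<open>\<bbbE>(Y, X)\<close>, a single
morphism \<open>f : S \<rightarrow> Y\<close> built from finitely many elements of \<open>H\<close> kills exactly those extensions; a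
functional that vanishes on them factors through \<open>f\<^sup>*\<close>, extends to \<open>\<bbbE>(S, X)\<close>, is therefore
represented by some \<open>u : K X \<rightarrow> S\<close>, and so corresponds to \<open>f u\<close>.

Let \<open>f\<close> be a deflation with end \<open>Y\<close> and extension \<open>\<delta> \<in> \<bbbE>(Y, A)\<close>. A morphism \<open>h\<close> to \<open>Y\<close> factors through \<open>f\<close>
if and only if \<open>h\<^sup>*\<delta> = 0\<close>. For \<open>h : K X \<rightarrow> Y\<close> this means that all functionals \<open>\<langle>e, -\<rangle>\<close> with
\<open>e : K A \<rightarrow> K X\<close> vanish at \<open>h\<^sup>*\<delta>\<close>; by adjointness their values are the \<open>\<langle>h, g\<^sub>*\<delta>\<rangle>\<close> with \<open>g : A \<rightarrow> X\<close>. Hence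
\<open>\<eta>(f)\<close> is the annihilator of \<open>\<xi>(f)\<close> (\<open>ann_orbit\<close>), which is the commutativity of the triangle, and it
holds for all deflations.

If \<open>A\<close> lies in \<open>add X\<close>, the same test with the roles of the objects changed shows that \<open>f\<close> is right
\<open>K X\<close>-determined (\<open>add_closure_determined\<close>). A deflation factors through a right \<open>K X\<close>-determined one
as soon as its \<open>\<eta>\<close>-value is contained in that of the latter (\<open>right_determined_factors\<close>), so \<open>\<eta>\<close> is
injective and reflects the order on determined classes. Finally, \<open>\<bbbE>(Y, X)\<close> is a noetherian module
(\<open>submodule_finitely_generated\<close>), so every submodule \<open>F\<close> is generated by finitely many extensions
\<open>\<delta>\<^sub>1, \<dots>, \<delta>\<^sub>m\<close>, and the deflation realizing \<open>(\<delta>\<^sub>1, \<dots>, \<delta>\<^sub>m) \<in> \<bbbE>(Y, X\<^sup>m)\<close> has \<open>\<xi>\<close>-value \<open>F\<close>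
(\<open>submodule_is_orbit\<close>). Taking for \<open>F\<close> the submodule annihilated by a given \<open>H\<close> gives surjectivity of
\<open>\<eta>\<close>; taking for \<open>F\<close> the \<open>\<xi>\<close>-value of a given determined deflation gives a right equivalent deflation
with first term in \<open>add X\<close>.\<close>

section \<open>Modules over a commutative artinian ring\<close>

definition sum_cyclic :: "'k ring \<Rightarrow> ('k, 'a) module \<Rightarrow> 'a set \<Rightarrow> 'a \<Rightarrow> 'a set" where
  "sum_cyclic k M U m = {u \<oplus>\<^bsub>M\<^esub> r \<odot>\<^bsub>M\<^esub> m | u r. u \<in> U \<and> r \<in> carrier k}"

context
  fixes k :: "'k ring" and M :: "('k, 'a) module" (structure)
  assumes mod: "module k M"
begin

interpretation module k M by (rule mod)

lemma zero_submodule: "submodule {\<zero>} k M"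
  by (rule submoduleI) auto

lemma submodule_Int:
  assumes "submodule A k M" "submodule B k M" shows "submodule (A \<inter> B) k M"
proof (rule submoduleI)
  show "\<zero> \<in> A \<inter> B"
    using assms subgroup.one_closed[OF submodule.axioms(1)] by fastforce
qed (use submoduleE[OF assms(1)] submoduleE[OF assms(2)] in auto)

lemma submodule_zero: "submodule A k M \<Longrightarrow> \<zero> \<in> A"
  using subgroup.one_closed[OF submodule.axioms(1)] by fastforce

lemma submodule_minus:
  "\<lbrakk>submodule A k M; x \<in> A; y \<in> A\<rbrakk> \<Longrightarrow> x \<ominus> y \<in> A"
  using submoduleE[of A] by (simp add: M.minus_eq)

lemma sum_cyclic_rearrange:
  assumes "u \<in> carrier M" "u' \<in> carrier M" "r \<in> carrier k" "r' \<in> carrier k" "m \<in> carrier M"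
  shows "(u \<oplus> r \<odot> m) \<oplus> (u' \<oplus> r' \<odot> m) = (u \<oplus> u') \<oplus> (r \<oplus>\<^bsub>k\<^esub> r') \<odot> m"
  using assms by (simp add: smult_l_distr M.add.m_ac)

lemma sum_cyclic_submodule:
  assumes U: "submodule U k M" and m: "m \<in> carrier M"
  shows "submodule (sum_cyclic k M U m) k M"
proof -
  note s = submoduleE[OF U] submodule_zero[OF U]
  show ?thesis
  proof (rule submoduleI)
    show "sum_cyclic k M U m \<subseteq> carrier M"
      using s(1) m by (auto simp: sum_cyclic_def)
    show "\<zero> \<in> sum_cyclic k M U m"
      unfolding sum_cyclic_def using submodule_zero[OF U] m
      by (auto intro!: exI[of _ "\<zero>"] exI[of _ "\<zero>\<^bsub>k\<^esub>"])
  next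
    fix a assume "a \<in> sum_cyclic k M U m"
    then obtain u r where a: "a = u \<oplus> r \<odot> m" "u \<in> U" "r \<in> carrier k"
      by (auto simp: sum_cyclic_def)
    have "\<ominus> a = (\<ominus> u) \<oplus> (\<ominus>\<^bsub>k\<^esub> r) \<odot> m"
      using a(2,3) s(1) m unfolding a(1) by (auto simp: subset_iff smult_l_minus M.minus_add)
    then show "\<ominus> a \<in> sum_cyclic k M U m"
      unfolding sum_cyclic_def using a(3) s(3)[OF a(2)] by blast
  next
    fix a b assume "a \<in> sum_cyclic k M U m" "b \<in> sum_cyclic k M U m"
    then obtain u r u' r' where a: "a = u \<oplus> r \<odot> m" "u \<in> U" "r \<in> carrier k"
      and b: "b = u' \<oplus> r' \<odot> m" "u' \<in> U" "r' \<in> carrier k"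
      by (auto simp: sum_cyclic_def)
    have "a \<oplus> b = (u \<oplus> u') \<oplus> (r \<oplus>\<^bsub>k\<^esub> r') \<odot> m"
      using a b s(1) m sum_cyclic_rearrange by blast
    then show "a \<oplus> b \<in> sum_cyclic k M U m"
      unfolding sum_cyclic_def using a(3) b(3) s(5)[OF a(2) b(2)] by blast
  next
    fix c a assume c: "c \<in> carrier k" and "a \<in> sum_cyclic k M U m"
    then obtain u r where a: "a = u \<oplus> r \<odot> m" "u \<in> U" "r \<in> carrier k"
      by (auto simp: sum_cyclic_def)
    have "c \<odot> a = c \<odot> u \<oplus> (c \<otimes>\<^bsub>k\<^esub> r) \<odot> m"
      using a(2,3) s(1) m c unfolding a(1) by (auto simp: subset_iff smult_r_distr smult_assoc1)
    then show "c \<odot> a \<in> sum_cyclic k M U m"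
      unfolding sum_cyclic_def using a(3) c s(4)[OF c a(2)] by blast
  qed
qed

lemma sum_cyclic_superset:
  assumes U: "submodule U k M" and m: "m \<in> carrier M"
  shows "U \<subseteq> sum_cyclic k M U m"
proof
  fix u assume u: "u \<in> U"
  then have "u = u \<oplus> \<zero>\<^bsub>k\<^esub> \<odot> m"
    using submoduleE(1)[OF U] m by auto
  then show "u \<in> sum_cyclic k M U m" unfolding sum_cyclic_def using u R.zero_closed by blast
qed

lemma sum_cyclic_generator:
  assumes U: "submodule U k M" and m: "m \<in> carrier M"
  shows "m \<in> sum_cyclic k M U m"
proof -
  have "m = \<zero> \<oplus> \<one>\<^bsub>k\<^esub> \<odot> m" using m by simp
  then show ?thesis unfolding sum_cyclic_def using submodule_zero[OF U] R.one_closed by blast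
qed

text \<open>For \<open>N \<subseteq> U + k m\<close> this is the image of \<open>N\<close> in the quotient \<open>(U + k m)/U\<close>, described by the ideal of
coefficients of \<open>m\<close>. With \<open>U = 0\<close> it is the ideal \<open>{r. r m \<in> N}\<close> on which functionals are extended
and separated below.\<close>

lemma coefficient_ideal:
  assumes U: "submodule U k M" and N: "submodule N k M" and m: "m \<in> carrier M"
  shows "ideal {r \<in> carrier k. \<exists>u\<in>U. u \<oplus> r \<odot> m \<in> N} k" (is "ideal ?I k")
proof -
  note u = submoduleE[OF U] submodule_zero[OF U]
  note n = submoduleE[OF N] submodule_zero[OF N]
  have sub: "subgroup ?I (add_monoid k)"
  proof (rule R.add.subgroupI)
    show "?I \<subseteq> carrier k" by auto
    have "\<zero>\<^bsub>k\<^esub> \<in> ?I" using submodule_zero[OF U] submodule_zero[OF N] m by (auto intro!: bexI[of _ "\<zero>"])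
    then show "?I \<noteq> {}" by blast
  next
    fix r assume "r \<in> ?I"
    then obtain x where x: "x \<in> U" "x \<oplus> r \<odot> m \<in> N" and r: "r \<in> carrier k" by auto
    have "\<ominus> (x \<oplus> r \<odot> m) = (\<ominus> x) \<oplus> (\<ominus>\<^bsub>k\<^esub> r) \<odot> m"
      using x(1) r u(1) m by (auto simp: subset_iff smult_l_minus M.minus_add)
    then show "\<ominus>\<^bsub>k\<^esub> r \<in> ?I" using n(3)[OF x(2)] u(3)[OF x(1)] r by (simp only: mem_Collect_eq R.a_inv_closed) (metis)
  next
    fix r r' assume "r \<in> ?I" "r' \<in> ?I"
    then obtain x x' where x: "x \<in> U" "x \<oplus> r \<odot> m \<in> N" "r \<in> carrier k"
      and x': "x' \<in> U" "x' \<oplus> r' \<odot> m \<in> N" "r' \<in> carrier k" by auto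
    have "(x \<oplus> x') \<oplus> (r \<oplus>\<^bsub>k\<^esub> r') \<odot> m \<in> N"
      using n(5)[OF x(2) x'(2)] sum_cyclic_rearrange[of x x' r r' m] x(1,3) x'(1,3) u(1) m
      by (metis subsetD)
    then show "r \<oplus>\<^bsub>k\<^esub> r' \<in> ?I" using u(5)[OF x(1) x'(1)] R.a_closed[OF x(3) x'(3)] by blast
  qed
  show ?thesis
  proof (rule idealI)
    show "ring k" by (rule R.ring_axioms)
    show "subgroup ?I (add_monoid k)" by (rule sub)
  next
    fix a c assume "a \<in> ?I" and c: "c \<in> carrier k"
    then obtain x where x: "x \<in> U" "x \<oplus> a \<odot> m \<in> N" and a: "a \<in> carrier k" by auto
    have "c \<odot> (x \<oplus> a \<odot> m) = c \<odot> x \<oplus> (c \<otimes>\<^bsub>k\<^esub> a) \<odot> m"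
      using x(1) a c u(1) m by (auto simp: subset_iff smult_r_distr smult_assoc1)
    then show "c \<otimes>\<^bsub>k\<^esub> a \<in> ?I" using n(4)[OF c x(2)] u(4)[OF c x(1)] R.m_closed[OF c a] by (simp only: mem_Collect_eq) metis
    then show "a \<otimes>\<^bsub>k\<^esub> c \<in> ?I" using R.m_comm[OF a c] by simp
  qed
qed

definition chains_stop_in :: "'a set \<Rightarrow> bool" where
  "chains_stop_in U \<longleftrightarrow> (\<forall>N :: nat \<Rightarrow> 'a set. (\<forall>i. submodule (N i) k M \<and> N i \<subseteq> U) \<longrightarrow>
     (\<forall>i. N (Suc i) \<subseteq> N i) \<longrightarrow> (\<exists>b. \<forall>i\<ge>b. N i = N b))"

text \<open>A descending chain in \<open>U + k m\<close> is controlled by its intersections with \<open>U\<close> and by its coefficient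
ideals, and both of these become stationary.\<close>

lemma chains_stop_in_sum_cyclic:
  assumes art: "artinian_ring k" and U: "submodule U k M" and m: "m \<in> carrier M"
    and stop: "chains_stop_in U"
  shows "chains_stop_in (sum_cyclic k M U m)"
  unfolding chains_stop_in_def
proof (intro allI impI)
  fix N :: "nat \<Rightarrow> 'a set"
  assume N: "\<forall>i. submodule (N i) k M \<and> N i \<subseteq> sum_cyclic k M U m"
    and desc: "\<forall>i. N (Suc i) \<subseteq> N i"
  define I where "I i = {r \<in> carrier k. \<exists>u\<in>U. u \<oplus> r \<odot> m \<in> N i}" for i
  have "\<exists>b. \<forall>i\<ge>b. N i \<inter> U = N b \<inter> U"
    using stop unfolding chains_stop_in_def
    apply (rule allE[of _ "\<lambda>i. N i \<inter> U"]) using N desc U submodule_Int by blast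
  then obtain a where a: "\<forall>i\<ge>a. N i \<inter> U = N a \<inter> U" by blast
  have "\<forall>i. ideal (I i) k" unfolding I_def using coefficient_ideal U N m by blast
  moreover have "\<forall>i. I (Suc i) \<subseteq> I i" unfolding I_def using desc by blast
  ultimately obtain b where b: "\<forall>i\<ge>b. I i = I b"
    using art unfolding artinian_ring_def by meson
  define c where "c = max a b"
  have mono: "N j \<subseteq> N i" if "i \<le> j" for i j
    using lift_Suc_antimono_le[of N, OF _ that] desc by blast
  have "N c \<subseteq> N i" if i: "c \<le> i" for i
  proof
    fix x assume x: "x \<in> N c"
    then obtain u r where ur: "x = u \<oplus> r \<odot> m" "u \<in> U" "r \<in> carrier k"
      using N unfolding sum_cyclic_def by blast
    then have "r \<in> I c" using x unfolding I_def by blast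
    moreover have "I c = I i" using b i unfolding c_def by (metis max.boundedE max.cobounded2)
    ultimately have "r \<in> I i" by simp
    then obtain u' where u': "u' \<in> U" "u' \<oplus> r \<odot> m \<in> N i" unfolding I_def by blast
    have Ni: "submodule (N i) k M" "submodule (N c) k M" using N by auto
    have car: "u \<in> carrier M" "u' \<in> carrier M" "r \<odot> m \<in> carrier M"
      using ur u' m submoduleE(1)[OF U] by auto
    have eq: "x \<ominus> (u' \<oplus> r \<odot> m) = u \<ominus> u'"
      using car ur(1) by (simp add: M.minus_eq M.minus_add M.add.m_ac M.r_neg2 M.r_neg M.r_neg1)
    have "x \<ominus> (u' \<oplus> r \<odot> m) \<in> N c"
      using submodule_minus[OF Ni(2) x] u'(2) mono[OF i] by blast
    moreover have "u \<ominus> u' \<in> U" using submodule_minus[OF U] ur u' by blast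
    ultimately have "x \<ominus> (u' \<oplus> r \<odot> m) \<in> N c \<inter> U" using eq by simp
    moreover have "N c \<inter> U = N i \<inter> U"
      using a i unfolding c_def by (metis max.boundedE max.cobounded1)
    ultimately have d: "x \<ominus> (u' \<oplus> r \<odot> m) \<in> N i" by blast
    have "x = (x \<ominus> (u' \<oplus> r \<odot> m)) \<oplus> (u' \<oplus> r \<odot> m)"
      using car ur(1) by (simp add: M.minus_eq M.add.m_assoc M.l_neg)
    then show "x \<in> N i" using submoduleE(5)[OF Ni(1) d u'(2)] by simp
  qed
  then have "\<forall>i\<ge>c. N i = N c" using mono by blast
  then show "\<exists>b. \<forall>i\<ge>b. N i = N b" by blast
qed

text \<open>A finitely generated module is reached from any submodule by finitely many steps \<open>U \<mapsto> U + k m\<close>.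
Both the chain condition and the extendability of functionals pass along such a step.\<close>

lemma finite_generation_induct:
  assumes fg: "finitely_generated k M (carrier M)" and N: "submodule N k M" and base: "P N"
    and step: "\<And>U m. \<lbrakk>submodule U k M; N \<subseteq> U; m \<in> carrier M; P U\<rbrakk> \<Longrightarrow> P (sum_cyclic k M U m)"
  shows "P (carrier M)"
proof -
  obtain G where G: "finite G" "G \<subseteq> carrier M"
    and gen: "\<forall>K. submodule K k M \<and> G \<subseteq> K \<longrightarrow> carrier M \<subseteq> K"
    using fg unfolding finitely_generated_def by (elim exE conjE)
  have "\<exists>U. submodule U k M \<and> N \<subseteq> U \<and> G \<subseteq> U \<and> P U"
    using G(1,2)
  proof (induction G rule: finite_induct)
    case empty
    show ?case by (intro exI[of _ N] conjI N base subset_refl empty_subsetI)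
  next
    case (insert m G)
    then obtain U where U: "submodule U k M" "N \<subseteq> U" "G \<subseteq> U" "P U"
      using insert.IH insert.prems by (meson insert_subset)
    have m: "m \<in> carrier M" using insert.prems by simp
    let ?S = "sum_cyclic k M U m"
    have "submodule ?S k M" "P ?S" "U \<subseteq> ?S" "m \<in> ?S"
      by (fact sum_cyclic_submodule[OF U(1) m] step[OF U(1,2) m U(4)]
          sum_cyclic_superset[OF U(1) m] sum_cyclic_generator[OF U(1) m])+
    with U(2,3) show ?case by (meson insert_subset subset_trans)
  qed
  then obtain U where U: "submodule U k M" "G \<subseteq> U" "P U" by (elim exE conjE)
  then have "U = carrier M" using gen[rule_format, OF conjI, OF U(1,2)] submoduleE(1)[OF U(1)] by (intro subset_antisym)
  then show ?thesis using U by simp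
qed

text \<open>Finitely generated modules over an artinian ring are artinian, here in the form of the minimum
condition.\<close>

lemma ex_minimal_submodule:
  assumes art: "artinian_ring k" and fg: "finitely_generated k M (carrier M)"
    and A: "A \<in> \<A>" and sub: "\<And>A. A \<in> \<A> \<Longrightarrow> submodule A k M"
  shows "\<exists>A\<in>\<A>. \<forall>B\<in>\<A>. B \<subseteq> A \<longrightarrow> B = A"
proof -
  have stop: "chains_stop_in (carrier M)"
  proof (rule finite_generation_induct[OF fg zero_submodule])
    show "chains_stop_in {\<zero>}"
      unfolding chains_stop_in_def using submodule_zero by (metis subset_singletonD empty_iff)
  qed (rule chains_stop_in_sum_cyclic[OF art])
  have "wf {(A, B). A \<in> \<A> \<and> B \<in> \<A> \<and> A \<subset> B}"
    unfolding wf_iff_no_infinite_down_chain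
  proof (rule notI, elim exE)
    fix N assume N: "\<forall>i. (N (Suc i), N i) \<in> {(A, B). A \<in> \<A> \<and> B \<in> \<A> \<and> A \<subset> B}"
    then have "\<forall>i. submodule (N i) k M" "\<forall>i. N (Suc i) \<subseteq> N i" using sub by auto
    moreover from this have "\<forall>i. N i \<subseteq> carrier M" using submoduleE(1) by blast
    ultimately obtain b where "\<forall>i\<ge>b. N i = N b"
      using stop unfolding chains_stop_in_def by meson
    then have "N (Suc b) = N b" by (meson le_SucI order_refl)
    moreover have "N (Suc b) \<subset> N b" using N by simp
    ultimately show False by simp
  qed
  then show ?thesis
  proof (rule wfE_min[OF _ A])
    fix B
    assume B: "B \<in> \<A>" and min: "\<And>A. (A, B) \<in> {(A, B). A \<in> \<A> \<and> B \<in> \<A> \<and> A \<subset> B} \<Longrightarrow> A \<notin> \<A>"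
    have "A = B" if "A \<in> \<A>" "A \<subseteq> B" for A using min[of A] B that by (auto simp: psubset_eq)
    then show ?thesis using B by (intro bexI[of _ B]) simp_all
  qed
qed

lemma smult_image_submodule:
  assumes N: "submodule N k M" and r: "r \<in> carrier k"
  shows "submodule ((\<lambda>x. r \<odot> x) ` N) k M"
proof (rule submoduleI)
  have Nc: "x \<in> carrier M" if "x \<in> N" for x using that submoduleE(1)[OF N] by blast
  show "(\<lambda>x. r \<odot> x) ` N \<subseteq> carrier M" using Nc r by blast
  show "\<zero> \<in> (\<lambda>x. r \<odot> x) ` N"
    using submodule_zero[OF N] r by (auto intro!: image_eqI[of _ _ "\<zero>"])
  show "\<ominus> a \<in> (\<lambda>x. r \<odot> x) ` N" if a: "a \<in> (\<lambda>x. r \<odot> x) ` N" for a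
  proof -
    obtain x where x: "x \<in> N" "a = r \<odot> x" using a by blast
    then have "\<ominus> a = r \<odot> (\<ominus> x)" using Nc r by (simp add: smult_r_minus)
    then show ?thesis using submoduleE(3)[OF N x(1)] by blast
  qed
  show "a \<oplus> b \<in> (\<lambda>x. r \<odot> x) ` N"
    if ab: "a \<in> (\<lambda>x. r \<odot> x) ` N" "b \<in> (\<lambda>x. r \<odot> x) ` N" for a b
  proof -
    obtain x y where x: "x \<in> N" "a = r \<odot> x" "y \<in> N" "b = r \<odot> y" using ab by blast
    then have "a \<oplus> b = r \<odot> (x \<oplus> y)" using Nc r by (simp add: smult_r_distr)
    then show ?thesis using submoduleE(5)[OF N x(1,3)] by blast
  qed
  show "c \<odot> a \<in> (\<lambda>x. r \<odot> x) ` N" if c: "c \<in> carrier k" and a: "a \<in> (\<lambda>x. r \<odot> x) ` N" for c a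
  proof -
    obtain x where x: "x \<in> N" "a = r \<odot> x" using a by blast
    then have "c \<odot> a = r \<odot> (c \<odot> x)"
      using Nc r c R.m_comm[OF r c] by (simp add: smult_assoc1[symmetric])
    then show ?thesis using submoduleE(4)[OF N c x(1)] by blast
  qed
qed

lemma smult_kernel_submodule:
  assumes N: "submodule N k M" and r: "r \<in> carrier k"
  shows "submodule {x \<in> N. r \<odot> x = \<zero>} k M"
proof (rule submoduleI)
  have Nc: "x \<in> carrier M" if "x \<in> N" for x using that submoduleE(1)[OF N] by blast
  show "{x \<in> N. r \<odot> x = \<zero>} \<subseteq> carrier M" using Nc by blast
  show "\<zero> \<in> {x \<in> N. r \<odot> x = \<zero>}" using submodule_zero[OF N] r by simp
  show "\<ominus> a \<in> {x \<in> N. r \<odot> x = \<zero>}" if "a \<in> {x \<in> N. r \<odot> x = \<zero>}" for a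
    using that Nc r submoduleE(3)[OF N] by (simp add: smult_r_minus)
  show "a \<oplus> b \<in> {x \<in> N. r \<odot> x = \<zero>}"
    if "a \<in> {x \<in> N. r \<odot> x = \<zero>}" "b \<in> {x \<in> N. r \<odot> x = \<zero>}" for a b
    using that Nc r submoduleE(5)[OF N] by (simp add: smult_r_distr)
  show "c \<odot> a \<in> {x \<in> N. r \<odot> x = \<zero>}"
    if c: "c \<in> carrier k" and a: "a \<in> {x \<in> N. r \<odot> x = \<zero>}" for c a
  proof -
    have "r \<odot> (c \<odot> a) = c \<odot> (r \<odot> a)"
      using Nc[of a] r c a R.m_comm[OF r c] by (metis (lifting) mem_Collect_eq smult_assoc1)
    then show ?thesis using a c submoduleE(4)[OF N c] by simp
  qed
qed

lemma finitely_generated_by_image_and_kernel: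
  assumes N: "submodule N k M" and r: "r \<in> carrier k"
    and image: "finitely_generated k M ((\<lambda>x. r \<odot> x) ` N)"
    and ker: "finitely_generated k M {x \<in> N. r \<odot> x = \<zero>}"
  shows "finitely_generated k M N"
proof -
  obtain G1 where G1: "finite G1" "G1 \<subseteq> (\<lambda>x. r \<odot> x) ` N"
    and gen1: "\<forall>K. submodule K k M \<and> G1 \<subseteq> K \<longrightarrow> (\<lambda>x. r \<odot> x) ` N \<subseteq> K"
    using image unfolding finitely_generated_def by (elim exE conjE)
  obtain G2 where G2: "finite G2" "G2 \<subseteq> {x \<in> N. r \<odot> x = \<zero>}"
    and gen2: "\<forall>K. submodule K k M \<and> G2 \<subseteq> K \<longrightarrow> {x \<in> N. r \<odot> x = \<zero>} \<subseteq> K"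
    using ker unfolding finitely_generated_def by (elim exE conjE)
  obtain G3 where G3: "finite G3" "G3 \<subseteq> N" "G1 = (\<lambda>x. r \<odot> x) ` G3"
    using finite_subset_image[OF G1] by (elim exE conjE)
  have "N \<subseteq> K" if K: "submodule K k M" "G2 \<union> G3 \<subseteq> K" for K
  proof
    fix x assume x: "x \<in> N"
    have KN: "submodule (K \<inter> N) k M" by (rule submodule_Int[OF K(1) N])
    have "G1 \<subseteq> (\<lambda>x. r \<odot> x) ` (K \<inter> N)" using G3 K(2) by auto
    then have "(\<lambda>x. r \<odot> x) ` N \<subseteq> (\<lambda>x. r \<odot> x) ` (K \<inter> N)"
      using gen1 smult_image_submodule[OF KN r] by simp
    then obtain y where y: "y \<in> K" "y \<in> N" "r \<odot> x = r \<odot> y" using x by fast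
    have car: "x \<in> carrier M" "y \<in> carrier M" using x y submoduleE(1)[OF N] by auto
    have "r \<odot> (x \<ominus> y) = r \<odot> x \<ominus> r \<odot> y"
      using car r by (simp add: M.minus_eq smult_r_distr smult_r_minus)
    also have "\<dots> = \<zero>" using y car r by (simp add: M.minus_eq M.r_neg)
    finally have "x \<ominus> y \<in> {x \<in> N. r \<odot> x = \<zero>}"
      using submodule_minus[OF N x y(2)] by simp
    then have d: "x \<ominus> y \<in> K" using gen2 K by blast
    have "x = (x \<ominus> y) \<oplus> y" using car by (simp add: M.minus_eq M.add.m_assoc M.l_neg)
    then show "x \<in> K" using submoduleE(5)[OF K(1) d y(1)] by simp
  qed
  then show ?thesis unfolding finitely_generated_def
    using G2 G3 by (intro exI[of _ "G2 \<union> G3"] conjI allI impI) auto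
qed

lemma finitely_generated_sum_cyclic:
  assumes U: "submodule U k M" and m: "m \<in> carrier M" and fg: "finitely_generated k M U"
  shows "finitely_generated k M (sum_cyclic k M U m)"
proof -
  obtain G where G: "finite G" "G \<subseteq> U" and gen: "\<forall>K. submodule K k M \<and> G \<subseteq> K \<longrightarrow> U \<subseteq> K"
    using fg unfolding finitely_generated_def by (elim exE conjE)
  have "sum_cyclic k M U m \<subseteq> K" if K: "submodule K k M" "insert m G \<subseteq> K" for K
  proof
    fix x assume "x \<in> sum_cyclic k M U m"
    then obtain u r where x: "x = u \<oplus> r \<odot> m" "u \<in> U" "r \<in> carrier k"
      unfolding sum_cyclic_def by blast
    have "u \<in> K" using gen K x(2) by blast
    moreover have "r \<odot> m \<in> K" using submoduleE(4)[OF K(1) x(3)] K(2) by simp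
    ultimately show "x \<in> K" unfolding x(1) by (rule submoduleE(5)[OF K(1)])
  qed
  then show ?thesis unfolding finitely_generated_def
    using G sum_cyclic_superset[OF U m] sum_cyclic_generator[OF U m]
    by (intro exI[of _ "insert m G"] conjI allI impI) auto
qed

text \<open>The powers of \<open>r\<close> generate a descending chain of ideals, so \<open>r\<^sup>b = s r\<^bsup>b+1\<^esup>\<close> for some \<open>b\<close> and \<open>s\<close>. As \<open>r\<^sup>b\<close>
maps \<open>N\<close> onto itself, \<open>s\<close> inverts \<open>r\<close> on \<open>N\<close>.\<close>

lemma artinian_ring_regular_inverse:
  assumes art: "artinian_ring k" and N: "N \<subseteq> carrier M" and r: "r \<in> carrier k"
    and onto: "(\<lambda>x. r \<odot> x) ` N = N"
  shows "\<exists>s\<in>carrier k. \<forall>x\<in>N. s \<odot> (r \<odot> x) = x"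
proof -
  define I where "I i = PIdl\<^bsub>k\<^esub> (r [^]\<^bsub>k\<^esub> i)" for i :: nat
  have "\<forall>i. ideal (I i) k" unfolding I_def using R.cgenideal_ideal r by simp
  moreover have "\<forall>i. I (Suc i) \<subseteq> I i"
  proof (intro allI subsetI)
    fix i x assume "x \<in> I (Suc i)"
    then obtain c where c: "c \<in> carrier k" "x = c \<otimes>\<^bsub>k\<^esub> r [^]\<^bsub>k\<^esub> Suc i"
      unfolding I_def cgenideal_def by blast
    then have "x = (c \<otimes>\<^bsub>k\<^esub> r) \<otimes>\<^bsub>k\<^esub> r [^]\<^bsub>k\<^esub> i" using r by (simp add: R.m_ac)
    then show "x \<in> I i" unfolding I_def cgenideal_def using c(1) r by blast
  qed
  ultimately obtain b where b: "\<forall>i\<ge>b. I i = I b"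
    using art unfolding artinian_ring_def by meson
  have "r [^]\<^bsub>k\<^esub> b \<in> I b" unfolding I_def using R.cgenideal_self r by simp
  moreover have "I (Suc b) = I b" using b by (meson le_SucI order_refl)
  ultimately obtain s where s: "s \<in> carrier k" "r [^]\<^bsub>k\<^esub> b = s \<otimes>\<^bsub>k\<^esub> r [^]\<^bsub>k\<^esub> (Suc b)"
    unfolding I_def cgenideal_def by blast
  have pow: "(\<lambda>x. r [^]\<^bsub>k\<^esub> i \<odot> x) ` N = N" for i :: nat
  proof (induction i)
    case 0 then show ?case using N by (force simp: subset_iff)
  next
    case (Suc i)
    have "(\<lambda>x. r [^]\<^bsub>k\<^esub> Suc i \<odot> x) ` N = (\<lambda>x. r [^]\<^bsub>k\<^esub> i \<odot> x) ` ((\<lambda>x. r \<odot> x) ` N)"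
      unfolding image_image using N r by (intro image_cong refl) (auto simp: subset_iff smult_assoc1)
    then show ?case unfolding onto Suc .
  qed
  have "s \<odot> (r \<odot> x) = x" if "x \<in> N" for x
  proof -
    have "x \<in> (\<lambda>x. r [^]\<^bsub>k\<^esub> b \<odot> x) ` N" unfolding pow by (rule that)
    then obtain y where y: "y \<in> N" "x = r [^]\<^bsub>k\<^esub> b \<odot> y" by (elim imageE)
    have yc: "y \<in> carrier M" using y N by blast
    have "s \<odot> (r \<odot> x) = (s \<otimes>\<^bsub>k\<^esub> r [^]\<^bsub>k\<^esub> (Suc b)) \<odot> y"
      unfolding y(2) using yc s(1) r by (simp add: smult_assoc1[symmetric] R.m_comm)
    then show ?thesis unfolding s(2)[symmetric] y(2)[symmetric] .
  qed
  then show ?thesis using s(1) by blast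
qed

text \<open>A form of the theorem of Hopkins and Levitzki. If it fails, there is a minimal submodule \<open>N\<close> that
is not finitely generated. Each \<open>r \<in> k\<close> acts on \<open>N\<close> either as zero or, by
\<open>finitely_generated_by_image_and_kernel\<close> and minimality, surjectively and hence invertibly; so \<open>N\<close>
is in effect a vector space. A subspace \<open>U\<close> maximal among those not containing some \<open>x \<noteq> 0\<close> then
satisfies \<open>N = U + k x\<close>. But \<open>U\<close> is finitely generated as a proper submodule of \<open>N\<close>, and so \<open>N\<close> is
finitely generated after all.\<close>

lemma submodule_finitely_generated:
  assumes art: "artinian_ring k" and fg: "finitely_generated k M (carrier M)"
    and N0: "submodule N0 k M"
  shows "finitely_generated k M N0"
proof (rule ccontr)
  assume notfg: "\<not> finitely_generated k M N0"
  define \<A> where "\<A> = {N. submodule N k M \<and> \<not> finitely_generated k M N}"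
  have "N0 \<in> \<A>" using N0 notfg unfolding \<A>_def by simp
  from ex_minimal_submodule[OF art fg this] obtain N where NA: "N \<in> \<A>"
    and min: "\<forall>B\<in>\<A>. B \<subseteq> N \<longrightarrow> B = N" unfolding \<A>_def by blast
  have N: "submodule N k M" and Nfg: "\<not> finitely_generated k M N" using NA unfolding \<A>_def by auto
  have proper: "finitely_generated k M B" if "submodule B k M" "B \<subseteq> N" "B \<noteq> N" for B
    using that min unfolding \<A>_def by blast
  have Nc: "N \<subseteq> carrier M" by (rule submoduleE(1)[OF N])
  have invertible: "\<exists>s\<in>carrier k. \<forall>x\<in>N. s \<odot> (r \<odot> x) = x"
    if r: "r \<in> carrier k" and z: "z \<in> N" "r \<odot> z \<noteq> \<zero>" for r z
  proof -
    let ?rN = "(\<lambda>x. r \<odot> x) ` N" and ?K = "{x \<in> N. r \<odot> x = \<zero>}"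
    have "?K \<noteq> N" using z by blast
    then have "finitely_generated k M ?K" by (intro proper smult_kernel_submodule[OF N r]) auto
    then have "\<not> finitely_generated k M ?rN"
      using finitely_generated_by_image_and_kernel[OF N r] Nfg by blast
    moreover have "?rN \<subseteq> N" using submoduleE(4)[OF N r] by blast
    ultimately have "?rN = N" using proper[OF smult_image_submodule[OF N r]] by blast
    then show ?thesis by (rule artinian_ring_regular_inverse[OF art Nc r])
  qed
  have zfg: "finitely_generated k M {\<zero>}"
    unfolding finitely_generated_def using submodule_zero by (intro exI[of _ "{}"]) auto
  have "N \<noteq> {\<zero>}" using zfg Nfg by auto
  then obtain x where x: "x \<in> N" "x \<noteq> \<zero>" using submodule_zero[OF N] by blast
  define \<U> where "\<U> = {U. submodule U k M \<and> U \<subseteq> N \<and> x \<notin> U}"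
  have "{\<zero>} \<in> \<U>" unfolding \<U>_def using zero_submodule submodule_zero[OF N] x by simp
  then have ne: "\<U> \<noteq> {}" by blast
  have "\<Union>\<C> \<in> \<U>" if C: "\<C> \<noteq> {}" "subset.chain \<U> \<C>" for \<C>
  proof -
    have sub: "submodule U k M" "U \<subseteq> N" "x \<notin> U" if "U \<in> \<C>" for U
      using that C unfolding \<U>_def subset_chain_def by auto
    have "submodule (\<Union>\<C>) k M"
    proof (rule submoduleI)
      show "\<Union>\<C> \<subseteq> carrier M" using sub Nc by blast
      show "\<zero> \<in> \<Union>\<C>" using C(1) sub(1) submodule_zero by blast
      show "\<ominus> a \<in> \<Union>\<C>" if "a \<in> \<Union>\<C>" for a using that sub(1) submoduleE(3) by blast
      show "r \<odot> a \<in> \<Union>\<C>" if "r \<in> carrier k" "a \<in> \<Union>\<C>" for r a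
        using that sub(1) submoduleE(4) by blast
      show "a \<oplus> b \<in> \<Union>\<C>" if ab: "a \<in> \<Union>\<C>" "b \<in> \<Union>\<C>" for a b
      proof -
        obtain A B where AB: "A \<in> \<C>" "B \<in> \<C>" "a \<in> A" "b \<in> B" using ab by blast
        then have "A \<subseteq> B \<or> B \<subseteq> A" using C(2) unfolding subset_chain_def by blast
        then obtain D where D: "D \<in> \<C>" "a \<in> D" "b \<in> D" using AB by blast
        then show ?thesis using submoduleE(5)[OF sub(1)[OF D(1)] D(2,3)] by blast
      qed
    qed
    then show ?thesis unfolding \<U>_def using sub by blast
  qed
  then obtain U where U: "U \<in> \<U>" and maxU: "\<forall>V\<in>\<U>. U \<subseteq> V \<longrightarrow> V = U"
    using subset_Zorn_nonempty[OF ne] by meson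
  have Us: "submodule U k M" "U \<subseteq> N" "x \<notin> U" using U unfolding \<U>_def by auto
  have xc: "x \<in> carrier M" using x Nc by blast
  have "N \<subseteq> sum_cyclic k M U x"
  proof
    fix y assume y: "y \<in> N"
    have yc: "y \<in> carrier M" using y Nc by blast
    show "y \<in> sum_cyclic k M U x"
    proof (cases "y \<in> U")
      case True then show ?thesis using sum_cyclic_superset[OF Us(1) xc] by blast
    next
      case False
      let ?V = "sum_cyclic k M U y"
      have "?V \<subseteq> N"
        unfolding sum_cyclic_def using Us(2) submoduleE(4)[OF N _ y] submoduleE(5)[OF N] by blast
      moreover have "U \<subseteq> ?V" "?V \<noteq> U"
        using False sum_cyclic_superset[OF Us(1) yc] sum_cyclic_generator[OF Us(1) yc] by auto
      ultimately have "x \<in> ?V"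
        using maxU sum_cyclic_submodule[OF Us(1) yc] unfolding \<U>_def by blast
      then obtain u r where ur: "x = u \<oplus> r \<odot> y" "u \<in> U" "r \<in> carrier k"
        unfolding sum_cyclic_def by blast
      have uc: "u \<in> carrier M" using ur submoduleE(1)[OF Us(1)] by blast
      have "r \<odot> y \<noteq> \<zero>" using ur Us(3) uc by auto
      then obtain s where s: "s \<in> carrier k" "\<forall>x\<in>N. s \<odot> (r \<odot> x) = x"
        using invertible[OF ur(3) y] by blast
      \<comment> \<open>Maximality of \<open>U\<close> gave \<open>x = u + r y\<close>, which can be solved for \<open>y\<close> because \<open>r\<close> is invertible on \<open>N\<close>.\<close>
      have "s \<odot> x = s \<odot> u \<oplus> y"
        unfolding ur(1) using s y uc yc ur(3) by (simp add: smult_r_distr)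
      then have "y = (\<ominus> (s \<odot> u)) \<oplus> s \<odot> x"
        using s(1) uc yc by (simp add: M.r_neg1)
      then show ?thesis
        unfolding sum_cyclic_def
        using submoduleE(3)[OF Us(1) submoduleE(4)[OF Us(1) s(1) ur(2)]] s(1) by blast
    qed
  qed
  moreover have "sum_cyclic k M U x \<subseteq> N"
    unfolding sum_cyclic_def using Us(2) submoduleE(4)[OF N _ x(1)] submoduleE(5)[OF N] by blast
  ultimately have "N = sum_cyclic k M U x" by (intro subset_antisym)
  moreover have "finitely_generated k M U" using proper[OF Us(1,2)] Us(3) x(1) by blast
  ultimately show False using finitely_generated_sum_cyclic[OF Us(1) xc] Nfg by simp
qed

end

section \<open>Functionals with values in an injective cogenerator\<close>

text \<open>The structure of \<open>M\<close> carried over along an injection \<open>e\<close>. It moves ideals of \<open>k\<close> to the type \<^typ>\<open>'k set\<close>,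
where the test modules for injectivity live.\<close>

definition transport_module :: "('a \<Rightarrow> 'b) \<Rightarrow> ('k, 'a) module \<Rightarrow> ('k, 'b) module" where
  "transport_module e M =
    \<lparr>carrier = e ` carrier M, monoid.mult = undefined, monoid.one = undefined,
     ring.zero = e \<zero>\<^bsub>M\<^esub>,
     ring.add = (\<lambda>x y. e (inv_into (carrier M) e x \<oplus>\<^bsub>M\<^esub> inv_into (carrier M) e y)),
     smult = (\<lambda>r x. e (r \<odot>\<^bsub>M\<^esub> inv_into (carrier M) e x))\<rparr>"

lemma transport_module_is_module:
  assumes "module k M" and inj: "inj_on e (carrier M)"
  shows "module k (transport_module e M)"
proof -
  interpret module k M by fact
  note [simp] = inv_into_f_f[OF inj]
  show ?thesis
  proof (rule moduleI)
    show "abelian_group (transport_module e M)"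
    proof (rule abelian_groupI)
      fix x assume "x \<in> carrier (transport_module e M)"
      then obtain a where a: "a \<in> carrier M" "x = e a" by (auto simp: transport_module_def)
      then show "\<exists>y\<in>carrier (transport_module e M).
          y \<oplus>\<^bsub>transport_module e M\<^esub> x = \<zero>\<^bsub>transport_module e M\<^esub>"
        by (auto simp: transport_module_def M.l_neg intro!: bexI[of _ "\<ominus>\<^bsub>M\<^esub> a"])
    qed (auto simp: transport_module_def M.a_ac)
  qed (auto simp: transport_module_def smult_l_distr smult_r_distr smult_assoc1 R.is_cring)
qed

definition ideal_module :: "'k ring \<Rightarrow> 'k set \<Rightarrow> ('k, 'k) module" where
  "ideal_module k I = \<lparr>carrier = I, monoid.mult = undefined, monoid.one = undefined,
     ring.zero = \<zero>\<^bsub>k\<^esub>, ring.add = ring.add k, smult = monoid.mult k\<rparr>"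

lemma ideal_module_is_module:
  assumes "cring k" and "ideal I k"
  shows "module k (ideal_module k I)"
proof -
  interpret cring k by fact
  interpret ideal I k by fact
  show ?thesis
  proof (rule moduleI)
    show "abelian_group (ideal_module k I)"
    proof (rule abelian_groupI)
      fix x assume "x \<in> carrier (ideal_module k I)"
      then show "\<exists>y\<in>carrier (ideal_module k I). y \<oplus>\<^bsub>ideal_module k I\<^esub> x = \<zero>\<^bsub>ideal_module k I\<^esub>"
        by (auto simp: ideal_module_def l_neg intro!: bexI[of _ "\<ominus>\<^bsub>k\<^esub> x"])
    qed (auto simp: ideal_module_def a_ac)
  qed (auto simp: ideal_module_def l_distr r_distr m_assoc I_l_closed is_cring)
qed

text \<open>One half of Baer's criterion: a functional on an ideal extends to \<open>k\<close>, and functionals on \<open>k\<close> are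
given by their value at \<open>1\<close>.\<close>

lemma linear_functional_on_ideal:
  assumes k: "cring k" and J: "injective_module k J" and I: "ideal I k"
    and h: "linear_map k (ideal_module k I) J h"
  shows "\<exists>j\<in>carrier J. \<forall>r\<in>I. h r = r \<odot>\<^bsub>J\<^esub> j"
proof -
  interpret cring k by fact
  interpret ideal I k by fact
  let ?e = "\<lambda>r. {r}"
  let ?M = "transport_module ?e (ideal_module k I)"
  let ?N = "transport_module ?e (ideal_module k (carrier k))"
  have inj: "inj_on ?e A" for A by simp
  have M: "module k ?M" by (rule transport_module_is_module[OF ideal_module_is_module[OF k I] inj])
  have N: "module k ?N"
    by (rule transport_module_is_module[OF ideal_module_is_module[OF k oneideal] inj])
  have cI: "carrier (ideal_module k I) = I" and ck: "carrier (ideal_module k (carrier k)) = carrier k"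
    by (simp_all add: ideal_module_def)
  have inv: "inv_into A ?e {r} = r" if "r \<in> A" for r :: 'a and A using inv_into_f_f[OF inj that] .
  have "linear_map k ?M ?N (\<lambda>x. x)"
    using a_Hcarr by (auto simp: linear_map_def transport_module_def cI ck inv)
      (auto simp: ideal_module_def)
  moreover have "linear_map k ?M J (\<lambda>x. h (the_elem x))"
    using h by (auto simp: linear_map_def transport_module_def cI inv Pi_iff)
  ultimately obtain g where g: "linear_map k ?N J g"
    and gh: "\<And>x. x \<in> carrier ?M \<Longrightarrow> g x = h (the_elem x)"
    using J M N unfolding injective_module_def by (metis inj_on_id2)
  have one: "{\<one>\<^bsub>k\<^esub>} \<in> carrier ?N" by (simp add: transport_module_def ck)
  have "h r = r \<odot>\<^bsub>J\<^esub> g {\<one>\<^bsub>k\<^esub>}" if r: "r \<in> I" for r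
  proof -
    have rk: "r \<in> carrier k" using r a_Hcarr by blast
    have "h r = g {r}" using gh[of "{r}"] r by (simp add: transport_module_def cI)
    also have "{r} = r \<odot>\<^bsub>?N\<^esub> {\<one>\<^bsub>k\<^esub>}"
      using rk inv[of "\<one>\<^bsub>k\<^esub>" "carrier k"] by (simp add: transport_module_def ck) (simp add: ideal_module_def)
    also have "g \<dots> = r \<odot>\<^bsub>J\<^esub> g {\<one>\<^bsub>k\<^esub>}"
      using g rk one unfolding linear_map_def by blast
    finally show ?thesis .
  qed
  moreover have "g {\<one>\<^bsub>k\<^esub>} \<in> carrier J" using g one unfolding linear_map_def by blast
  ultimately show ?thesis by blast
qed

text \<open>Such elements are the values at \<open>1\<close> of functionals on the nonzero cyclic module \<open>k/A\<close>.\<close>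

lemma nonzero_element_killed_by_ideal:
  assumes k: "cring k" and J: "cogenerator_module k J" and A: "ideal A k" and proper: "\<one>\<^bsub>k\<^esub> \<notin> A"
  shows "\<exists>j\<in>carrier J. j \<noteq> \<zero>\<^bsub>J\<^esub> \<and> (\<forall>r\<in>A. r \<odot>\<^bsub>J\<^esub> j = \<zero>\<^bsub>J\<^esub>)"
proof -
  interpret cring k by fact
  interpret ideal A k by fact
  interpret J: module k J using J unfolding cogenerator_module_def by blast
  define Q where "Q = k Quot A"
  interpret Q: cring Q unfolding Q_def by (rule quotient_is_cring) fact
  interpret h: ring_hom_ring k Q "(+>\<^bsub>k\<^esub>) A" unfolding Q_def by (rule rcos_ring_hom_ring)
  define M :: "('a, 'a set) module" where
    "M = \<lparr>carrier = carrier Q, monoid.mult = undefined, monoid.one = undefined, ring.zero = \<zero>\<^bsub>Q\<^esub>, ring.add = ring.add Q, smult = (\<lambda>r U. (A +>\<^bsub>k\<^esub> r) \<otimes>\<^bsub>Q\<^esub> U)\<rparr>"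
  have M: "module k M"
  proof (rule moduleI)
    show "abelian_group M"
    proof (rule abelian_groupI)
      fix x assume "x \<in> carrier M"
      then show "\<exists>y\<in>carrier M. y \<oplus>\<^bsub>M\<^esub> x = \<zero>\<^bsub>M\<^esub>"
        by (auto simp: M_def Q.l_neg intro!: bexI[of _ "\<ominus>\<^bsub>Q\<^esub> x"])
    qed (auto simp: M_def Q.a_ac)
  qed (auto simp: M_def Q.l_distr Q.r_distr Q.m_assoc is_cring)
  have one: "\<one>\<^bsub>Q\<^esub> \<in> carrier M" by (simp add: M_def)
  have "\<one>\<^bsub>Q\<^esub> \<noteq> \<zero>\<^bsub>M\<^esub>"
  proof -
    have "\<one>\<^bsub>k\<^esub> \<in> A +>\<^bsub>k\<^esub> \<one>\<^bsub>k\<^esub>" by (rule a_rcos_self) simp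
    then show ?thesis using proper unfolding M_def Q_def FactRing_def by auto
  qed
  then obtain f where f: "linear_map k M J f" "f \<one>\<^bsub>Q\<^esub> \<noteq> \<zero>\<^bsub>J\<^esub>"
    using J M one unfolding cogenerator_module_def by blast
  have "r \<odot>\<^bsub>J\<^esub> f \<one>\<^bsub>Q\<^esub> = \<zero>\<^bsub>J\<^esub>" if r: "r \<in> A" for r
  proof -
    have rk: "r \<in> carrier k" using r a_Hcarr by blast
    have "A +>\<^bsub>k\<^esub> r = A +>\<^bsub>k\<^esub> \<zero>\<^bsub>k\<^esub>"
      using a_rcos_const[OF r] a_rcos_const[OF additive_subgroup.zero_closed[OF is_additive_subgroup]] by simp
    then have smult: "r \<odot>\<^bsub>M\<^esub> U = \<zero>\<^bsub>k\<^esub> \<odot>\<^bsub>M\<^esub> U" for U unfolding M_def module.simps by simp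
    have "r \<odot>\<^bsub>J\<^esub> f \<one>\<^bsub>Q\<^esub> = f (r \<odot>\<^bsub>M\<^esub> \<one>\<^bsub>Q\<^esub>)"
      using f(1) rk one unfolding linear_map_def by simp
    also have "r \<odot>\<^bsub>M\<^esub> \<one>\<^bsub>Q\<^esub> = \<zero>\<^bsub>k\<^esub> \<odot>\<^bsub>M\<^esub> \<one>\<^bsub>Q\<^esub>"
      by (rule smult)
    also have "f \<dots> = \<zero>\<^bsub>k\<^esub> \<odot>\<^bsub>J\<^esub> f \<one>\<^bsub>Q\<^esub>" using f(1) one unfolding linear_map_def by simp
    also have "\<dots> = \<zero>\<^bsub>J\<^esub>" using f(1) one unfolding linear_map_def by (simp add: Pi_iff)
    finally show ?thesis .
  qed
  then show ?thesis using f one unfolding linear_map_def by blast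
qed

definition functional_on :: "'k ring \<Rightarrow> ('k, 'j) module \<Rightarrow> ('k, 'a) module \<Rightarrow> 'a set \<Rightarrow> ('a \<Rightarrow> 'j) \<Rightarrow> bool"
  where "functional_on k J M U f \<longleftrightarrow> linear_map k (M\<lparr>carrier := U\<rparr>) J f"

lemma functional_onD:
  assumes "functional_on k J M U f"
  shows "x \<in> U \<Longrightarrow> f x \<in> carrier J"
    and "\<lbrakk>x \<in> U; y \<in> U\<rbrakk> \<Longrightarrow> f (x \<oplus>\<^bsub>M\<^esub> y) = f x \<oplus>\<^bsub>J\<^esub> f y"
    and "\<lbrakk>r \<in> carrier k; x \<in> U\<rbrakk> \<Longrightarrow> f (r \<odot>\<^bsub>M\<^esub> x) = r \<odot>\<^bsub>J\<^esub> f x"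
  using assms unfolding functional_on_def linear_map_def by (simp_all add: Pi_iff)

lemma functional_on_carrier: "functional_on k J M (carrier M) f \<longleftrightarrow> linear_map k M J f"
  by (simp add: functional_on_def)

text \<open>The extension sends \<open>u + r m\<close> to \<open>f u + r j\<close>; the compatibility condition is what makes this well
defined.\<close>

lemma functional_extends_one_step:
  assumes M: "module k M" and J: "module k J" and U: "submodule U k M" and m: "m \<in> carrier M"
    and f: "functional_on k J M U f" and j: "j \<in> carrier J"
    and compatible: "\<And>r. \<lbrakk>r \<in> carrier k; r \<odot>\<^bsub>M\<^esub> m \<in> U\<rbrakk> \<Longrightarrow> f (r \<odot>\<^bsub>M\<^esub> m) = r \<odot>\<^bsub>J\<^esub> j"
  shows "\<exists>g. functional_on k J M (sum_cyclic k M U m) g \<and> (\<forall>x\<in>U. g x = f x) \<and> g m = j"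
proof -
  interpret M: module k M by fact
  interpret J: module k J by fact
  have Uc: "u \<in> carrier M" if "u \<in> U" for u using that M.submoduleE(1)[OF U] by blast
  have fc: "f u \<in> carrier J" if "u \<in> U" for u using that functional_onD(1)[OF f] by blast
  \<comment> \<open>The decomposition of \<open>x\<close> is not unique; \<open>wd\<close> shows that the value is.\<close>
  define g where "g x = (THE y. \<exists>u\<in>U. \<exists>r\<in>carrier k. x = u \<oplus>\<^bsub>M\<^esub> r \<odot>\<^bsub>M\<^esub> m \<and> y = f u \<oplus>\<^bsub>J\<^esub> r \<odot>\<^bsub>J\<^esub> j)" for x
  have wd: "f u' \<oplus>\<^bsub>J\<^esub> r' \<odot>\<^bsub>J\<^esub> j = f u \<oplus>\<^bsub>J\<^esub> r \<odot>\<^bsub>J\<^esub> j"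
    if u: "u \<in> U" "u' \<in> U" and r: "r \<in> carrier k" "r' \<in> carrier k"
      and eq: "u \<oplus>\<^bsub>M\<^esub> r \<odot>\<^bsub>M\<^esub> m = u' \<oplus>\<^bsub>M\<^esub> r' \<odot>\<^bsub>M\<^esub> m" for u u' r r'
  proof -
    let ?q = "r' \<ominus>\<^bsub>k\<^esub> r"
    have q: "?q \<in> carrier k" using r by simp
    have mc: "r \<odot>\<^bsub>M\<^esub> m \<in> carrier M" "r' \<odot>\<^bsub>M\<^esub> m \<in> carrier M" using r m by auto
    have "u = (u' \<oplus>\<^bsub>M\<^esub> r' \<odot>\<^bsub>M\<^esub> m) \<ominus>\<^bsub>M\<^esub> r \<odot>\<^bsub>M\<^esub> m"
      unfolding eq[symmetric] using mc u Uc by (simp add: M.minus_eq M.add.m_assoc M.r_neg)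
    also have "\<dots> = u' \<oplus>\<^bsub>M\<^esub> ?q \<odot>\<^bsub>M\<^esub> m"
      using r mc u Uc m
      by (simp add: M.minus_eq M.R.minus_eq M.smult_l_distr M.smult_l_minus M.add.m_assoc)
    finally have u_eq: "u = u' \<oplus>\<^bsub>M\<^esub> ?q \<odot>\<^bsub>M\<^esub> m" .
    then have "?q \<odot>\<^bsub>M\<^esub> m = u \<ominus>\<^bsub>M\<^esub> u'"
      using u(2) Uc[OF u(2)] q m by (simp add: M.minus_eq M.add.m_ac M.r_neg2)
    then have qU: "?q \<odot>\<^bsub>M\<^esub> m \<in> U" using submodule_minus[OF M U u] by simp
    have "f u = f u' \<oplus>\<^bsub>J\<^esub> f (?q \<odot>\<^bsub>M\<^esub> m)"
      using functional_onD(2)[OF f u(2) qU] u_eq by simp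
    also have "f (?q \<odot>\<^bsub>M\<^esub> m) = ?q \<odot>\<^bsub>J\<^esub> j" by (rule compatible[OF q qU])
    finally have "f u \<oplus>\<^bsub>J\<^esub> r \<odot>\<^bsub>J\<^esub> j = f u' \<oplus>\<^bsub>J\<^esub> (?q \<odot>\<^bsub>J\<^esub> j \<oplus>\<^bsub>J\<^esub> r \<odot>\<^bsub>J\<^esub> j)"
      using fc u q j r by (simp add: J.add.m_assoc)
    also have "?q \<odot>\<^bsub>J\<^esub> j \<oplus>\<^bsub>J\<^esub> r \<odot>\<^bsub>J\<^esub> j = r' \<odot>\<^bsub>J\<^esub> j"
      using r j q by (simp add: J.smult_l_distr[symmetric] M.R.minus_eq M.R.add.m_assoc M.R.l_neg)
    finally show ?thesis by simp
  qed
  have g: "g (u \<oplus>\<^bsub>M\<^esub> r \<odot>\<^bsub>M\<^esub> m) = f u \<oplus>\<^bsub>J\<^esub> r \<odot>\<^bsub>J\<^esub> j" if ur: "u \<in> U" "r \<in> carrier k" for u r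
    unfolding g_def
  proof (rule the_equality)
    show "\<exists>u'\<in>U. \<exists>r'\<in>carrier k. u \<oplus>\<^bsub>M\<^esub> r \<odot>\<^bsub>M\<^esub> m = u' \<oplus>\<^bsub>M\<^esub> r' \<odot>\<^bsub>M\<^esub> m \<and>
        f u \<oplus>\<^bsub>J\<^esub> r \<odot>\<^bsub>J\<^esub> j = f u' \<oplus>\<^bsub>J\<^esub> r' \<odot>\<^bsub>J\<^esub> j" using ur by blast
  next
    fix y assume "\<exists>u'\<in>U. \<exists>r'\<in>carrier k. u \<oplus>\<^bsub>M\<^esub> r \<odot>\<^bsub>M\<^esub> m = u' \<oplus>\<^bsub>M\<^esub> r' \<odot>\<^bsub>M\<^esub> m \<and>
        y = f u' \<oplus>\<^bsub>J\<^esub> r' \<odot>\<^bsub>J\<^esub> j"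
    then obtain u' r' where "u' \<in> U" "r' \<in> carrier k" "u \<oplus>\<^bsub>M\<^esub> r \<odot>\<^bsub>M\<^esub> m = u' \<oplus>\<^bsub>M\<^esub> r' \<odot>\<^bsub>M\<^esub> m"
        "y = f u' \<oplus>\<^bsub>J\<^esub> r' \<odot>\<^bsub>J\<^esub> j" by (elim bexE conjE)
    then show "y = f u \<oplus>\<^bsub>J\<^esub> r \<odot>\<^bsub>J\<^esub> j" using wd[OF ur(1) _ ur(2)] by metis
  qed
  have "functional_on k J M (sum_cyclic k M U m) g"
    unfolding functional_on_def linear_map_def
  proof (intro conjI ballI Pi_I; simp)
    fix x assume "x \<in> sum_cyclic k M U m"
    then obtain u r where x: "x = u \<oplus>\<^bsub>M\<^esub> r \<odot>\<^bsub>M\<^esub> m" "u \<in> U" "r \<in> carrier k"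
      unfolding sum_cyclic_def by blast
    show "g x \<in> carrier J" unfolding x(1) g[OF x(2,3)] using fc[OF x(2)] x(3) j by simp
  next
    fix x y assume "x \<in> sum_cyclic k M U m" "y \<in> sum_cyclic k M U m"
    then obtain u r u' r' where x: "x = u \<oplus>\<^bsub>M\<^esub> r \<odot>\<^bsub>M\<^esub> m" "u \<in> U" "r \<in> carrier k"
      and y: "y = u' \<oplus>\<^bsub>M\<^esub> r' \<odot>\<^bsub>M\<^esub> m" "u' \<in> U" "r' \<in> carrier k"
      unfolding sum_cyclic_def by blast
    have "x \<oplus>\<^bsub>M\<^esub> y = (u \<oplus>\<^bsub>M\<^esub> u') \<oplus>\<^bsub>M\<^esub> (r \<oplus>\<^bsub>k\<^esub> r') \<odot>\<^bsub>M\<^esub> m"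
      unfolding x(1) y(1) using x y Uc m by (intro sum_cyclic_rearrange[OF M]) auto
    then have "g (x \<oplus>\<^bsub>M\<^esub> y) = f (u \<oplus>\<^bsub>M\<^esub> u') \<oplus>\<^bsub>J\<^esub> (r \<oplus>\<^bsub>k\<^esub> r') \<odot>\<^bsub>J\<^esub> j"
      using g[OF M.submoduleE(5)[OF U x(2) y(2)] M.R.a_closed[OF x(3) y(3)]] by simp
    also have "\<dots> = (f u \<oplus>\<^bsub>J\<^esub> f u') \<oplus>\<^bsub>J\<^esub> (r \<oplus>\<^bsub>k\<^esub> r') \<odot>\<^bsub>J\<^esub> j"
      using functional_onD(2)[OF f x(2) y(2)] by simp
    also have "\<dots> = (f u \<oplus>\<^bsub>J\<^esub> r \<odot>\<^bsub>J\<^esub> j) \<oplus>\<^bsub>J\<^esub> (f u' \<oplus>\<^bsub>J\<^esub> r' \<odot>\<^bsub>J\<^esub> j)"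
      using sum_cyclic_rearrange[OF J fc[OF x(2)] fc[OF y(2)] x(3) y(3) j] by simp
    finally show "g (x \<oplus>\<^bsub>M\<^esub> y) = g x \<oplus>\<^bsub>J\<^esub> g y"
      unfolding x(1) y(1) g[OF x(2,3)] g[OF y(2,3)] .
  next
    fix c x assume c: "c \<in> carrier k" and "x \<in> sum_cyclic k M U m"
    then obtain u r where x: "x = u \<oplus>\<^bsub>M\<^esub> r \<odot>\<^bsub>M\<^esub> m" "u \<in> U" "r \<in> carrier k"
      unfolding sum_cyclic_def by blast
    have "c \<odot>\<^bsub>M\<^esub> x = c \<odot>\<^bsub>M\<^esub> u \<oplus>\<^bsub>M\<^esub> (c \<otimes>\<^bsub>k\<^esub> r) \<odot>\<^bsub>M\<^esub> m"
      unfolding x(1) using x(2,3) c Uc m by (simp add: M.smult_r_distr M.smult_assoc1)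
    then have "g (c \<odot>\<^bsub>M\<^esub> x) = f (c \<odot>\<^bsub>M\<^esub> u) \<oplus>\<^bsub>J\<^esub> (c \<otimes>\<^bsub>k\<^esub> r) \<odot>\<^bsub>J\<^esub> j"
      using g[OF M.submoduleE(4)[OF U c x(2)] M.R.m_closed[OF c x(3)]] by simp
    also have "\<dots> = c \<odot>\<^bsub>J\<^esub> (f u \<oplus>\<^bsub>J\<^esub> r \<odot>\<^bsub>J\<^esub> j)"
      using functional_onD(3)[OF f c x(2)] fc[OF x(2)] c x(3) j
      by (simp add: J.smult_r_distr J.smult_assoc1)
    finally show "g (c \<odot>\<^bsub>M\<^esub> x) = c \<odot>\<^bsub>J\<^esub> g x" unfolding x(1) g[OF x(2,3)] .
  qed
  moreover have "g x = f x" if x: "x \<in> U" for x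
    using g[OF x M.R.zero_closed] Uc[OF x] fc[OF x] j m by simp
  moreover have "g m = j"
  proof -
    have 0: "\<zero>\<^bsub>M\<^esub> \<in> U" by (rule submodule_zero[OF M U])
    have "f \<zero>\<^bsub>M\<^esub> = \<zero>\<^bsub>J\<^esub>" using functional_onD(3)[OF f M.R.zero_closed 0] fc[OF 0] by simp
    then show ?thesis using g[OF 0 M.R.one_closed] j m by simp
  qed
  ultimately show ?thesis by blast
qed

text \<open>Baer's argument. In each step \<open>U \<mapsto> U + k m\<close>, the value at \<open>m\<close> is an element \<open>j\<close> that represents
\<open>r \<mapsto> g(r m)\<close> on the ideal of all \<open>r\<close> with \<open>r m \<in> U\<close>.\<close>

lemma functional_extends:
  assumes M: "module k M" and J: "injective_module k J" and fg: "finitely_generated k M (carrier M)"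
    and N: "submodule N k M" and f: "functional_on k J M N f"
  shows "\<exists>g. linear_map k M J g \<and> (\<forall>x\<in>N. g x = f x)"
proof -
  interpret M: module k M by fact
  have Jm: "module k J" using J unfolding injective_module_def by blast
  let ?P = "\<lambda>U. \<exists>g. functional_on k J M U g \<and> (\<forall>x\<in>N. g x = f x)"
  have "?P (carrier M)"
  proof (rule finite_generation_induct[OF M fg N])
    show "?P N" using f by blast
  next
    fix U m assume U: "submodule U k M" and NU: "N \<subseteq> U" and m: "m \<in> carrier M" and "?P U"
    then obtain g where g: "functional_on k J M U g" "\<forall>x\<in>N. g x = f x" by blast
    let ?I = "{r \<in> carrier k. \<exists>u\<in>{\<zero>\<^bsub>M\<^esub>}. u \<oplus>\<^bsub>M\<^esub> r \<odot>\<^bsub>M\<^esub> m \<in> U}"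
    have I: "ideal ?I k" by (rule coefficient_ideal[OF M zero_submodule[OF M] U m])
    have Ieq: "r \<in> ?I \<longleftrightarrow> r \<in> carrier k \<and> r \<odot>\<^bsub>M\<^esub> m \<in> U" for r using m by auto
    have "linear_map k (ideal_module k ?I) J (\<lambda>r. g (r \<odot>\<^bsub>M\<^esub> m))"
      unfolding linear_map_def ideal_module_def
      using functional_onD[OF g(1)] m
      by (auto simp: M.smult_l_distr M.smult_assoc1)
    then obtain j where j: "j \<in> carrier J" "\<forall>r\<in>?I. g (r \<odot>\<^bsub>M\<^esub> m) = r \<odot>\<^bsub>J\<^esub> j"
      using linear_functional_on_ideal[OF M.R.is_cring J I] by blast
    from functional_extends_one_step[OF M Jm U m g(1) j(1)] j(2) Ieq
    obtain h where "functional_on k J M (sum_cyclic k M U m) h" "\<forall>x\<in>U. h x = g x" by blast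
    then show "?P (sum_cyclic k M U m)" using g(2) NU by (metis subsetD)
  qed
  then show ?thesis unfolding functional_on_carrier .
qed

text \<open>The zero functional on \<open>N\<close> extends to \<open>N + k m\<close> by any \<open>j\<close> that is killed by \<open>{r. r m \<in> N}\<close>, in
particular by a nonzero one.\<close>

lemma functional_separates:
  assumes M: "module k M" and J: "injective_cogenerator k J"
    and fg: "finitely_generated k M (carrier M)"
    and N: "submodule N k M" and m: "m \<in> carrier M" "m \<notin> N"
  shows "\<exists>g. linear_map k M J g \<and> (\<forall>x\<in>N. g x = \<zero>\<^bsub>J\<^esub>) \<and> g m \<noteq> \<zero>\<^bsub>J\<^esub>"
proof -
  interpret M: module k M by fact
  have Ji: "injective_module k J" and Jc: "cogenerator_module k J"
    using J unfolding injective_cogenerator_def by auto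
  then interpret J: module k J unfolding injective_module_def by blast
  have Jm: "module k J" by (rule J.module_axioms)
  let ?A = "{r \<in> carrier k. \<exists>u\<in>{\<zero>\<^bsub>M\<^esub>}. u \<oplus>\<^bsub>M\<^esub> r \<odot>\<^bsub>M\<^esub> m \<in> N}"
  have A: "ideal ?A k" by (rule coefficient_ideal[OF M zero_submodule[OF M] N m(1)])
  have Aeq: "r \<in> ?A \<longleftrightarrow> r \<in> carrier k \<and> r \<odot>\<^bsub>M\<^esub> m \<in> N" for r using m by auto
  have "\<one>\<^bsub>k\<^esub> \<notin> ?A" using m by simp
  then obtain j where j: "j \<in> carrier J" "j \<noteq> \<zero>\<^bsub>J\<^esub>" "\<forall>r\<in>?A. r \<odot>\<^bsub>J\<^esub> j = \<zero>\<^bsub>J\<^esub>"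
    using nonzero_element_killed_by_ideal[OF M.R.is_cring Jc A] by blast
  have "functional_on k J M N (\<lambda>_. \<zero>\<^bsub>J\<^esub>)" by (auto simp: functional_on_def linear_map_def)
  moreover have "\<zero>\<^bsub>J\<^esub> = r \<odot>\<^bsub>J\<^esub> j" if "r \<in> carrier k" "r \<odot>\<^bsub>M\<^esub> m \<in> N" for r
    using j(3) Aeq[of r] that by simp
  ultimately obtain h
    where h: "functional_on k J M (sum_cyclic k M N m) h" "\<forall>x\<in>N. h x = \<zero>\<^bsub>J\<^esub>" "h m = j"
    using functional_extends_one_step[OF M Jm N m(1) _ j(1)] by blast
  from functional_extends[OF M Ji fg sum_cyclic_submodule[OF M N m(1)] h(1)]
  obtain g where "linear_map k M J g" "\<forall>x\<in>sum_cyclic k M N m. g x = h x" by blast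
  then show ?thesis
    using h(2,3) j(2) sum_cyclic_superset[OF M N m(1)] sum_cyclic_generator[OF M N m(1)]
    by (intro exI[of _ g]) auto
qed

section \<open>Additive maps and ideals of a preadditive category\<close>

lemma additive_map_zero:
  assumes "abelian_group A" "abelian_group B" and f: "f \<in> carrier A \<rightarrow> carrier B"
    and add: "\<And>x y. \<lbrakk>x \<in> carrier A; y \<in> carrier A\<rbrakk> \<Longrightarrow> f (x \<oplus>\<^bsub>A\<^esub> y) = f x \<oplus>\<^bsub>B\<^esub> f y"
  shows "f \<zero>\<^bsub>A\<^esub> = \<zero>\<^bsub>B\<^esub>"
proof -
  interpret A: abelian_group A by fact
  interpret B: abelian_group B by fact
  have c: "f \<zero>\<^bsub>A\<^esub> \<in> carrier B" using f by auto
  have "f \<zero>\<^bsub>A\<^esub> \<oplus>\<^bsub>B\<^esub> f \<zero>\<^bsub>A\<^esub> = f \<zero>\<^bsub>A\<^esub>" using add[of "\<zero>\<^bsub>A\<^esub>" "\<zero>\<^bsub>A\<^esub>"] by simp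
  then show ?thesis using c by simp
qed

lemma additive_map_minus:
  assumes "abelian_group A" "abelian_group B" and f: "f \<in> carrier A \<rightarrow> carrier B"
    and add: "\<And>x y. \<lbrakk>x \<in> carrier A; y \<in> carrier A\<rbrakk> \<Longrightarrow> f (x \<oplus>\<^bsub>A\<^esub> y) = f x \<oplus>\<^bsub>B\<^esub> f y"
    and x: "x \<in> carrier A" and y: "y \<in> carrier A"
  shows "f (x \<ominus>\<^bsub>A\<^esub> y) = f x \<ominus>\<^bsub>B\<^esub> f y"
proof -
  interpret A: abelian_group A by fact
  interpret B: abelian_group B by fact
  have c: "f x \<in> carrier B" "f y \<in> carrier B" "f (x \<ominus>\<^bsub>A\<^esub> y) \<in> carrier B" using f x y by auto
  have "(x \<ominus>\<^bsub>A\<^esub> y) \<oplus>\<^bsub>A\<^esub> y = x" using x y by (simp add: A.minus_eq A.add.m_assoc A.l_neg)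
  then have "f x = f (x \<ominus>\<^bsub>A\<^esub> y) \<oplus>\<^bsub>B\<^esub> f y" using add[of "x \<ominus>\<^bsub>A\<^esub> y" y] x y by simp
  then show ?thesis using c by (simp add: B.minus_eq B.add.m_assoc B.r_neg)
qed

context preadditive_category
begin

lemma zmor_closed: "\<lbrakk>X \<in> obj C; Y \<in> obj C\<rbrakk> \<Longrightarrow> zmor C X Y \<in> Mor C X Y"
  using abelian_monoid.zero_closed[OF abelian_group.axioms(1)[OF mor_group]] .

lemma add_mor_closed: "\<lbrakk>X \<in> obj C; Y \<in> obj C; f \<in> Mor C X Y; g \<in> Mor C X Y\<rbrakk>
    \<Longrightarrow> f \<oplus>\<^bsub>mor C X Y\<^esub> g \<in> Mor C X Y"
  using abelian_monoid.a_closed[OF abelian_group.axioms(1)[OF mor_group]] .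

lemma minus_mor_closed: "\<lbrakk>X \<in> obj C; Y \<in> obj C; f \<in> Mor C X Y; g \<in> Mor C X Y\<rbrakk>
    \<Longrightarrow> f \<ominus>\<^bsub>mor C X Y\<^esub> g \<in> Mor C X Y"
  using abelian_group.minus_closed[OF mor_group] .

lemma cmp_zmor_left:
  assumes "X \<in> obj C" "Y \<in> obj C" "Z \<in> obj C" "f \<in> Mor C X Y"
  shows "cmp C X Y Z (zmor C Y Z) f = zmor C X Z"
  by (rule additive_map_zero[of "mor C Y Z" "mor C X Z" "\<lambda>g. cmp C X Y Z g f"])
    (use assms mor_group cmp_closed cmp_add_left in auto)

lemma cmp_zmor_right:
  assumes "X \<in> obj C" "Y \<in> obj C" "Z \<in> obj C" "g \<in> Mor C Y Z"
  shows "cmp C X Y Z g (zmor C X Y) = zmor C X Z"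
  by (rule additive_map_zero[of "mor C X Y" "mor C X Z" "\<lambda>f. cmp C X Y Z g f"])
    (use assms mor_group cmp_closed cmp_add_right in auto)

lemma cmp_minus_left:
  assumes "X \<in> obj C" "Y \<in> obj C" "Z \<in> obj C" "f \<in> Mor C X Y" "g \<in> Mor C Y Z" "g' \<in> Mor C Y Z"
  shows "cmp C X Y Z (g \<ominus>\<^bsub>mor C Y Z\<^esub> g') f = cmp C X Y Z g f \<ominus>\<^bsub>mor C X Z\<^esub> cmp C X Y Z g' f"
  by (rule additive_map_minus[of "mor C Y Z" "mor C X Z" "\<lambda>g. cmp C X Y Z g f"])
    (use assms mor_group cmp_closed cmp_add_left in auto)

lemma cmp_minus_right:
  assumes "X \<in> obj C" "Y \<in> obj C" "Z \<in> obj C" "f \<in> Mor C X Y" "f' \<in> Mor C X Y" "g \<in> Mor C Y Z"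
  shows "cmp C X Y Z g (f \<ominus>\<^bsub>mor C X Y\<^esub> f') = cmp C X Y Z g f \<ominus>\<^bsub>mor C X Z\<^esub> cmp C X Y Z g f'"
  by (rule additive_map_minus[of "mor C X Y" "mor C X Z" "\<lambda>f. cmp C X Y Z g f"])
    (use assms mor_group cmp_closed cmp_add_right in auto)

end

lemma group_cong:
  assumes "carrier A = carrier B" "monoid.mult A = monoid.mult B" "monoid.one A = monoid.one B"
  shows "group A \<longleftrightarrow> group B"
  unfolding group_def group_axioms_def Group.monoid_def Units_def assms by (rule refl)

text \<open>Inverses in a subgroup are those of the ambient monoid, so \<open>subgroup\<close> depends on the group only
through these three fields. This compares the additive groups of one carrier regarded as a
module over different rings.\<close>

lemma subgroup_cong:
  assumes "carrier A = carrier B" "monoid.mult A = monoid.mult B" "monoid.one A = monoid.one B"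
  shows "subgroup H A \<longleftrightarrow> subgroup H B"
  unfolding subgroup_def m_inv_def assms by (rule refl)

text \<open>The axioms of a category without the additive structure, for reasoning about adjunctions and
equivalences between stable categories.\<close>

locale plain_category =
  fixes C :: "('o, 'm, 'k) cat"
  assumes idm_mor: "X \<in> obj C \<Longrightarrow> idm C X \<in> Mor C X X"
    and cmp_mor: "\<lbrakk>X \<in> obj C; Y \<in> obj C; Z \<in> obj C; f \<in> Mor C X Y; g \<in> Mor C Y Z\<rbrakk>
      \<Longrightarrow> cmp C X Y Z g f \<in> Mor C X Z"
    and idm_right: "\<lbrakk>X \<in> obj C; Y \<in> obj C; f \<in> Mor C X Y\<rbrakk> \<Longrightarrow> cmp C X X Y f (idm C X) = f"
    and idm_left: "\<lbrakk>X \<in> obj C; Y \<in> obj C; f \<in> Mor C X Y\<rbrakk> \<Longrightarrow> cmp C X Y Y (idm C Y) f = f"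
    and assoc: "\<lbrakk>W \<in> obj C; X \<in> obj C; Y \<in> obj C; Z \<in> obj C;
        f \<in> Mor C W X; g \<in> Mor C X Y; h \<in> Mor C Y Z\<rbrakk>
      \<Longrightarrow> cmp C W X Z (cmp C X Y Z h g) f = cmp C W Y Z h (cmp C W X Y g f)"

locale category_ideal = preadditive_category C
  for C :: "('o, 'm, 'k) cat" +
  fixes N :: "'o \<Rightarrow> 'o \<Rightarrow> 'm set"
  assumes N_subgroup: "\<lbrakk>X \<in> obj C; Y \<in> obj C\<rbrakk> \<Longrightarrow> additive_subgroup (N X Y) (mor C X Y)"
    and N_cmp_left: "\<lbrakk>X \<in> obj C; Y \<in> obj C; Z \<in> obj C; f \<in> N X Y; g \<in> Mor C Y Z\<rbrakk>
      \<Longrightarrow> cmp C X Y Z g f \<in> N X Z"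
    and N_cmp_right: "\<lbrakk>X \<in> obj C; Y \<in> obj C; Z \<in> obj C; f \<in> Mor C X Y; g \<in> N Y Z\<rbrakk>
      \<Longrightarrow> cmp C X Y Z g f \<in> N X Z"
begin

abbreviation "Q \<equiv> quotient_cat C N"

abbreviation coset :: "'o \<Rightarrow> 'o \<Rightarrow> 'm \<Rightarrow> 'm set" where
  "coset X Y f \<equiv> N X Y +>\<^bsub>mor C X Y\<^esub> f"

lemma N_abelian_subgroup: "\<lbrakk>X \<in> obj C; Y \<in> obj C\<rbrakk> \<Longrightarrow> abelian_subgroup (N X Y) (mor C X Y)"
  using abelian_subgroupI3 N_subgroup mor_group by blast

lemma obj_quotient: "obj Q = obj C"
  by (simp add: quotient_cat_def)

lemma Mor_quotient: "Mor Q X Y = coset X Y ` Mor C X Y"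
  by (auto simp: quotient_cat_def quotient_module_def A_RCOSETS_def')

lemma coset_eq_iff:
  assumes "X \<in> obj C" "Y \<in> obj C" "f \<in> Mor C X Y" "g \<in> Mor C X Y"
  shows "coset X Y f = coset X Y g \<longleftrightarrow> f \<ominus>\<^bsub>mor C X Y\<^esub> g \<in> N X Y"
proof -
  interpret N: abelian_subgroup "N X Y" "mor C X Y" using N_abelian_subgroup assms by simp
  have "f \<ominus>\<^bsub>mor C X Y\<^esub> g \<in> N X Y \<longleftrightarrow> f \<in> coset X Y g"
    using N.a_rcos_module[of g f] assms by (simp add: N.minus_eq)
  then show ?thesis
    using assms N.a_repr_independence'[of f g] N.a_rcos_self[of f] by blast
qed

lemma cmp_coset:
  assumes o: "X \<in> obj C" "Y \<in> obj C" "Z \<in> obj C" and f: "f \<in> Mor C X Y" and g: "g \<in> Mor C Y Z"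
  shows "cmp Q X Y Z (coset Y Z g) (coset X Y f) = coset X Z (cmp C X Y Z g f)"
proof -
  interpret XY: abelian_subgroup "N X Y" "mor C X Y" using N_abelian_subgroup o by simp
  interpret YZ: abelian_subgroup "N Y Z" "mor C Y Z" using N_abelian_subgroup o by simp
  interpret XZ: abelian_subgroup "N X Z" "mor C X Z" using N_abelian_subgroup o by simp
  have eq: "coset X Z (cmp C X Y Z g' f') = coset X Z (cmp C X Y Z g f)"
    if "f' \<in> coset X Y f" "g' \<in> coset Y Z g" for f' g'
  proof -
    have f': "f' \<in> Mor C X Y" and g': "g' \<in> Mor C Y Z"
      using that f g XY.a_elemrcos_carrier YZ.a_elemrcos_carrier by blast+
    have "coset X Y f' = coset X Y f" "coset Y Z g' = coset Y Z g"
      using that f g XY.a_repr_independence' YZ.a_repr_independence' by metis+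
    then have d: "f' \<ominus>\<^bsub>mor C X Y\<^esub> f \<in> N X Y" "g' \<ominus>\<^bsub>mor C Y Z\<^esub> g \<in> N Y Z"
      using coset_eq_iff o f g f' g' by auto
    have "cmp C X Y Z g' f' \<ominus>\<^bsub>mor C X Z\<^esub> cmp C X Y Z g' f \<in> N X Z"
      using N_cmp_left[OF o d(1) g'] cmp_minus_right[OF o f' f g'] by simp
    then have 1: "coset X Z (cmp C X Y Z g' f') = coset X Z (cmp C X Y Z g' f)"
      using coset_eq_iff cmp_closed o f g f' g' by auto
    have "cmp C X Y Z g' f \<ominus>\<^bsub>mor C X Z\<^esub> cmp C X Y Z g f \<in> N X Z"
      using N_cmp_right[OF o f d(2)] cmp_minus_left[OF o f g' g] by simp
    then have 2: "coset X Z (cmp C X Y Z g' f) = coset X Z (cmp C X Y Z g f)"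
      using coset_eq_iff cmp_closed o f g f' g' by auto
    show ?thesis using 1 2 by simp
  qed
  have ne: "f \<in> coset X Y f" "g \<in> coset Y Z g" using f g XY.a_rcos_self YZ.a_rcos_self by auto
  have "cmp Q X Y Z (coset Y Z g) (coset X Y f) =
      (\<Union>g'\<in>coset Y Z g. \<Union>f'\<in>coset X Y f. coset X Z (cmp C X Y Z g' f'))"
    by (simp add: quotient_cat_def)
  also have "\<dots> = (\<Union>g'\<in>coset Y Z g. \<Union>f'\<in>coset X Y f. coset X Z (cmp C X Y Z g f))"
    using eq by (intro SUP_cong refl) auto
  also have "\<dots> = coset X Z (cmp C X Y Z g f)" using ne by blast
  finally show ?thesis .
qed

lemma idm_quotient: "idm Q X = coset X X (idm C X)"
  by (simp add: quotient_cat_def)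

lemma quotient_plain_category: "plain_category Q"
proof
  fix X Y f assume "X \<in> obj Q" "Y \<in> obj Q" "f \<in> Mor Q X Y"
  then show "cmp Q X X Y f (idm Q X) = f" "cmp Q X Y Y (idm Q Y) f = f"
    by (auto simp: Mor_quotient obj_quotient idm_quotient cmp_coset idm_closed cmp_idm_left cmp_idm_right)
qed (auto simp: Mor_quotient obj_quotient idm_quotient cmp_coset idm_closed cmp_closed cmp_assoc)

lemma add_coset:
  assumes "X \<in> obj C" "Y \<in> obj C" "f \<in> Mor C X Y" "g \<in> Mor C X Y"
  shows "coset X Y f \<oplus>\<^bsub>mor Q X Y\<^esub> coset X Y g = coset X Y (f \<oplus>\<^bsub>mor C X Y\<^esub> g)"
  using abelian_subgroup.a_rcos_sum[OF N_abelian_subgroup] assms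
  by (simp add: quotient_cat_def quotient_module_def)

lemma zmor_quotient:
  assumes "X \<in> obj C" "Y \<in> obj C"
  shows "zmor Q X Y = coset X Y (zmor C X Y)"
proof -
  interpret abelian_subgroup "N X Y" "mor C X Y" using N_abelian_subgroup assms by simp
  show ?thesis using a_rcos_const[OF additive_subgroup.zero_closed[OF is_additive_subgroup]] by (simp add: quotient_cat_def quotient_module_def)
qed

lemma quotient_add_group:
  assumes "X \<in> obj C" "Y \<in> obj C"
  shows "group (add_monoid (mor Q X Y))"
proof -
  interpret abelian_subgroup "N X Y" "mor C X Y" using N_abelian_subgroup assms by simp
  have "carrier (mor C X Y A_Mod N X Y) = Mor Q X Y"
    "monoid.mult (mor C X Y A_Mod N X Y) = ring.add (mor Q X Y)"
    "monoid.one (mor C X Y A_Mod N X Y) = zmor Q X Y"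
    by (simp_all add: A_FactGroup_def FactGroup_def A_RCOSETS_def set_add_def fun_eq_iff
        quotient_cat_def quotient_module_def)
  then show ?thesis using group_cong[of "add_monoid (mor Q X Y)" "mor C X Y A_Mod N X Y"] a_factorgroup_is_group by simp
qed

end

section \<open>Categories, adjunctions and equivalences\<close>

text \<open>The inverse sends \<open>h : L X \<rightarrow> Z\<close> to \<open>R(h) \<circ> u\<close>; the two triangle identities give the two composites.\<close>

lemma adjunction_bijective:
  assumes A: "plain_category A" and B: "plain_category B" and adj: "adjunction A B L R u e"
    and X: "X \<in> obj A" and Z: "Z \<in> obj B"
  shows "bij_betw (\<lambda>f. cmp B (fob L X) (fob L (fob R Z)) Z (e Z) (fmor L X (fob R Z) f))
    (Mor A X (fob R Z)) (Mor B (fob L X) Z)"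
proof -
  interpret A: plain_category A by fact
  interpret B: plain_category B by fact
  have L: "\<And>X. X \<in> obj A \<Longrightarrow> fob L X \<in> obj B"
      "\<And>X Y f. \<lbrakk>X \<in> obj A; Y \<in> obj A; f \<in> Mor A X Y\<rbrakk> \<Longrightarrow> fmor L X Y f \<in> Mor B (fob L X) (fob L Y)"
      "\<And>X Y Z f g. \<lbrakk>X \<in> obj A; Y \<in> obj A; Z \<in> obj A; f \<in> Mor A X Y; g \<in> Mor A Y Z\<rbrakk> \<Longrightarrow>
        fmor L X Z (cmp A X Y Z g f) = cmp B (fob L X) (fob L Y) (fob L Z) (fmor L Y Z g) (fmor L X Y f)"
    and R: "\<And>X. X \<in> obj B \<Longrightarrow> fob R X \<in> obj A"
      "\<And>X Y f. \<lbrakk>X \<in> obj B; Y \<in> obj B; f \<in> Mor B X Y\<rbrakk> \<Longrightarrow> fmor R X Y f \<in> Mor A (fob R X) (fob R Y)"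
      "\<And>X Y Z f g. \<lbrakk>X \<in> obj B; Y \<in> obj B; Z \<in> obj B; f \<in> Mor B X Y; g \<in> Mor B Y Z\<rbrakk> \<Longrightarrow>
        fmor R X Z (cmp B X Y Z g f) = cmp A (fob R X) (fob R Y) (fob R Z) (fmor R Y Z g) (fmor R X Y f)"
    and u: "\<And>X. X \<in> obj A \<Longrightarrow> u X \<in> Mor A X (fob R (fob L X))"
      "\<And>X Y f. \<lbrakk>X \<in> obj A; Y \<in> obj A; f \<in> Mor A X Y\<rbrakk> \<Longrightarrow>
        cmp A X Y (fob R (fob L Y)) (u Y) f =
        cmp A X (fob R (fob L X)) (fob R (fob L Y)) (fmor R (fob L X) (fob L Y) (fmor L X Y f)) (u X)"
    and e: "\<And>Z. Z \<in> obj B \<Longrightarrow> e Z \<in> Mor B (fob L (fob R Z)) Z"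
      "\<And>Y Z f. \<lbrakk>Y \<in> obj B; Z \<in> obj B; f \<in> Mor B Y Z\<rbrakk> \<Longrightarrow>
        cmp B (fob L (fob R Y)) (fob L (fob R Z)) Z (e Z) (fmor L (fob R Y) (fob R Z) (fmor R Y Z f)) =
        cmp B (fob L (fob R Y)) Y Z f (e Y)"
    and triangle: "\<And>X. X \<in> obj A \<Longrightarrow> cmp B (fob L X) (fob L (fob R (fob L X))) (fob L X)
        (e (fob L X)) (fmor L X (fob R (fob L X)) (u X)) = idm B (fob L X)"
      "\<And>Y. Y \<in> obj B \<Longrightarrow> cmp A (fob R Y) (fob R (fob L (fob R Y))) (fob R Y)
        (fmor R (fob L (fob R Y)) Y (e Y)) (u (fob R Y)) = idm A (fob R Y)"
    using adj unfolding adjunction_def is_functor_def nat_transformation_def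
    by (simp_all add: comp_functor_def id_functor_def Pi_iff)
  let ?f = "\<lambda>f. cmp B (fob L X) (fob L (fob R Z)) Z (e Z) (fmor L X (fob R Z) f)"
  let ?g = "\<lambda>h. cmp A X (fob R (fob L X)) (fob R Z) (fmor R (fob L X) Z h) (u X)"
  show ?thesis
  proof (rule bij_betwI[where g = ?g])
    show "?f \<in> Mor A X (fob R Z) \<rightarrow> Mor B (fob L X) Z"
      using X Z L R e B.cmp_mor by auto
    show "?g \<in> Mor B (fob L X) Z \<rightarrow> Mor A X (fob R Z)"
      using X Z L R u A.cmp_mor by auto
    show "?g (?f f) = f" if f: "f \<in> Mor A X (fob R Z)" for f
    proof -
      have Lf: "fmor L X (fob R Z) f \<in> Mor B (fob L X) (fob L (fob R Z))" using X Z R L f by simp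
      have "?g (?f f) = cmp A X (fob R (fob L X)) (fob R Z)
          (cmp A (fob R (fob L X)) (fob R (fob L (fob R Z))) (fob R Z) (fmor R (fob L (fob R Z)) Z (e Z))
            (fmor R (fob L X) (fob L (fob R Z)) (fmor L X (fob R Z) f))) (u X)"
        using R(3)[OF _ _ _ Lf e(1)[OF Z]] X Z L R by simp
      also have "\<dots> = cmp A X (fob R (fob L (fob R Z))) (fob R Z) (fmor R (fob L (fob R Z)) Z (e Z))
          (cmp A X (fob R (fob L X)) (fob R (fob L (fob R Z)))
            (fmor R (fob L X) (fob L (fob R Z)) (fmor L X (fob R Z) f)) (u X))"
        by (rule A.assoc) (use X Z L R u e Lf in auto)
      also have "\<dots> = cmp A X (fob R (fob L (fob R Z))) (fob R Z) (fmor R (fob L (fob R Z)) Z (e Z))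
          (cmp A X (fob R Z) (fob R (fob L (fob R Z))) (u (fob R Z)) f)"
        using u(2)[OF X R(1)[OF Z] f] by simp
      also have "\<dots> = cmp A X (fob R Z) (fob R Z) (cmp A (fob R Z) (fob R (fob L (fob R Z))) (fob R Z)
          (fmor R (fob L (fob R Z)) Z (e Z)) (u (fob R Z))) f"
        by (rule A.assoc[symmetric]) (use X Z L R u e f in auto)
      also have "\<dots> = f" using triangle(2)[OF Z] A.idm_left[OF X R(1)[OF Z] f] by simp
      finally show ?thesis .
    qed
    show "?f (?g h) = h" if h: "h \<in> Mor B (fob L X) Z" for h
    proof -
      have Rh: "fmor R (fob L X) Z h \<in> Mor A (fob R (fob L X)) (fob R Z)" using X Z R L h by simp
      have "?f (?g h) = cmp B (fob L X) (fob L (fob R Z)) Z (e Z)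
          (cmp B (fob L X) (fob L (fob R (fob L X))) (fob L (fob R Z))
            (fmor L (fob R (fob L X)) (fob R Z) (fmor R (fob L X) Z h)) (fmor L X (fob R (fob L X)) (u X)))"
        using L(3)[OF _ _ _ u(1)[OF X] Rh] X Z L R by simp
      also have "\<dots> = cmp B (fob L X) (fob L (fob R (fob L X))) Z
          (cmp B (fob L (fob R (fob L X))) (fob L (fob R Z)) Z (e Z)
            (fmor L (fob R (fob L X)) (fob R Z) (fmor R (fob L X) Z h))) (fmor L X (fob R (fob L X)) (u X))"
        by (rule B.assoc[symmetric]) (use X Z L R u e Rh in auto)
      also have "\<dots> = cmp B (fob L X) (fob L (fob R (fob L X))) Z
          (cmp B (fob L (fob R (fob L X))) (fob L X) Z h (e (fob L X))) (fmor L X (fob R (fob L X)) (u X))"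
        using e(2)[OF L(1)[OF X] Z h] by simp
      also have "\<dots> = cmp B (fob L X) (fob L X) Z h (cmp B (fob L X) (fob L (fob R (fob L X))) (fob L X)
          (e (fob L X)) (fmor L X (fob R (fob L X)) (u X)))"
        by (rule B.assoc) (use X Z L R u e h in auto)
      also have "\<dots> = h" using triangle(1)[OF X] B.idm_right[OF L(1)[OF X] Z h] by simp
      finally show ?thesis .
    qed
  qed
qed

lemma iso_cancel_right:
  assumes "plain_category A" and i: "is_iso A X Y i" and o: "X \<in> obj A" "Y \<in> obj A" "Z \<in> obj A"
    and f: "f \<in> Mor A Y Z" "g \<in> Mor A Y Z" and eq: "cmp A X Y Z f i = cmp A X Y Z g i"
  shows "f = g"
proof -
  interpret plain_category A by fact
  obtain j where j: "i \<in> Mor A X Y" "j \<in> Mor A Y X" "cmp A Y X Y i j = idm A Y"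
    using i unfolding is_iso_def by blast
  have "h = cmp A Y X Z (cmp A X Y Z h i) j" if "h \<in> Mor A Y Z" for h
    using assoc[OF o(2,1,2,3) j(2,1) that] j(3) idm_right[OF o(2,3) that] by simp
  then show ?thesis using f eq by metis
qed

text \<open>Conjugating \<open>F h\<close> with an isomorphism \<open>Id \<rightarrow> F G\<close> gives a \<open>g\<close> with \<open>F(G g) = F h\<close>. The functor \<open>F\<close> is
faithful because \<open>G F\<close> is isomorphic to the identity, so \<open>G g = h\<close>.\<close>

lemma quasi_inverse_full:
  assumes A: "plain_category A" and B: "plain_category B" and F: "is_functor A B F"
    and G: "quasi_inverse A B F G"
    and X: "X \<in> obj B" and Y: "Y \<in> obj B" and h: "h \<in> Mor A (fob G X) (fob G Y)"
  shows "\<exists>g\<in>Mor B X Y. fmor G X Y g = h"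
proof -
  interpret A: plain_category A by fact
  interpret B: plain_category B by fact
  have Fo: "\<And>X. X \<in> obj A \<Longrightarrow> fob F X \<in> obj B"
    and Fm: "\<And>X Y f. \<lbrakk>X \<in> obj A; Y \<in> obj A; f \<in> Mor A X Y\<rbrakk> \<Longrightarrow> fmor F X Y f \<in> Mor B (fob F X) (fob F Y)"
    using F unfolding is_functor_def by (simp_all add: Pi_iff)
  have Go: "\<And>X. X \<in> obj B \<Longrightarrow> fob G X \<in> obj A"
    and Gm: "\<And>X Y f. \<lbrakk>X \<in> obj B; Y \<in> obj B; f \<in> Mor B X Y\<rbrakk> \<Longrightarrow> fmor G X Y f \<in> Mor A (fob G X) (fob G Y)"
    using G unfolding quasi_inverse_def is_functor_def by (simp_all add: Pi_iff)
  obtain a where "nat_transformation A A (comp_functor G F) id_functor a"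
      "\<forall>X\<in>obj A. is_iso A (fob G (fob F X)) X (a X)"
    using G unfolding quasi_inverse_def naturally_isomorphic_def
    by (auto simp: comp_functor_def id_functor_def)
  then have a: "\<And>X. X \<in> obj A \<Longrightarrow> is_iso A (fob G (fob F X)) X (a X)"
    and an: "\<And>X Y f. \<lbrakk>X \<in> obj A; Y \<in> obj A; f \<in> Mor A X Y\<rbrakk> \<Longrightarrow>
        cmp A (fob G (fob F X)) (fob G (fob F Y)) Y (a Y) (fmor G (fob F X) (fob F Y) (fmor F X Y f)) =
        cmp A (fob G (fob F X)) X Y f (a X)"
    unfolding nat_transformation_def by (simp_all add: comp_functor_def id_functor_def)
  obtain b where "nat_transformation B B id_functor (comp_functor F G) b"
      "\<forall>X\<in>obj B. is_iso B X (fob F (fob G X)) (b X)"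
    using G unfolding quasi_inverse_def naturally_isomorphic_def
    by (auto simp: comp_functor_def id_functor_def)
  then have b: "\<And>X. X \<in> obj B \<Longrightarrow> is_iso B X (fob F (fob G X)) (b X)"
    and bn: "\<And>X Y f. \<lbrakk>X \<in> obj B; Y \<in> obj B; f \<in> Mor B X Y\<rbrakk> \<Longrightarrow>
        cmp B X Y (fob F (fob G Y)) (b Y) f =
        cmp B X (fob F (fob G X)) (fob F (fob G Y)) (fmor F (fob G X) (fob G Y) (fmor G X Y f)) (b X)"
    unfolding nat_transformation_def by (simp_all add: comp_functor_def id_functor_def)
  have faithful: "f = f'" if f: "f \<in> Mor A (fob G X) (fob G Y)" "f' \<in> Mor A (fob G X) (fob G Y)"
    and eq: "fmor F (fob G X) (fob G Y) f = fmor F (fob G X) (fob G Y) f'" for f f'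
    using an[OF Go[OF X] Go[OF Y] f(1)] an[OF Go[OF X] Go[OF Y] f(2)] eq
    by (intro iso_cancel_right[OF A a[OF Go[OF X]] _ _ _ f]) (auto simp: X Y Go Fo)
  let ?FX = "fob F (fob G X)" and ?FY = "fob F (fob G Y)"
  have FX: "?FX \<in> obj B" "?FY \<in> obj B" using X Y Go Fo by auto
  obtain c where bY: "b Y \<in> Mor B Y ?FY" and c: "c \<in> Mor B ?FY Y" "cmp B ?FY Y ?FY (b Y) c = idm B ?FY"
    using b[OF Y] unfolding is_iso_def by blast
  have bX: "b X \<in> Mor B X ?FX" using b[OF X] unfolding is_iso_def by blast
  have Fh: "fmor F (fob G X) (fob G Y) h \<in> Mor B ?FX ?FY" using X Y Go Fm h by simp
  let ?d = "cmp B X ?FX ?FY (fmor F (fob G X) (fob G Y) h) (b X)"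
  have d: "?d \<in> Mor B X ?FY" using B.cmp_mor[OF X FX bX Fh] .
  let ?g = "cmp B X ?FY Y c ?d"
  have g: "?g \<in> Mor B X Y" using B.cmp_mor[OF X FX(2) Y d c(1)] .
  have "cmp B X Y ?FY (b Y) ?g = ?d"
    using B.assoc[OF X FX(2) Y FX(2) d c(1) bY] c(2) B.idm_left[OF X FX(2) d] by simp
  then have "cmp B X ?FX ?FY (fmor F (fob G X) (fob G Y) (fmor G X Y ?g)) (b X) = ?d"
    using bn[OF X Y g] by simp
  then have "fmor F (fob G X) (fob G Y) (fmor G X Y ?g) = fmor F (fob G X) (fob G Y) h"
    by (intro iso_cancel_right[OF B b[OF X] X FX _ Fh]) (auto simp: X Y Go Fm Gm g)
  then have "fmor G X Y ?g = h" by (intro faithful) (auto simp: Gm X Y g h)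
  then show ?thesis using g by blast
qed

text \<open>The morphism \<open>(f, h) : S \<oplus> A \<rightarrow> Y\<close> and its composites.\<close>

lemma (in preadditive_category) biproduct_copair:
  assumes T: "is_biproduct C S A T i1 i2 p1 p2" and Y: "Y \<in> obj C"
    and f: "f \<in> Mor C S Y" and h: "h \<in> Mor C A Y"
  shows "\<exists>f'\<in>Mor C T Y. cmp C S T Y f' i1 = f \<and> cmp C A T Y f' i2 = h \<and>
    (\<forall>W\<in>obj C. \<forall>u\<in>Mor C W T. cmp C W T Y f' u =
      cmp C W S Y f (cmp C W T S p1 u) \<oplus>\<^bsub>mor C W Y\<^esub> cmp C W A Y h (cmp C W T A p2 u))"
proof -
  have o: "S \<in> obj C" "A \<in> obj C" "T \<in> obj C"
    and m: "i1 \<in> Mor C S T" "i2 \<in> Mor C A T" "p1 \<in> Mor C T S" "p2 \<in> Mor C T A"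
    and e: "cmp C S T S p1 i1 = idm C S" "cmp C A T A p2 i2 = idm C A"
      "cmp C A T S p1 i2 = zmor C A S" "cmp C S T A p2 i1 = zmor C S A"
    using T unfolding is_biproduct_def by auto
  let ?a = "cmp C T S Y f p1" and ?b = "cmp C T A Y h p2"
  let ?f = "?a \<oplus>\<^bsub>mor C T Y\<^esub> ?b"
  have ab: "?a \<in> Mor C T Y" "?b \<in> Mor C T Y" using cmp_closed o m f h Y by auto
  have comp: "cmp C W T Y ?f u =
      cmp C W S Y f (cmp C W T S p1 u) \<oplus>\<^bsub>mor C W Y\<^esub> cmp C W A Y h (cmp C W T A p2 u)"
    if W: "W \<in> obj C" and u: "u \<in> Mor C W T" for W u
    using cmp_add_left[OF W o(3) Y u ab] cmp_assoc[OF W o(3,1) Y u m(3) f]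
      cmp_assoc[OF W o(3,2) Y u m(4) h] by simp
  interpret SY: abelian_group "mor C S Y" using mor_group o Y by simp
  interpret AY: abelian_group "mor C A Y" using mor_group o Y by simp
  have "cmp C S T Y ?f i1 = f"
    using comp[OF o(1) m(1)] e cmp_idm_right[OF o(1) Y f] cmp_zmor_right[OF o(1,2) Y h] f by simp
  moreover have "cmp C A T Y ?f i2 = h"
    using comp[OF o(2) m(2)] e cmp_idm_right[OF o(2) Y h] cmp_zmor_right[OF o(2,1) Y f] h by simp
  ultimately show ?thesis using add_mor_closed[OF o(3) Y ab] comp by blast
qed

section \<open>Extension bifunctors\<close>

lemma additive_subgroup_if_minus_closed:
  assumes "abelian_group G" and sub: "H \<subseteq> carrier G" and zero: "\<zero>\<^bsub>G\<^esub> \<in> H"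
    and minus: "\<And>x y. \<lbrakk>x \<in> H; y \<in> H\<rbrakk> \<Longrightarrow> x \<ominus>\<^bsub>G\<^esub> y \<in> H"
  shows "additive_subgroup H G"
proof -
  interpret abelian_group G by fact
  have inv: "\<ominus>\<^bsub>G\<^esub> x \<in> H" if "x \<in> H" for x
    using minus[OF zero that] that sub by (auto simp: minus_eq)
  have add: "x \<oplus>\<^bsub>G\<^esub> y \<in> H" if "x \<in> H" "y \<in> H" for x y
    using minus[OF that(1) inv[OF that(2)]] that sub by (auto simp: minus_eq)
  show ?thesis
    by (intro additive_subgroupI add.subgroupI sub inv add) (use zero in auto)
qed

lemma minus_eq_zero_imp_eq:
  assumes "abelian_group G" "x \<in> carrier G" "y \<in> carrier G" "x \<ominus>\<^bsub>G\<^esub> y = \<zero>\<^bsub>G\<^esub>"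
  shows "x = y"
proof -
  interpret abelian_group G by fact
  have "x = (x \<ominus>\<^bsub>G\<^esub> y) \<oplus>\<^bsub>G\<^esub> y" using assms(2,3) by (simp add: minus_eq add.m_assoc l_neg)
  then show ?thesis unfolding assms(4) using assms(3) by simp
qed

context additive_bifunctor
begin

lemma zext_closed: "\<lbrakk>X \<in> obj C; A \<in> obj C\<rbrakk> \<Longrightarrow> zext E X A \<in> Ext E X A"
  using abelian_monoid.zero_closed[OF abelian_group.axioms(1)[OF ext_group]] .

lemma pull_zext:
  assumes "X \<in> obj C" "Y \<in> obj C" "A \<in> obj C" "c \<in> Mor C X Y"
  shows "pull E X Y A c (zext E Y A) = zext E X A"
  by (rule additive_map_zero[of "ext E Y A" "ext E X A" "pull E X Y A c"])
    (use assms ext_group pull_closed pull_add_ext in auto)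

lemma push_zext:
  assumes "X \<in> obj C" "A \<in> obj C" "B \<in> obj C" "a \<in> Mor C A B"
  shows "push E X A B a (zext E X A) = zext E X B"
  by (rule additive_map_zero[of "ext E X A" "ext E X B" "push E X A B a"])
    (use assms ext_group push_closed push_add_ext in auto)

lemma pull_zmor:
  assumes "X \<in> obj C" "Y \<in> obj C" "A \<in> obj C" "\<delta> \<in> Ext E Y A"
  shows "pull E X Y A (zmor C X Y) \<delta> = zext E X A"
  by (rule additive_map_zero[of "mor C X Y" "ext E X A" "\<lambda>c. pull E X Y A c \<delta>"])
    (use assms ext_group mor_group pull_closed pull_add_mor in auto)

lemma push_zmor:
  assumes "X \<in> obj C" "A \<in> obj C" "B \<in> obj C" "\<delta> \<in> Ext E X A"
  shows "push E X A B (zmor C A B) \<delta> = zext E X B"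
  by (rule additive_map_zero[of "mor C A B" "ext E X B" "\<lambda>a. push E X A B a \<delta>"])
    (use assms ext_group mor_group push_closed push_add_mor in auto)

lemma pull_minus_mor:
  assumes "X \<in> obj C" "Y \<in> obj C" "A \<in> obj C" "\<delta> \<in> Ext E Y A" "c \<in> Mor C X Y" "c' \<in> Mor C X Y"
  shows "pull E X Y A (c \<ominus>\<^bsub>mor C X Y\<^esub> c') \<delta> = pull E X Y A c \<delta> \<ominus>\<^bsub>ext E X A\<^esub> pull E X Y A c' \<delta>"
  by (rule additive_map_minus[of "mor C X Y" "ext E X A" "\<lambda>c. pull E X Y A c \<delta>"])
    (use assms ext_group mor_group pull_closed pull_add_mor in auto)

lemma push_minus_mor:
  assumes "X \<in> obj C" "A \<in> obj C" "B \<in> obj C" "\<delta> \<in> Ext E X A" "a \<in> Mor C A B" "a' \<in> Mor C A B"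
  shows "push E X A B (a \<ominus>\<^bsub>mor C A B\<^esub> a') \<delta> = push E X A B a \<delta> \<ominus>\<^bsub>ext E X B\<^esub> push E X A B a' \<delta>"
  by (rule additive_map_minus[of "mor C A B" "ext E X B" "\<lambda>a. push E X A B a \<delta>"])
    (use assms ext_group mor_group push_closed push_add_mor in auto)

lemma ext_minus_zero: "\<lbrakk>X \<in> obj C; A \<in> obj C\<rbrakk> \<Longrightarrow>
    zext E X A \<ominus>\<^bsub>ext E X A\<^esub> zext E X A = zext E X A"
proof -
  assume "X \<in> obj C" "A \<in> obj C"
  then interpret abelian_group "ext E X A" by (rule ext_group)
  show ?thesis by (simp add: minus_eq)
qed

lemma proj_trivial_ideal: "category_ideal C (proj_trivial C E)"
proof (intro category_ideal.intro category_ideal_axioms.intro preadditive_category_axioms)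
  fix X Y assume o: "X \<in> obj C" "Y \<in> obj C"
  show "additive_subgroup (proj_trivial C E X Y) (mor C X Y)"
    by (rule additive_subgroup_if_minus_closed[OF mor_group[OF o]])
      (auto simp: proj_trivial_def o zmor_closed pull_zmor minus_mor_closed pull_minus_mor ext_minus_zero)
next
  fix X Y Z f g assume "X \<in> obj C" "Y \<in> obj C" "Z \<in> obj C" "f \<in> proj_trivial C E X Y" "g \<in> Mor C Y Z"
  then show "cmp C X Y Z g f \<in> proj_trivial C E X Z"
    by (auto simp: proj_trivial_def cmp_closed pull_cmp pull_closed)
next
  fix X Y Z f g assume "X \<in> obj C" "Y \<in> obj C" "Z \<in> obj C" "f \<in> Mor C X Y" "g \<in> proj_trivial C E Y Z"
  then show "cmp C X Y Z g f \<in> proj_trivial C E X Z"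
    by (auto simp: proj_trivial_def cmp_closed pull_cmp pull_zext)
qed

lemma inj_trivial_ideal: "category_ideal C (inj_trivial C E)"
proof (intro category_ideal.intro category_ideal_axioms.intro preadditive_category_axioms)
  fix X Y assume o: "X \<in> obj C" "Y \<in> obj C"
  show "additive_subgroup (inj_trivial C E X Y) (mor C X Y)"
    by (rule additive_subgroup_if_minus_closed[OF mor_group[OF o]])
      (auto simp: inj_trivial_def o zmor_closed push_zmor minus_mor_closed push_minus_mor ext_minus_zero)
next
  fix X Y Z f g assume "X \<in> obj C" "Y \<in> obj C" "Z \<in> obj C" "f \<in> inj_trivial C E X Y" "g \<in> Mor C Y Z"
  then show "cmp C X Y Z g f \<in> inj_trivial C E X Z"
    by (auto simp: inj_trivial_def cmp_closed push_cmp push_zext)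
next
  fix X Y Z f g assume "X \<in> obj C" "Y \<in> obj C" "Z \<in> obj C" "f \<in> Mor C X Y" "g \<in> inj_trivial C E Y Z"
  then show "cmp C X Y Z g f \<in> inj_trivial C E X Z"
    by (auto simp: inj_trivial_def cmp_closed push_cmp push_closed)
qed

abbreviation End_submodule :: "'o \<Rightarrow> 'o \<Rightarrow> 'e set \<Rightarrow> bool" where
  "End_submodule X Y F \<equiv> submodule F (End_ring C X) (ext_End_module E Y X)"

lemma ext_End_submodule_iff:
  assumes "X \<in> obj C" "Y \<in> obj C"
  shows "End_submodule X Y F \<longleftrightarrow>
    additive_subgroup F (ext E Y X) \<and> (\<forall>g\<in>Mor C X X. \<forall>\<delta>\<in>F. push E Y X X g \<delta> \<in> F)"
proof -
  have "subgroup F (add_monoid (ext_End_module E Y X)) \<longleftrightarrow> subgroup F (add_monoid (ext E Y X))"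
    by (rule subgroup_cong) (simp_all add: ext_End_module_def)
  then show ?thesis
    by (auto simp: submodule_def submodule_axioms_def additive_subgroup_def ext_End_module_def End_ring_def)
qed

end

context linear_bifunctor
begin

lemma pull_smult_ext:
  assumes "A \<in> obj C" "B \<in> obj C" "X \<in> obj C" "f \<in> Mor C A B" "\<delta> \<in> Ext E B X" "r \<in> carrier k"
  shows "pull E A B X f (r \<odot>\<^bsub>ext E B X\<^esub> \<delta>) = r \<odot>\<^bsub>ext E A X\<^esub> pull E A B X f \<delta>"
proof -
  have "r \<odot>\<^bsub>ext E B X\<^esub> \<delta> \<in> Ext E B X" using module.smult_closed[OF ext_module] assms by simp
  then show ?thesis
    using smult_ext[OF assms(1-3,3,4,5) idm_closed assms(6)] assms
    by (simp add: push_idm pull_closed)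
qed

lemma push_smult_ext:
  assumes "Y \<in> obj C" "A \<in> obj C" "B \<in> obj C" "g \<in> Mor C A B" "\<delta> \<in> Ext E Y A" "r \<in> carrier k"
  shows "push E Y A B g (r \<odot>\<^bsub>ext E Y A\<^esub> \<delta>) = r \<odot>\<^bsub>ext E Y B\<^esub> push E Y A B g \<delta>"
proof -
  have "r \<odot>\<^bsub>ext E Y A\<^esub> \<delta> \<in> Ext E Y A" using module.smult_closed[OF ext_module] assms by simp
  then show ?thesis
    using smult_ext[OF assms(1,1,2,3) idm_closed assms(5,4,6)] assms by (simp add: pull_idm)
qed

lemma push_smult_mor:
  assumes "Y \<in> obj C" "A \<in> obj C" "B \<in> obj C" "g \<in> Mor C A B" "\<delta> \<in> Ext E Y A" "r \<in> carrier k"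
  shows "push E Y A B (r \<odot>\<^bsub>mor C A B\<^esub> g) \<delta> = r \<odot>\<^bsub>ext E Y B\<^esub> push E Y A B g \<delta>"
  using smult_push[OF assms(1,1,2,3) idm_closed assms(5,4,6)] assms by (simp add: pull_idm)

text \<open>Scalars of \<open>k\<close> act on extensions as the endomorphisms \<open>r \<cdot> id\<close>, so \<open>End(X)\<close>-submodules are
\<open>k\<close>-submodules.\<close>

lemma ext_End_submodule_linear:
  assumes o: "X \<in> obj C" "Y \<in> obj C" and F: "End_submodule X Y F"
  shows "submodule F k (ext E Y X)"
proof -
  have sub: "additive_subgroup F (ext E Y X)" and st: "\<forall>g\<in>Mor C X X. \<forall>\<delta>\<in>F. push E Y X X g \<delta> \<in> F"
    using F ext_End_submodule_iff[OF o] by auto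
  show ?thesis
  proof (intro submodule.intro submodule_axioms.intro)
    show "subgroup F (add_monoid (ext E Y X))" using sub by (simp add: additive_subgroup_def)
    fix r \<delta> assume r: "r \<in> carrier k" and d: "\<delta> \<in> F"
    then have dE: "\<delta> \<in> Ext E Y X" using additive_subgroup.a_subset[OF sub] by blast
    have i: "r \<odot>\<^bsub>mor C X X\<^esub> idm C X \<in> Mor C X X"
      using module.smult_closed[OF mor_module[OF o(1,1)] r idm_closed[OF o(1)]] .
    have eq: "push E Y X X (r \<odot>\<^bsub>mor C X X\<^esub> idm C X) \<delta> = r \<odot>\<^bsub>ext E Y X\<^esub> \<delta>"
      using push_smult_mor[OF o(2,1,1) idm_closed dE r] push_idm[OF o(2,1) dE] o by simp
    show "r \<odot>\<^bsub>ext E Y X\<^esub> \<delta> \<in> F" unfolding eq[symmetric] using st i d by blast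
  qed
qed

end

section \<open>Trace functionals\<close>

text \<open>The functionals \<open>t X\<close> encode a Serre-type duality. The axioms \<open>functional_represented\<close> and
\<open>zero_functional\<close> say that \<open>h \<mapsto> t X (h\<^sup>*-)\<close> is an isomorphism from the projectively stable morphisms
\<open>K X \<rightarrow> Y\<close> to the dual of \<open>\<bbbE>(Y, X)\<close>; the axiom \<open>transposed\<close> makes every morphism \<open>K X \<rightarrow> K X'\<close> adjoint to
a morphism \<open>X \<rightarrow> X'\<close>, as fullness of the functor \<open>\<tau>\<^sup>-\<close> does in the application.\<close>

locale serre_trace = exact_realization n C E s + linear_bifunctor k C E
  for n :: nat and C :: "('o, 'm, 'k) cat" and E :: "('o, 'm, 'k, 'e) ext_data"
    and s :: "('o, 'm, 'e) realization" and k :: "'k ring" +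
  fixes J :: "('k, 'j) module" and K :: "'o \<Rightarrow> 'o" and t :: "'o \<Rightarrow> 'e \<Rightarrow> 'j"
  assumes artinian: "artinian_ring k"
    and cogenerator: "injective_cogenerator k J"
    and finite: "ext_finite k C E"
    and K_obj: "X \<in> obj C \<Longrightarrow> K X \<in> obj C"
    and t_linear: "X \<in> obj C \<Longrightarrow> linear_map k (ext E (K X) X) J (t X)"
    and functional_represented: "\<lbrakk>X \<in> obj C; Y \<in> obj C; linear_map k (ext E Y X) J \<phi>\<rbrakk> \<Longrightarrow>
      \<exists>h\<in>Mor C (K X) Y. \<forall>\<delta>\<in>Ext E Y X. \<phi> \<delta> = t X (pull E (K X) Y X h \<delta>)"
    and zero_functional: "\<lbrakk>X \<in> obj C; Y \<in> obj C; h \<in> Mor C (K X) Y;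
        \<forall>\<delta>\<in>Ext E Y X. t X (pull E (K X) Y X h \<delta>) = \<zero>\<^bsub>J\<^esub>\<rbrakk> \<Longrightarrow> h \<in> proj_trivial C E (K X) Y"
    and transposed: "\<lbrakk>X \<in> obj C; X' \<in> obj C; e \<in> Mor C (K X) (K X')\<rbrakk> \<Longrightarrow>
      \<exists>g\<in>Mor C X X'. \<forall>\<epsilon>\<in>Ext E (K X') X.
        t X (pull E (K X) (K X') X e \<epsilon>) = t X' (push E (K X') X X' g \<epsilon>)"
begin

abbreviation pairing :: "'o \<Rightarrow> 'o \<Rightarrow> 'm \<Rightarrow> 'e \<Rightarrow> 'j" where
  "pairing X Y h \<delta> \<equiv> t X (pull E (K X) Y X h \<delta>)"

definition ann :: "'o \<Rightarrow> 'o \<Rightarrow> 'e set \<Rightarrow> 'm set" where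
  "ann X Y F = {h \<in> Mor C (K X) Y. \<forall>\<delta>\<in>F. pairing X Y h \<delta> = \<zero>\<^bsub>J\<^esub>}"

definition coann :: "'o \<Rightarrow> 'o \<Rightarrow> 'm set \<Rightarrow> 'e set" where
  "coann X Y H = {\<delta> \<in> Ext E Y X. \<forall>h\<in>H. pairing X Y h \<delta> = \<zero>\<^bsub>J\<^esub>}"

text \<open>These are the full preimages of the \<open>End(A)\<close>-submodules of the stable morphisms \<open>A \<rightarrow> Y\<close>. Negatives
are obtained by composing with the negative of the identity.\<close>

definition right_submodule :: "'o \<Rightarrow> 'o \<Rightarrow> 'm set \<Rightarrow> bool" where
  "right_submodule A Y H \<longleftrightarrow> H \<subseteq> Mor C A Y \<and> proj_trivial C E A Y \<subseteq> H \<and>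
    (\<forall>h\<in>H. \<forall>h'\<in>H. h \<oplus>\<^bsub>mor C A Y\<^esub> h' \<in> H) \<and> (\<forall>h\<in>H. \<forall>e\<in>Mor C A A. cmp C A A Y h e \<in> H)"

lemma injective: "injective_module k J"
  using cogenerator unfolding injective_cogenerator_def by blast

lemma J_module: "module k J"
  using injective unfolding injective_module_def by blast

lemma ext_fg: "\<lbrakk>X \<in> obj C; Y \<in> obj C\<rbrakk> \<Longrightarrow> finitely_generated k (ext E X Y) (Ext E X Y)"
  using finite unfolding ext_finite_def by blast

lemma J_abelian: "abelian_group J"
  using J_module module.axioms(2) by blast

lemma t_closed: "\<lbrakk>X \<in> obj C; \<epsilon> \<in> Ext E (K X) X\<rbrakk> \<Longrightarrow> t X \<epsilon> \<in> carrier J"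
  using t_linear unfolding linear_map_def by blast

lemma t_add: "\<lbrakk>X \<in> obj C; \<epsilon> \<in> Ext E (K X) X; \<epsilon>' \<in> Ext E (K X) X\<rbrakk>
    \<Longrightarrow> t X (\<epsilon> \<oplus>\<^bsub>ext E (K X) X\<^esub> \<epsilon>') = t X \<epsilon> \<oplus>\<^bsub>J\<^esub> t X \<epsilon>'"
  using t_linear unfolding linear_map_def by blast

lemma t_zero: "X \<in> obj C \<Longrightarrow> t X (zext E (K X) X) = \<zero>\<^bsub>J\<^esub>"
  by (rule additive_map_zero[of "ext E (K X) X" J "t X"])
    (auto simp: ext_group K_obj J_abelian t_closed t_add)

lemma t_minus: "\<lbrakk>X \<in> obj C; \<epsilon> \<in> Ext E (K X) X; \<epsilon>' \<in> Ext E (K X) X\<rbrakk>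
    \<Longrightarrow> t X (\<epsilon> \<ominus>\<^bsub>ext E (K X) X\<^esub> \<epsilon>') = t X \<epsilon> \<ominus>\<^bsub>J\<^esub> t X \<epsilon>'"
  by (rule additive_map_minus[of "ext E (K X) X" J "t X"])
    (auto simp: ext_group K_obj J_abelian t_closed t_add)

lemma pairing_linear:
  assumes o: "X \<in> obj C" "Y \<in> obj C" and h: "h \<in> Mor C (K X) Y"
  shows "linear_map k (ext E Y X) J (pairing X Y h)"
  using t_linear[OF o(1)] o h
  by (auto simp: linear_map_def K_obj pull_closed t_closed pull_add_ext t_add pull_smult_ext)

lemma pairing_add:
  assumes o: "X \<in> obj C" "Y \<in> obj C" and h: "h \<in> Mor C (K X) Y" "h' \<in> Mor C (K X) Y"
    and d: "\<delta> \<in> Ext E Y X"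
  shows "pairing X Y (h \<oplus>\<^bsub>mor C (K X) Y\<^esub> h') \<delta> = pairing X Y h \<delta> \<oplus>\<^bsub>J\<^esub> pairing X Y h' \<delta>"
  using assms by (simp add: K_obj pull_add_mor t_add pull_closed)

lemma pairing_minus:
  assumes o: "X \<in> obj C" "Y \<in> obj C" and h: "h \<in> Mor C (K X) Y" "h' \<in> Mor C (K X) Y"
    and d: "\<delta> \<in> Ext E Y X"
  shows "pairing X Y (h \<ominus>\<^bsub>mor C (K X) Y\<^esub> h') \<delta> = pairing X Y h \<delta> \<ominus>\<^bsub>J\<^esub> pairing X Y h' \<delta>"
  using assms by (simp add: K_obj pull_minus_mor t_minus pull_closed)

lemma pairing_proj_trivial:
  assumes "X \<in> obj C" "Y \<in> obj C" "h \<in> proj_trivial C E (K X) Y" "\<delta> \<in> Ext E Y X"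
  shows "pairing X Y h \<delta> = \<zero>\<^bsub>J\<^esub>"
  using assms t_zero by (simp add: proj_trivial_def)

lemma pairing_separates:
  assumes o: "X \<in> obj C" "Y \<in> obj C" and F: "submodule F k (ext E Y X)"
    and d: "\<delta> \<in> Ext E Y X" "\<delta> \<notin> F"
  shows "\<exists>h\<in>ann X Y F. pairing X Y h \<delta> \<noteq> \<zero>\<^bsub>J\<^esub>"
proof -
  have M: "module k (ext E Y X)" using ext_module o by simp
  obtain \<phi> where \<phi>: "linear_map k (ext E Y X) J \<phi>" "\<forall>x\<in>F. \<phi> x = \<zero>\<^bsub>J\<^esub>" "\<phi> \<delta> \<noteq> \<zero>\<^bsub>J\<^esub>"
    using functional_separates[OF M cogenerator ext_fg[OF o(2,1)] F d] by blast
  obtain h where h: "h \<in> Mor C (K X) Y" "\<forall>\<delta>\<in>Ext E Y X. \<phi> \<delta> = pairing X Y h \<delta>"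
    using functional_represented[OF o \<phi>(1)] by blast
  have "pairing X Y h x = \<zero>\<^bsub>J\<^esub>" if x: "x \<in> F" for x
  proof -
    have "x \<in> Ext E Y X" using module.submoduleE(1)[OF M F] x by blast
    then have "pairing X Y h x = \<phi> x" using h(2) by simp
    then show ?thesis using \<phi>(2) x by simp
  qed
  then have "h \<in> ann X Y F" unfolding ann_def using h(1) by blast
  then show ?thesis using h(2) d(1) \<phi>(3) by auto
qed

lemma ext_zero_if_pairing_zero:
  assumes o: "X \<in> obj C" "Y \<in> obj C" and d: "\<delta> \<in> Ext E Y X"
    and z: "\<And>h. h \<in> Mor C (K X) Y \<Longrightarrow> pairing X Y h \<delta> = \<zero>\<^bsub>J\<^esub>"
  shows "\<delta> = zext E Y X"
proof (rule ccontr)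
  assume "\<delta> \<noteq> zext E Y X"
  then have "\<exists>h\<in>ann X Y {zext E Y X}. pairing X Y h \<delta> \<noteq> \<zero>\<^bsub>J\<^esub>"
    using pairing_separates[OF o zero_submodule[OF ext_module[OF o(2,1)]] d] by simp
  then show False using z unfolding ann_def by blast
qed

text \<open>One of the two double annihilator laws: an element outside \<open>F\<close> is separated from \<open>F\<close> by a
functional, and functionals are represented by morphisms.\<close>

lemma coann_ann:
  assumes o: "X \<in> obj C" "Y \<in> obj C" and F: "submodule F k (ext E Y X)"
  shows "coann X Y (ann X Y F) = F"
proof
  show "coann X Y (ann X Y F) \<subseteq> F"
    using pairing_separates[OF o F] unfolding coann_def by blast
  show "F \<subseteq> coann X Y (ann X Y F)"
    using module.submoduleE(1)[OF ext_module[OF o(2,1)] F] unfolding coann_def ann_def by auto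
qed

lemma pull_kernel_submodule:
  assumes o: "X \<in> obj C" "Y \<in> obj C" "S \<in> obj C" and f: "f \<in> Mor C S Y"
  shows "submodule {\<delta> \<in> Ext E Y X. pull E S Y X f \<delta> = zext E S X} k (ext E Y X)"
proof -
  interpret YX: module k "ext E Y X" using ext_module o by simp
  interpret SX: module k "ext E S X" using ext_module o by simp
  have minus: "pull E S Y X f (\<ominus>\<^bsub>ext E Y X\<^esub> a) = zext E S X"
    if "a \<in> Ext E Y X" "pull E S Y X f a = zext E S X" for a
  proof -
    have "\<ominus>\<^bsub>ext E Y X\<^esub> a = (\<ominus>\<^bsub>k\<^esub> \<one>\<^bsub>k\<^esub>) \<odot>\<^bsub>ext E Y X\<^esub> a" using that by (simp add: YX.smult_l_minus)
    then show ?thesis using that o f by (simp add: pull_smult_ext)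
  qed
  show ?thesis
    by (rule YX.submoduleI) (use o f minus in \<open>auto simp: pull_zext pull_add_ext pull_smult_ext\<close>)
qed

text \<open>A functional on \<open>\<bbbE>(Y, X)\<close> that vanishes on the kernel of \<open>f\<^sup>*\<close> is defined on the image of \<open>f\<^sup>*\<close> in
\<open>\<bbbE>(S, X)\<close>. Its extension to \<open>\<bbbE>(S, X)\<close> is represented by some \<open>u\<close>, and composing with \<open>f\<close> represents the
original functional.\<close>

lemma functional_on_pull_image:
  assumes o: "X \<in> obj C" "Y \<in> obj C" "S \<in> obj C" and f: "f \<in> Mor C S Y"
    and \<phi>: "linear_map k (ext E Y X) J \<phi>"
    and ker: "\<And>\<delta>. \<lbrakk>\<delta> \<in> Ext E Y X; pull E S Y X f \<delta> = zext E S X\<rbrakk> \<Longrightarrow> \<phi> \<delta> = \<zero>\<^bsub>J\<^esub>"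
  shows "\<exists>u\<in>Mor C (K X) S. \<forall>\<delta>\<in>Ext E Y X. \<phi> \<delta> = pairing X Y (cmp C (K X) S Y f u) \<delta>"
proof -
  interpret YX: module k "ext E Y X" using ext_module o by simp
  interpret SX: module k "ext E S X" using ext_module o by simp
  interpret J: module k J by (rule J_module)
  let ?p = "pull E S Y X f"
  let ?I = "?p ` Ext E Y X"
  have pc: "?p \<delta> \<in> Ext E S X" if "\<delta> \<in> Ext E Y X" for \<delta> using pull_closed[OF o(3,2,1) f that] .
  have \<phi>c: "\<phi> \<delta> \<in> carrier J" if "\<delta> \<in> Ext E Y X" for \<delta> using \<phi> that unfolding linear_map_def by blast
  have sub: "submodule ?I k (ext E S X)"
  proof (rule SX.submoduleI)
    show "zext E S X \<in> ?I"
      using pull_zext[OF o(3,2,1) f] by (intro image_eqI[of _ _ "zext E Y X"]) auto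
    show "\<ominus>\<^bsub>ext E S X\<^esub> a \<in> ?I" if a: "a \<in> ?I" for a
    proof -
      obtain \<delta> where d: "\<delta> \<in> Ext E Y X" "a = ?p \<delta>" using a by blast
      have "\<ominus>\<^bsub>ext E S X\<^esub> a = ?p ((\<ominus>\<^bsub>k\<^esub> \<one>\<^bsub>k\<^esub>) \<odot>\<^bsub>ext E Y X\<^esub> \<delta>)"
        using d o f pc by (simp add: pull_smult_ext SX.smult_l_minus)
      then show ?thesis using d by blast
    qed
    show "a \<oplus>\<^bsub>ext E S X\<^esub> b \<in> ?I" if "a \<in> ?I" "b \<in> ?I" for a b
      using that pull_add_ext[OF o(3,2,1) f] by (auto simp del: pull_add_ext) (metis YX.M.a_closed imageI)
    show "r \<odot>\<^bsub>ext E S X\<^esub> a \<in> ?I" if "r \<in> carrier k" "a \<in> ?I" for r a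
      using that pull_smult_ext[OF o(3,2,1) f] by auto (metis YX.smult_closed imageI)
  qed (use pc in auto)
  \<comment> \<open>The functional that \<open>\<phi>\<close> induces on the image, evaluated at an arbitrary preimage.\<close>
  define \<psi> where "\<psi> y = \<phi> (inv_into (Ext E Y X) ?p y)" for y
  have \<psi>: "\<psi> (?p \<delta>) = \<phi> \<delta>" if d: "\<delta> \<in> Ext E Y X" for \<delta>
  proof -
    let ?d = "inv_into (Ext E Y X) ?p (?p \<delta>)"
    have d': "?d \<in> Ext E Y X" "?p ?d = ?p \<delta>" using d by (simp_all add: inv_into_into f_inv_into_f)
    have "?p (?d \<ominus>\<^bsub>ext E Y X\<^esub> \<delta>) = ?p ?d \<ominus>\<^bsub>ext E S X\<^esub> ?p \<delta>"
      by (rule additive_map_minus[of _ _ ?p])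
        (use d d' pc o f in \<open>auto simp: ext_group pull_add_ext\<close>)
    also have "\<dots> = zext E S X" using d' pc[OF d] by (simp add: SX.M.minus_eq SX.M.r_neg)
    finally have "\<phi> (?d \<ominus>\<^bsub>ext E Y X\<^esub> \<delta>) = \<zero>\<^bsub>J\<^esub>" using ker[OF YX.M.minus_closed[OF d'(1) d]] by simp
    moreover have "\<phi> (?d \<ominus>\<^bsub>ext E Y X\<^esub> \<delta>) = \<phi> ?d \<ominus>\<^bsub>J\<^esub> \<phi> \<delta>"
      by (rule additive_map_minus[of _ _ \<phi>])
        (use d d' \<phi> o in \<open>auto simp: ext_group J_abelian linear_map_def\<close>)
    ultimately show ?thesis
      using minus_eq_zero_imp_eq[OF J_abelian \<phi>c[OF d'(1)] \<phi>c[OF d]] unfolding \<psi>_def by simp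
  qed
  have "functional_on k J (ext E S X) ?I \<psi>"
    unfolding functional_on_def linear_map_def
  proof (intro conjI ballI Pi_I; simp)
    fix y assume "y \<in> ?I" then show "\<psi> y \<in> carrier J" using \<psi> \<phi>c by auto
  next
    fix x y assume "x \<in> ?I" "y \<in> ?I"
    then obtain a b where ab: "a \<in> Ext E Y X" "b \<in> Ext E Y X" "x = ?p a" "y = ?p b" by blast
    have "x \<oplus>\<^bsub>ext E S X\<^esub> y = ?p (a \<oplus>\<^bsub>ext E Y X\<^esub> b)" using ab o f by (simp add: pull_add_ext)
    then have "\<psi> (x \<oplus>\<^bsub>ext E S X\<^esub> y) = \<phi> (a \<oplus>\<^bsub>ext E Y X\<^esub> b)" using \<psi> ab by simp
    then show "\<psi> (x \<oplus>\<^bsub>ext E S X\<^esub> y) = \<psi> x \<oplus>\<^bsub>J\<^esub> \<psi> y"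
      using \<phi> ab \<psi> unfolding linear_map_def by simp
  next
    fix r x assume r: "r \<in> carrier k" and "x \<in> ?I"
    then obtain a where a: "a \<in> Ext E Y X" "x = ?p a" by blast
    have "r \<odot>\<^bsub>ext E S X\<^esub> x = ?p (r \<odot>\<^bsub>ext E Y X\<^esub> a)" using a o f r by (simp add: pull_smult_ext)
    then have "\<psi> (r \<odot>\<^bsub>ext E S X\<^esub> x) = \<phi> (r \<odot>\<^bsub>ext E Y X\<^esub> a)" using \<psi> a r by simp
    then show "\<psi> (r \<odot>\<^bsub>ext E S X\<^esub> x) = r \<odot>\<^bsub>J\<^esub> \<psi> x"
      using \<phi> a \<psi> r unfolding linear_map_def by simp
  qed
  then obtain g where g: "linear_map k (ext E S X) J g" "\<forall>x\<in>?I. g x = \<psi> x"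
    using functional_extends[OF ext_module[OF o(3,1)] injective ext_fg[OF o(3,1)] sub] by blast
  then obtain u where u: "u \<in> Mor C (K X) S" "\<forall>\<epsilon>\<in>Ext E S X. g \<epsilon> = pairing X S u \<epsilon>"
    using functional_represented[OF o(1,3)] by blast
  have "\<phi> \<delta> = pairing X Y (cmp C (K X) S Y f u) \<delta>" if d: "\<delta> \<in> Ext E Y X" for \<delta>
  proof -
    have "\<phi> \<delta> = g (?p \<delta>)" using \<psi>[OF d] g(2) d by simp
    also have "\<dots> = pairing X S u (?p \<delta>)" using u(2) pc[OF d] by blast
    finally show ?thesis using pull_cmp[OF K_obj[OF o(1)] o(3,2,1) u(1) f d] by simp
  qed
  then show ?thesis using u(1) by blast
qed

text \<open>The other double annihilator law, together with finite generation. Among the morphisms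
\<open>f : S \<rightarrow> Y\<close> assembled from finitely many elements of \<open>H\<close>, one has a minimal kernel of \<open>f\<^sup>*\<close> on
\<open>\<bbbE>(Y, X)\<close>. If \<open>h \<in> H\<close>, then adjoining \<open>h\<close> to \<open>f\<close>, on the object \<open>S \<oplus> K X\<close>, does not change this kernel,
so \<open>h\<^sup>*\<close> vanishes on it. Hence a functional that vanishes on all extensions annihilated by \<open>H\<close>
vanishes on the kernel of \<open>f\<^sup>*\<close>, and \<open>functional_on_pull_image\<close> represents it by a composite \<open>f u\<close>.\<close>

lemma right_submodule_closed_and_finite:
  assumes o: "X \<in> obj C" "Y \<in> obj C" and H: "right_submodule (K X) Y H"
  shows "\<exists>G. finite G \<and> G \<subseteq> H \<and>
    (\<forall>H'. right_submodule (K X) Y H' \<and> G \<subseteq> H' \<longrightarrow> ann X Y (coann X Y H) \<subseteq> H')"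
proof -
  let ?ker = "\<lambda>S f. {\<delta> \<in> Ext E Y X. pull E S Y X f \<delta> = zext E S X}"
  \<comment> \<open>\<open>gen S f\<close>: all composites \<open>f u\<close> lie in the right submodule generated by finitely many elements of \<open>H\<close>.\<close>
  define gen where "gen S f \<longleftrightarrow> S \<in> obj C \<and> f \<in> Mor C S Y \<and>
    (\<exists>G. finite G \<and> G \<subseteq> H \<and> (\<forall>H'. right_submodule (K X) Y H' \<and> G \<subseteq> H' \<longrightarrow>
       (\<forall>u\<in>Mor C (K X) S. cmp C (K X) S Y f u \<in> H')))" for S f
  define \<A> where "\<A> = {?ker S f | S f. gen S f}"
  have KX: "K X \<in> obj C" using K_obj o by simp
  obtain O0 where O0: "is_zero_object C O0" using ex_zero_object by blast
  then have O0o: "O0 \<in> obj C" unfolding is_zero_object_def by blast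
  have "gen O0 (zmor C O0 Y)"
  proof -
    have "cmp C (K X) O0 Y (zmor C O0 Y) u \<in> H'"
      if H': "right_submodule (K X) Y H'" and u: "u \<in> Mor C (K X) O0" for H' u
    proof -
      have "cmp C (K X) O0 Y (zmor C O0 Y) u = zmor C (K X) Y"
        using cmp_zmor_left[OF KX O0o o(2) u] .
      also have "zmor C (K X) Y \<in> proj_trivial C E (K X) Y"
        using KX o by (simp add: proj_trivial_def zmor_closed pull_zmor)
      finally show ?thesis using H' unfolding right_submodule_def by blast
    qed
    then show ?thesis unfolding gen_def using O0o o zmor_closed by (intro conjI exI[of _ "{}"]) auto
  qed
  then have A0: "?ker O0 (zmor C O0 Y) \<in> \<A>" unfolding \<A>_def by blast
  have "\<exists>A\<in>\<A>. \<forall>B\<in>\<A>. B \<subseteq> A \<longrightarrow> B = A"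
  proof (rule ex_minimal_submodule[OF ext_module[OF o(2,1)] artinian ext_fg[OF o(2,1)] A0])
    fix A assume "A \<in> \<A>"
    then obtain S f where "A = ?ker S f" "gen S f" unfolding \<A>_def by blast
    then show "submodule A k (ext E Y X)" using pull_kernel_submodule[OF o] unfolding gen_def by blast
  qed
  then obtain A where A: "A \<in> \<A>" "\<forall>B\<in>\<A>. B \<subseteq> A \<longrightarrow> B = A" by (elim bexE)
  then obtain S f where Sf: "A = ?ker S f" and gen: "gen S f" unfolding \<A>_def by blast
  have min: "?ker S' f' = ?ker S f" if S': "gen S' f'" "?ker S' f' \<subseteq> ?ker S f" for S' f'
  proof -
    have "?ker S' f' \<in> \<A>" unfolding \<A>_def using S'(1) by blast
    then show ?thesis by (rule A(2)[unfolded Sf, rule_format, OF _ S'(2)])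
  qed
  have S: "S \<in> obj C" and f: "f \<in> Mor C S Y" using gen unfolding gen_def by simp_all
  obtain G where G: "finite G" "G \<subseteq> H"
    and GH': "\<forall>H'. right_submodule (K X) Y H' \<and> G \<subseteq> H' \<longrightarrow> (\<forall>u\<in>Mor C (K X) S. cmp C (K X) S Y f u \<in> H')"
    using gen unfolding gen_def by (elim conjE exE)
  have GH: "cmp C (K X) S Y f u \<in> H'"
    if "right_submodule (K X) Y H'" "G \<subseteq> H'" "u \<in> Mor C (K X) S" for H' u
    using GH' that by simp
  have killed: "pull E (K X) Y X h \<delta> = zext E (K X) X"
    if h: "h \<in> H" and d: "\<delta> \<in> ?ker S f" for h \<delta>
  proof -
    have hm: "h \<in> Mor C (K X) Y" using h H unfolding right_submodule_def by blast
    obtain T i1 i2 p1 p2 where T: "is_biproduct C S (K X) T i1 i2 p1 p2" using ex_biproduct[OF S KX] by blast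
    then have T': "T \<in> obj C" "i1 \<in> Mor C S T" "i2 \<in> Mor C (K X) T" "p1 \<in> Mor C T S" "p2 \<in> Mor C T (K X)"
      unfolding is_biproduct_def by auto
    obtain f' where fm: "f' \<in> Mor C T Y" and fi1: "cmp C S T Y f' i1 = f" and fi2: "cmp C (K X) T Y f' i2 = h"
      and f'_cmp: "\<And>W u. \<lbrakk>W \<in> obj C; u \<in> Mor C W T\<rbrakk> \<Longrightarrow> cmp C W T Y f' u =
        cmp C W S Y f (cmp C W T S p1 u) \<oplus>\<^bsub>mor C W Y\<^esub> cmp C W (K X) Y h (cmp C W T (K X) p2 u)"
      using biproduct_copair[OF T o(2) f hm] by blast
    have "gen T f'"
    proof -
      have "cmp C (K X) T Y f' u \<in> H'"
        if H': "right_submodule (K X) Y H'" "insert h G \<subseteq> H'" and u: "u \<in> Mor C (K X) T" for H' u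
      proof -
        have p1u: "cmp C (K X) T S p1 u \<in> Mor C (K X) S" and p2u: "cmp C (K X) T (K X) p2 u \<in> Mor C (K X) (K X)"
          using cmp_closed T' u S KX by auto
        have "cmp C (K X) S Y f (cmp C (K X) T S p1 u) \<in> H'" using GH[OF H'(1) _ p1u] H'(2) by blast
        moreover have "cmp C (K X) (K X) Y h (cmp C (K X) T (K X) p2 u) \<in> H'"
          using H' p2u unfolding right_submodule_def by blast
        ultimately show ?thesis unfolding f'_cmp[OF KX u] using H'(1) unfolding right_submodule_def by blast
      qed
      then show ?thesis unfolding gen_def using T'(1) fm G h by (intro conjI exI[of _ "insert h G"]) auto
    qed
    moreover have "?ker T f' \<subseteq> ?ker S f"
    proof
      fix \<epsilon> assume e: "\<epsilon> \<in> ?ker T f'"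
      then have "pull E S Y X (cmp C S T Y f' i1) \<epsilon> = zext E S X"
        using pull_cmp[OF S T'(1) o(2,1) T'(2) fm] pull_zext[OF S T'(1) o(1) T'(2)] by simp
      then show "\<epsilon> \<in> ?ker S f" using e unfolding fi1 by blast
    qed
    ultimately have "?ker T f' = ?ker S f" by (rule min)
    with d have "\<delta> \<in> ?ker T f'" by simp
    then have "pull E (K X) Y X (cmp C (K X) T Y f' i2) \<delta> = zext E (K X) X"
      using pull_cmp[OF KX T'(1) o(2,1) T'(3) fm] pull_zext[OF KX T'(1) o(1) T'(3)] by simp
    then show ?thesis unfolding fi2 .
  qed
  have "ann X Y (coann X Y H) \<subseteq> H'" if H': "right_submodule (K X) Y H'" "G \<subseteq> H'" for H'
  proof
    fix h assume h: "h \<in> ann X Y (coann X Y H)"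
    then have hm: "h \<in> Mor C (K X) Y" unfolding ann_def by blast
    have z: "pairing X Y h \<delta> = \<zero>\<^bsub>J\<^esub>" if d: "\<delta> \<in> Ext E Y X" "pull E S Y X f \<delta> = zext E S X" for \<delta>
    proof -
      have "\<delta> \<in> coann X Y H" unfolding coann_def using killed d t_zero[OF o(1)] by simp
      then show ?thesis using h unfolding ann_def by blast
    qed
    obtain u where u: "u \<in> Mor C (K X) S"
      "\<forall>\<delta>\<in>Ext E Y X. pairing X Y h \<delta> = pairing X Y (cmp C (K X) S Y f u) \<delta>"
      using functional_on_pull_image[OF o S f pairing_linear[OF o hm] z] by blast
    let ?g = "cmp C (K X) S Y f u"
    have gm: "?g \<in> Mor C (K X) Y" using cmp_closed[OF KX S o(2) u(1) f] .
    interpret J: module k J by (rule J_module)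
    interpret KY: abelian_group "mor C (K X) Y" using mor_group KX o by simp
    have "pairing X Y (h \<ominus>\<^bsub>mor C (K X) Y\<^esub> ?g) \<delta> = \<zero>\<^bsub>J\<^esub>" if d: "\<delta> \<in> Ext E Y X" for \<delta>
    proof -
      have "pairing X Y ?g \<delta> \<in> carrier J" using pairing_linear[OF o gm] d unfolding linear_map_def by blast
      then show ?thesis
        using pairing_minus[OF o hm gm d] u(2) d by (simp add: J.M.minus_eq J.M.r_neg)
    qed
    then have "h \<ominus>\<^bsub>mor C (K X) Y\<^esub> ?g \<in> proj_trivial C E (K X) Y"
      using zero_functional[OF o KY.minus_closed[OF hm gm]] by blast
    then have 1: "h \<ominus>\<^bsub>mor C (K X) Y\<^esub> ?g \<in> H'" using H'(1) unfolding right_submodule_def by blast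
    have 2: "?g \<in> H'" using GH[OF H' u(1)] .
    have "h = (h \<ominus>\<^bsub>mor C (K X) Y\<^esub> ?g) \<oplus>\<^bsub>mor C (K X) Y\<^esub> ?g"
      using hm gm by (simp add: KY.minus_eq KY.add.m_assoc KY.l_neg)
    then show "h \<in> H'" using 1 2 H'(1) unfolding right_submodule_def by metis
  qed
  then show ?thesis using G by blast
qed

end

section \<open>Submodules generated by one extension\<close>

context additive_bifunctor
begin

text \<open>The image of \<open>\<delta>\<^sup>\<sharp>\<close> at \<open>X\<close>; it is the value of \<open>\<xi>\<close> at the deflation of an exangle with extension \<open>\<delta>\<close>.\<close>

definition orbit :: "'o \<Rightarrow> 'o \<Rightarrow> 'o \<Rightarrow> 'e \<Rightarrow> 'e set" where
  "orbit A X Y \<delta> = (\<lambda>g. push E Y A X g \<delta>) ` Mor C A X"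

lemma orbit_submodule:
  assumes o: "A \<in> obj C" "X \<in> obj C" "Y \<in> obj C" and d: "\<delta> \<in> Ext E Y A"
  shows "End_submodule X Y (orbit A X Y \<delta>)"
  unfolding ext_End_submodule_iff[OF o(2,3)]
proof
  show "additive_subgroup (orbit A X Y \<delta>) (ext E Y X)"
  proof (rule additive_subgroup_if_minus_closed[OF ext_group[OF o(3,2)]])
    show "orbit A X Y \<delta> \<subseteq> Ext E Y X" unfolding orbit_def using push_closed o d by auto
    show "zext E Y X \<in> orbit A X Y \<delta>"
      unfolding orbit_def using push_zmor o d zmor_closed by (intro image_eqI[of _ _ "zmor C A X"]) auto
    fix x y assume "x \<in> orbit A X Y \<delta>" "y \<in> orbit A X Y \<delta>"
    then obtain a b where "a \<in> Mor C A X" "b \<in> Mor C A X" "x = push E Y A X a \<delta>" "y = push E Y A X b \<delta>"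
      unfolding orbit_def by blast
    then show "x \<ominus>\<^bsub>ext E Y X\<^esub> y \<in> orbit A X Y \<delta>"
      unfolding orbit_def using push_minus_mor[OF o(3,1,2) d] minus_mor_closed[OF o(1,2)]
      by (intro image_eqI[of _ _ "a \<ominus>\<^bsub>mor C A X\<^esub> b"]) auto
  qed
  show "\<forall>g\<in>Mor C X X. \<forall>\<epsilon>\<in>orbit A X Y \<delta>. push E Y X X g \<epsilon> \<in> orbit A X Y \<delta>"
    unfolding orbit_def using push_cmp[OF o(3,1,2,2) _ _ d] cmp_closed[OF o(1,2,2)] by (auto simp: image_iff) metis
qed

end

section \<open>Direct sums\<close>

context preadditive_category
begin

lemma direct_sum_snoc:
  assumes S: "is_direct_sum C m (\<lambda>_. X) S \<iota> \<pi>" and X: "X \<in> obj C"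
    and T: "is_biproduct C S X T i1 i2 p1 p2"
  shows "is_direct_sum C (Suc m) (\<lambda>_. X) T
    (\<lambda>i. if i < m then cmp C X S T i1 (\<iota> i) else i2) (\<lambda>i. if i < m then cmp C T S X (\<pi> i) p1 else p2)"
    (is "is_direct_sum C _ _ T ?\<iota> ?\<pi>")
proof -
  have S': "S \<in> obj C" "\<And>i. i < m \<Longrightarrow> \<iota> i \<in> Mor C X S" "\<And>i. i < m \<Longrightarrow> \<pi> i \<in> Mor C S X"
    "\<And>i j. \<lbrakk>i < m; j < m\<rbrakk> \<Longrightarrow> cmp C X S X (\<pi> j) (\<iota> i) = (if i = j then idm C X else zmor C X X)"
    "finsum (mor C S S) (\<lambda>i. cmp C S X S (\<iota> i) (\<pi> i)) {..<m} = idm C S"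
    using S unfolding is_direct_sum_def by auto
  have T': "T \<in> obj C" "i1 \<in> Mor C S T" "i2 \<in> Mor C X T" "p1 \<in> Mor C T S" "p2 \<in> Mor C T X"
    "cmp C S T S p1 i1 = idm C S" "cmp C X T X p2 i2 = idm C X"
    "cmp C X T S p1 i2 = zmor C X S" "cmp C S T X p2 i1 = zmor C S X"
    "cmp C T S T i1 p1 \<oplus>\<^bsub>mor C T T\<^esub> cmp C T X T i2 p2 = idm C T"
    using T unfolding is_biproduct_def by auto
  have \<iota>c: "?\<iota> i \<in> Mor C X T" and \<pi>c: "?\<pi> i \<in> Mor C T X" for i
    using S' T' X cmp_closed by auto
  have orth: "cmp C X T X (?\<pi> j) (?\<iota> i) = (if i = j then idm C X else zmor C X X)"
    if "i < Suc m" "j < Suc m" for i j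
  proof -
    have 1: "cmp C X T X (cmp C T S X (\<pi> j) p1) (cmp C X S T i1 (\<iota> i)) = cmp C X S X (\<pi> j) (\<iota> i)"
      if "i < m" "j < m" for i j
    proof -
      have "cmp C X T S p1 (cmp C X S T i1 (\<iota> i)) = \<iota> i"
        using cmp_assoc[OF X S'(1) T'(1) S'(1) S'(2)[OF that(1)] T'(2,4)] T'(6)
          cmp_idm_left[OF X S'(1) S'(2)[OF that(1)]] by simp
      then show ?thesis
        using cmp_assoc[OF X T'(1) S'(1) X cmp_closed[OF X S'(1) T'(1) S'(2)[OF that(1)] T'(2)] T'(4) S'(3)[OF that(2)]]
        by simp
    qed
    have 2: "cmp C X T X (cmp C T S X (\<pi> j) p1) i2 = zmor C X X" if "j < m" for j
      using cmp_assoc[OF X T'(1) S'(1) X T'(3,4) S'(3)[OF that]] T'(8)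
        cmp_zmor_right[OF X S'(1) X S'(3)[OF that]] by simp
    have 3: "cmp C X T X p2 (cmp C X S T i1 (\<iota> i)) = zmor C X X" if "i < m" for i
      using cmp_assoc[OF X S'(1) T'(1) X S'(2)[OF that] T'(2,5)] T'(9)
        cmp_zmor_left[OF X S'(1) X S'(2)[OF that]] by simp
    show ?thesis using that 1 2 3 S'(4) T'(7) by (auto simp: less_Suc_eq)
  qed
  interpret SS: abelian_group "mor C S S" using mor_group S' by simp
  interpret TT: abelian_group "mor C T T" using mor_group T' by simp
  have \<iota>\<pi>: "cmp C S X S (\<iota> i) (\<pi> i) \<in> Mor C S S" if "i < m" for i
    using cmp_closed[OF S'(1) X S'(1) S'(3) S'(2)] that by simp
  have "finsum (mor C T T) (\<lambda>i. cmp C T X T (?\<iota> i) (?\<pi> i)) {..<j} =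
      cmp C T S T i1 (cmp C T S S (finsum (mor C S S) (\<lambda>i. cmp C S X S (\<iota> i) (\<pi> i)) {..<j}) p1)"
    if "j \<le> m" for j
    using that
  proof (induction j)
    case 0
    then show ?case
      using cmp_zmor_left[OF T'(1) S'(1,1) T'(4)] cmp_zmor_right[OF T'(1) S'(1) T'(1,2)] by simp
  next
    case (Suc j)
    let ?s = "finsum (mor C S S) (\<lambda>i. cmp C S X S (\<iota> i) (\<pi> i)) {..<j}"
    let ?x = "cmp C S X S (\<iota> j) (\<pi> j)"
    have j: "j < m" using Suc by simp
    have s: "?s \<in> Mor C S S" using \<iota>\<pi> j by (intro SS.finsum_closed) auto
    have x: "?x \<in> Mor C S S" using \<iota>\<pi> j by simp
    have summand: "cmp C T X T (?\<iota> j) (?\<pi> j) = cmp C T S T i1 (cmp C T S S ?x p1)"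
    proof -
      have "cmp C T X T (cmp C X S T i1 (\<iota> j)) (cmp C T S X (\<pi> j) p1) =
          cmp C T S T i1 (cmp C T X S (\<iota> j) (cmp C T S X (\<pi> j) p1))"
        using cmp_assoc[OF T'(1) X S'(1) T'(1) cmp_closed[OF T'(1) S'(1) X T'(4) S'(3)[OF j]] S'(2)[OF j] T'(2)] .
      also have "cmp C T X S (\<iota> j) (cmp C T S X (\<pi> j) p1) = cmp C T S S ?x p1"
        using cmp_assoc[OF T'(1) S'(1) X S'(1) T'(4) S'(3)[OF j] S'(2)[OF j]] by simp
      finally show ?thesis using j by simp
    qed
    have "finsum (mor C S S) (\<lambda>i. cmp C S X S (\<iota> i) (\<pi> i)) {..<Suc j} = ?x \<oplus>\<^bsub>mor C S S\<^esub> ?s"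
      unfolding lessThan_Suc using \<iota>\<pi> j by (intro SS.finsum_insert) auto
    then have "cmp C T S T i1 (cmp C T S S (finsum (mor C S S) (\<lambda>i. cmp C S X S (\<iota> i) (\<pi> i)) {..<Suc j}) p1) =
        cmp C T S T i1 (cmp C T S S ?x p1) \<oplus>\<^bsub>mor C T T\<^esub> cmp C T S T i1 (cmp C T S S ?s p1)"
      using cmp_add_left[OF T'(1) S'(1,1) T'(4) x s]
        cmp_add_right[OF T'(1) S'(1) T'(1) cmp_closed[OF T'(1) S'(1,1) T'(4) x]
          cmp_closed[OF T'(1) S'(1,1) T'(4) s] T'(2)] by simp
    moreover have "finsum (mor C T T) (\<lambda>i. cmp C T X T (?\<iota> i) (?\<pi> i)) {..<Suc j} =
        cmp C T X T (?\<iota> j) (?\<pi> j) \<oplus>\<^bsub>mor C T T\<^esub> finsum (mor C T T) (\<lambda>i. cmp C T X T (?\<iota> i) (?\<pi> i)) {..<j}"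
      unfolding lessThan_Suc using cmp_closed[OF T'(1) X T'(1) \<pi>c \<iota>c] by (intro TT.finsum_insert) auto
    ultimately show ?case using Suc.IH j summand by simp
  qed
  from this[OF order_refl]
  have "finsum (mor C T T) (\<lambda>i. cmp C T X T (?\<iota> i) (?\<pi> i)) {..<m} = cmp C T S T i1 p1"
    using S'(5) cmp_idm_left[OF T'(1) S'(1) T'(4)] by simp
  moreover have "finsum (mor C T T) (\<lambda>i. cmp C T X T (?\<iota> i) (?\<pi> i)) {..<Suc m} =
      cmp C T X T (?\<iota> m) (?\<pi> m) \<oplus>\<^bsub>mor C T T\<^esub> finsum (mor C T T) (\<lambda>i. cmp C T X T (?\<iota> i) (?\<pi> i)) {..<m}"
    unfolding lessThan_Suc
    by (intro TT.finsum_insert Pi_I cmp_closed[OF T'(1) X T'(1) \<pi>c \<iota>c]) auto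
  ultimately have "finsum (mor C T T) (\<lambda>i. cmp C T X T (?\<iota> i) (?\<pi> i)) {..<Suc m} = idm C T"
    using T'(10) TT.a_comm[OF cmp_closed[OF T'(1) S'(1) T'(1,4,2)] cmp_closed[OF T'(1) X T'(1,5,3)]] by simp
  then show ?thesis unfolding is_direct_sum_def using T'(1) X \<iota>c \<pi>c orth by blast
qed

lemma empty_direct_sum:
  assumes "is_zero_object C Z"
  shows "is_direct_sum C 0 A Z \<iota> \<pi>"
proof -
  have Z: "Z \<in> obj C" using assms unfolding is_zero_object_def by blast
  have "\<exists>!f. f \<in> Mor C Z Z" using assms Z unfolding is_zero_object_def by blast
  then have "zmor C Z Z = idm C Z" using zmor_closed[OF Z Z] idm_closed[OF Z] by blast
  interpret abelian_group "mor C Z Z" using mor_group Z by simp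
  show ?thesis unfolding is_direct_sum_def using Z \<open>zmor C Z Z = idm C Z\<close> by simp
qed

end

context additive_bifunctor
begin

lemma direct_sum_detects_zero:
  assumes L: "L \<in> obj C" and X: "X \<in> obj C" and S: "is_direct_sum C m (\<lambda>_. X) S \<iota> \<pi>"
    and \<epsilon>: "\<epsilon> \<in> Ext E L S" and z: "\<And>i. i < m \<Longrightarrow> push E L S X (\<pi> i) \<epsilon> = zext E L X"
  shows "\<epsilon> = zext E L S"
proof -
  have S': "S \<in> obj C" "\<And>i. i < m \<Longrightarrow> \<iota> i \<in> Mor C X S" "\<And>i. i < m \<Longrightarrow> \<pi> i \<in> Mor C S X"
    "finsum (mor C S S) (\<lambda>i. cmp C S X S (\<iota> i) (\<pi> i)) {..<m} = idm C S"
    using S unfolding is_direct_sum_def by auto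
  interpret SS: abelian_group "mor C S S" using mor_group S' by simp
  interpret LS: abelian_group "ext E L S" using ext_group L S' by simp
  have \<iota>\<pi>: "cmp C S X S (\<iota> i) (\<pi> i) \<in> Mor C S S" if "i < m" for i
    using cmp_closed[OF S'(1) X S'(1) S'(3) S'(2)] that by simp
  have "push E L S S (finsum (mor C S S) (\<lambda>i. cmp C S X S (\<iota> i) (\<pi> i)) {..<j}) \<epsilon> = zext E L S"
    if "j \<le> m" for j
    using that
  proof (induction j)
    case 0
    then show ?case using push_zmor[OF L S'(1,1) \<epsilon>] by simp
  next
    case (Suc j)
    let ?s = "finsum (mor C S S) (\<lambda>i. cmp C S X S (\<iota> i) (\<pi> i)) {..<j}"
    let ?x = "cmp C S X S (\<iota> j) (\<pi> j)"
    have j: "j < m" using Suc by simp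
    have s: "?s \<in> Mor C S S" using \<iota>\<pi> j by (intro SS.finsum_closed) auto
    have x: "?x \<in> Mor C S S" using \<iota>\<pi> j by simp
    have "push E L S S ?x \<epsilon> = zext E L S"
      using push_cmp[OF L S'(1) X S'(1) S'(3)[OF j] S'(2)[OF j] \<epsilon>] z[OF j]
        push_zext[OF L X S'(1) S'(2)[OF j]] by simp
    moreover have "finsum (mor C S S) (\<lambda>i. cmp C S X S (\<iota> i) (\<pi> i)) {..<Suc j} = ?x \<oplus>\<^bsub>mor C S S\<^esub> ?s"
      unfolding lessThan_Suc using \<iota>\<pi> j by (intro SS.finsum_insert) auto
    ultimately show ?case using push_add_mor[OF L S'(1,1) x s \<epsilon>] Suc by simp
  qed
  from this[OF order_refl] show ?thesis using S'(4) push_idm[OF L S'(1) \<epsilon>] by simp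
qed

lemma add_closure_obj: "A \<in> add_closure C X \<Longrightarrow> A \<in> obj C"
  unfolding add_closure_def is_biproduct_def by blast

text \<open>A summand of a power of \<open>X\<close> embeds into that power, and an extension by the power vanishes when
its components do.\<close>

lemma add_closure_detects_zero:
  assumes A: "A \<in> add_closure C X" and L: "L \<in> obj C" and X: "X \<in> obj C" and \<epsilon>: "\<epsilon> \<in> Ext E L A"
    and z: "\<And>p. p \<in> Mor C A X \<Longrightarrow> push E L A X p \<epsilon> = zext E L X"
  shows "\<epsilon> = zext E L A"
proof -
  obtain m S \<iota> \<pi> B i1 i2 p1 p2 where S: "is_direct_sum C m (\<lambda>_. X) S \<iota> \<pi>"
    and AB: "is_biproduct C A B S i1 i2 p1 p2" using A unfolding add_closure_def by blast
  have \<pi>: "\<pi> i \<in> Mor C S X" if "i < m" for i using S that unfolding is_direct_sum_def by blast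
  have AS: "A \<in> obj C" "S \<in> obj C" "i1 \<in> Mor C A S" "p1 \<in> Mor C S A" "cmp C A S A p1 i1 = idm C A"
    using AB unfolding is_biproduct_def by auto
  have "push E L S X (\<pi> i) (push E L A S i1 \<epsilon>) = zext E L X" if "i < m" for i
    using push_cmp[OF L AS(1,2) X AS(3) \<pi>[OF that] \<epsilon>] z[OF cmp_closed[OF AS(1,2) X AS(3) \<pi>[OF that]]] by simp
  then have "push E L A S i1 \<epsilon> = zext E L S"
    using direct_sum_detects_zero[OF L X S push_closed[OF L AS(1,2,3) \<epsilon>]] by simp
  then have "push E L A A (cmp C A S A p1 i1) \<epsilon> = zext E L A"
    using push_cmp[OF L AS(1,2,1,3,4) \<epsilon>] push_zext[OF L AS(2,1,4)] by simp
  then show ?thesis using AS(5) push_idm[OF L AS(1) \<epsilon>] by simp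
qed

end

lemma (in preadditive_category) direct_sum_in_add_closure:
  assumes "is_zero_object C Z" and S: "is_direct_sum C m (\<lambda>_. X) S \<iota> \<pi>"
  shows "S \<in> add_closure C X"
proof -
  have o: "Z \<in> obj C" "S \<in> obj C" using assms unfolding is_zero_object_def is_direct_sum_def by auto
  interpret abelian_group "mor C S S" using mor_group o by simp
  have "zmor C Z Z = idm C Z"
    using assms(1) o(1) zmor_closed[OF o(1,1)] idm_closed[OF o(1)] unfolding is_zero_object_def by metis
  then have "is_biproduct C S Z S (idm C S) (zmor C Z S) (idm C S) (zmor C S Z)"
    unfolding is_biproduct_def using o idm_closed zmor_closed
    by (simp add: cmp_idm_left cmp_idm_right cmp_zmor_left cmp_zmor_right)
  then show ?thesis unfolding add_closure_def using S by blast
qed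

section \<open>Distinguished exangles\<close>

context exact_realization
begin

text \<open>A homotopy class contains the complex that it is the class of, so every extension is realized
by an actual exangle.\<close>

lemma homotopy_equivalent_refl:
  assumes Z: "is_complex n C Z"
  shows "homotopy_equivalent n C Z Z"
proof -
  have o: "Ob Z i \<in> obj C" if "i \<le> n + 1" for i using Z that unfolding is_complex_def by blast
  have d: "dif Z i \<in> Mor C (Ob Z i) (Ob Z (i+1))" if "i \<le> n" for i using Z that unfolding is_complex_def by blast
  have fixing: "end_fixing_map n C Z Z (\<lambda>i. idm C (Ob Z i))"
    unfolding end_fixing_map_def chain_map_def using o d
    by (auto simp: idm_closed cmp_idm_left cmp_idm_right)
  have "homotopic n C Z Z (\<lambda>i. cmp C (Ob Z i) (Ob Z i) (Ob Z i) (idm C (Ob Z i)) (idm C (Ob Z i))) (\<lambda>i. idm C (Ob Z i))"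
    unfolding homotopic_def
  proof (intro exI[of _ "\<lambda>i. zmor C (Ob Z i) (Ob Z (i-1))"] conjI ballI)
    show "zmor C (Ob Z i) (Ob Z (i-1)) \<in> Mor C (Ob Z i) (Ob Z (i-1))" if "i \<in> {1..n+1}" for i
      using that o by (intro zmor_closed) auto
    show "cmp C (Ob Z 0) (Ob Z 1) (Ob Z 0) (zmor C (Ob Z 1) (Ob Z (1-1))) (dif Z 0) = zmor C (Ob Z 0) (Ob Z 0)"
      using o[of 0] o[of 1] d[of 0] by (simp add: cmp_zmor_left)
    show "cmp C (Ob Z (n+1)) (Ob Z n) (Ob Z (n+1)) (dif Z n) (zmor C (Ob Z (n+1)) (Ob Z (n+1-1))) =
        zmor C (Ob Z (n+1)) (Ob Z (n+1))"
      using o[of n] o[of "n+1"] d[of n] by (simp add: cmp_zmor_right)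
  next
    fix i assume i: "i \<in> {1..n}"
    then have oi: "Ob Z i \<in> obj C" "Ob Z (i-1) \<in> obj C" "Ob Z (i+1) \<in> obj C" using o by auto
    have di: "dif Z (i-1) \<in> Mor C (Ob Z (i-1)) (Ob Z i)" "dif Z i \<in> Mor C (Ob Z i) (Ob Z (i+1))"
      using d[of "i-1"] d[of i] i by auto
    interpret abelian_group "mor C (Ob Z i) (Ob Z i)" using mor_group oi by simp
    show "cmp C (Ob Z i) (Ob Z i) (Ob Z i) (idm C (Ob Z i)) (idm C (Ob Z i)) \<ominus>\<^bsub>mor C (Ob Z i) (Ob Z i)\<^esub> idm C (Ob Z i) =
       cmp C (Ob Z i) (Ob Z (i-1)) (Ob Z i) (dif Z (i-1)) (zmor C (Ob Z i) (Ob Z (i-1)))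
       \<oplus>\<^bsub>mor C (Ob Z i) (Ob Z i)\<^esub>
       cmp C (Ob Z i) (Ob Z (i+1)) (Ob Z i) (zmor C (Ob Z (i+1)) (Ob Z (i+1-1))) (dif Z i)"
      using oi di idm_closed[OF oi(1)]
      by (simp add: cmp_idm_left cmp_zmor_right cmp_zmor_left minus_eq r_neg)
  qed
  then show ?thesis unfolding homotopy_equivalent_def using fixing by blast
qed

lemma ex_distinguished:
  assumes o: "A \<in> obj C" "Y \<in> obj C" and d: "\<delta> \<in> Ext E Y A"
  shows "\<exists>Z. distinguished n C E s Z \<delta> \<and> Ob Z 0 = A \<and> Ob Z (n+1) = Y"
proof -
  obtain Z where Z: "is_complex n C Z" "Ob Z 0 = A" "Ob Z (n+1) = Y" "s Y A \<delta> = homotopy_class n C Z"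
    using realization_class[OF o d] by blast
  then have "Z \<in> s Y A \<delta>" using homotopy_equivalent_refl unfolding homotopy_class_def by simp
  then show ?thesis unfolding distinguished_def using Z o d by auto
qed

lemma distinguished_obj:
  assumes Z: "distinguished n C E s Z \<delta>"
  shows "Ob Z 0 \<in> obj C" "Ob Z n \<in> obj C" "Ob Z (n+1) \<in> obj C"
    "dif Z n \<in> Mor C (Ob Z n) (Ob Z (n+1))" "\<delta> \<in> Ext E (Ob Z (n+1)) (Ob Z 0)"
proof -
  have "is_exangle n C E Z \<delta>" using Z R1 unfolding distinguished_def by blast
  then have "is_complex n C Z" unfolding is_exangle_def by blast
  then show "Ob Z 0 \<in> obj C" "Ob Z n \<in> obj C" "Ob Z (n+1) \<in> obj C"
    "dif Z n \<in> Mor C (Ob Z n) (Ob Z (n+1))"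
    unfolding is_complex_def by auto
  show "\<delta> \<in> Ext E (Ob Z (n+1)) (Ob Z 0)" using Z unfolding distinguished_def by blast
qed

text \<open>Exactness of \<open>\<C>(-, Z\<^sub>n) \<rightarrow> \<C>(-, Z\<^bsub>n+1\<^esub>) \<rightarrow> \<bbbE>(-, Z\<^sub>0)\<close>.\<close>

lemma factors_iff_pull_zero:
  assumes Z: "distinguished n C E s Z \<delta>" and Y: "Ob Z (n+1) = Y" and A: "A \<in> obj C" and f: "f \<in> Mor C A Y"
  shows "factors_through C Y (A, f) (Ob Z n, dif Z n) \<longleftrightarrow> pull E A Y (Ob Z 0) f \<delta> = zext E A (Ob Z 0)"
proof -
  have "is_exangle n C E Z \<delta>" using Z R1 unfolding distinguished_def by blast
  then have "{f \<in> Mor C A (Ob Z (n+1)). pull E A (Ob Z (n+1)) (Ob Z 0) f \<delta> = zext E A (Ob Z 0)} =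
        cmp C A (Ob Z n) (Ob Z (n+1)) (dif Z n) ` Mor C A (Ob Z n)"
    using A unfolding is_exangle_def by blast
  then show ?thesis unfolding factors_through_def Y using f by auto
qed

text \<open>For generators \<open>\<delta>\<^sub>1, \<dots>, \<delta>\<^sub>m\<close> of \<open>F\<close>, the element of \<open>\<bbbE>(Y, X\<^sup>m)\<close> with these components has orbit \<open>F\<close>:
pushing it out along the projections gives the \<open>\<delta>\<^sub>i\<close>, and pushing it out along any \<open>X\<^sup>m \<rightarrow> X\<close> gives a
combination of them. The induction on the set of generators states this as a universal
property, so that it need not mention the coefficients.\<close>

lemma submodule_is_orbit:
  assumes o: "X \<in> obj C" "Y \<in> obj C"
    and F: "End_submodule X Y F"
    and fg: "finitely_generated (End_ring C X) (ext_End_module E Y X) F"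
  shows "\<exists>S\<in>add_closure C X. \<exists>\<delta>\<in>Ext E Y S. orbit S X Y \<delta> = F"
proof -
  let ?sub = "\<lambda>F. End_submodule X Y F"
  have sub: "additive_subgroup F (ext E Y X)" "\<And>g \<delta>. \<lbrakk>g \<in> Mor C X X; \<delta> \<in> F\<rbrakk> \<Longrightarrow> push E Y X X g \<delta> \<in> F"
    if "?sub F" for F using that ext_End_submodule_iff[OF o] by auto
  obtain O0 where O0: "is_zero_object C O0" using ex_zero_object by blast
  then have O0o: "O0 \<in> obj C" unfolding is_zero_object_def by blast
  obtain G where G: "finite G" "G \<subseteq> F" and gen: "\<forall>K. ?sub K \<and> G \<subseteq> K \<longrightarrow> F \<subseteq> K"
    using fg unfolding finitely_generated_def by (elim exE conjE)
  have "G \<subseteq> Ext E Y X" using G(2) additive_subgroup.a_subset[OF sub(1)[OF F]] by blast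
  with G(1) have "\<exists>m S \<iota> \<pi> \<delta>. is_direct_sum C m (\<lambda>_. X) S \<iota> \<pi> \<and> \<delta> \<in> Ext E Y S \<and>
      (\<forall>F. ?sub F \<longrightarrow> (G \<subseteq> F \<longleftrightarrow> orbit S X Y \<delta> \<subseteq> F))"
  proof (induction G rule: finite_induct)
    case empty
    have "orbit O0 X Y (zext E Y O0) \<subseteq> F" if F: "?sub F" for F
      unfolding orbit_def using push_zext[OF o(2) O0o o(1)] additive_subgroup.zero_closed[OF sub(1)[OF F]] by auto
    then show ?case using empty_direct_sum[OF O0] zext_closed[OF o(2) O0o] by blast
  next
    case (insert \<gamma> G)
    then obtain m S \<iota> \<pi> \<delta> where S: "is_direct_sum C m (\<lambda>_. X) S \<iota> \<pi>" and d: "\<delta> \<in> Ext E Y S"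
      and eq: "\<And>F. ?sub F \<Longrightarrow> G \<subseteq> F \<longleftrightarrow> orbit S X Y \<delta> \<subseteq> F" by blast
    have \<gamma>: "\<gamma> \<in> Ext E Y X" using insert.prems by simp
    have So: "S \<in> obj C" using S unfolding is_direct_sum_def by blast
    obtain T i1 i2 p1 p2 where T: "is_biproduct C S X T i1 i2 p1 p2" using ex_biproduct[OF So o(1)] by blast
    then have T': "T \<in> obj C" "i1 \<in> Mor C S T" "i2 \<in> Mor C X T" "p1 \<in> Mor C T S" "p2 \<in> Mor C T X"
      "cmp C S T S p1 i1 = idm C S" "cmp C X T X p2 i2 = idm C X"
      "cmp C X T S p1 i2 = zmor C X S" "cmp C S T X p2 i1 = zmor C S X"
      unfolding is_biproduct_def by auto
    interpret YS: abelian_group "ext E Y S" using ext_group o So by simp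
    interpret YX: abelian_group "ext E Y X" using ext_group o by simp
    let ?a = "push E Y S T i1 \<delta>" and ?b = "push E Y X T i2 \<gamma>"
    let ?d = "?a \<oplus>\<^bsub>ext E Y T\<^esub> ?b"
    have ab: "?a \<in> Ext E Y T" "?b \<in> Ext E Y T" using push_closed o So T' d \<gamma> by auto
    have dT: "?d \<in> Ext E Y T"
      using abelian_monoid.a_closed[OF abelian_group.axioms(1)[OF ext_group[OF o(2) T'(1)]] ab] .
    have push_d: "push E Y T B g ?d = push E Y S B (cmp C S T B g i1) \<delta> \<oplus>\<^bsub>ext E Y B\<^esub> push E Y X B (cmp C X T B g i2) \<gamma>"
      if "B \<in> obj C" "g \<in> Mor C T B" for B g
      using push_add_ext[OF o(2) T'(1) that ab] push_cmp[OF o(2) So T'(1) that(1) T'(2) that(2) d]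
        push_cmp[OF o(2,1) T'(1) that(1) T'(3) that(2) \<gamma>] by simp
    have p1d: "push E Y T S p1 ?d = \<delta>"
      using push_d[OF So T'(4)] T'(6,8) push_idm[OF o(2) So d] push_zmor[OF o(2,1) So \<gamma>] d by simp
    have p2d: "push E Y T X p2 ?d = \<gamma>"
      using push_d[OF o(1) T'(5)] T'(7,9) push_idm[OF o(2,1) \<gamma>] push_zmor[OF o(2) So o(1) d] \<gamma> by simp
    have "insert \<gamma> G \<subseteq> F \<longleftrightarrow> orbit T X Y ?d \<subseteq> F" if F: "?sub F" for F
    proof
      assume gF: "insert \<gamma> G \<subseteq> F"
      show "orbit T X Y ?d \<subseteq> F"
      proof
        fix x assume "x \<in> orbit T X Y ?d"
        then obtain g where g: "g \<in> Mor C T X" "x = push E Y T X g ?d" unfolding orbit_def by blast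
        have "push E Y S X (cmp C S T X g i1) \<delta> \<in> F"
          using eq[OF F] gF cmp_closed[OF So T'(1) o(1) T'(2) g(1)] unfolding orbit_def by blast
        moreover have "push E Y X X (cmp C X T X g i2) \<gamma> \<in> F"
          using sub(2)[OF F] gF cmp_closed[OF o(1) T'(1) o(1) T'(3) g(1)] by blast
        ultimately show "x \<in> F" unfolding g(2) push_d[OF o(1) g(1)]
          by (rule additive_subgroup.a_closed[OF sub(1)[OF F]])
      qed
    next
      assume oF: "orbit T X Y ?d \<subseteq> F"
      have "orbit S X Y \<delta> \<subseteq> F"
      proof
        fix x assume "x \<in> orbit S X Y \<delta>"
        then obtain g where g: "g \<in> Mor C S X" "x = push E Y S X g \<delta>" unfolding orbit_def by blast
        have "x = push E Y T X (cmp C T S X g p1) ?d"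
          using push_cmp[OF o(2) T'(1) So o(1) T'(4) g(1) dT] p1d g(2) by simp
        then show "x \<in> F" using oF cmp_closed[OF T'(1) So o(1) T'(4) g(1)] unfolding orbit_def by blast
      qed
      moreover have "\<gamma> \<in> F"
      proof -
        have "push E Y T X p2 ?d \<in> F" using oF T'(5) unfolding orbit_def by blast
        then show ?thesis unfolding p2d .
      qed
      ultimately show "insert \<gamma> G \<subseteq> F" using eq[OF F] by simp
    qed
    then show ?case using direct_sum_snoc[OF S o(1) T] dT by blast
  qed
  then obtain m S \<iota> \<pi> \<delta> where S: "is_direct_sum C m (\<lambda>_. X) S \<iota> \<pi>" and d: "\<delta> \<in> Ext E Y S"
    and eq: "\<And>F. ?sub F \<Longrightarrow> G \<subseteq> F \<longleftrightarrow> orbit S X Y \<delta> \<subseteq> F" by blast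
  have So: "S \<in> obj C" using S unfolding is_direct_sum_def by blast
  have "orbit S X Y \<delta> \<subseteq> F" using eq[OF F] G(2) by blast
  moreover have "G \<subseteq> orbit S X Y \<delta>" using eq[OF orbit_submodule[OF So o d]] by blast
  then have "F \<subseteq> orbit S X Y \<delta>" using gen orbit_submodule[OF So o d] by simp
  ultimately have "orbit S X Y \<delta> = F" by (rule subset_antisym)
  then show ?thesis using direct_sum_in_add_closure[OF O0 S] d by blast
qed

end

section \<open>Annihilators and determined deflations\<close>

context serre_trace
begin

lemma pairing_push:
  assumes o: "X \<in> obj C" "Y \<in> obj C" "A \<in> obj C" and h: "h \<in> Mor C (K X) Y" and d: "\<delta> \<in> Ext E Y A"
    and g: "g \<in> Mor C A X"
  shows "pairing X Y h (push E Y A X g \<delta>) = t X (push E (K X) A X g (pull E (K X) Y A h \<delta>))"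
  using push_pull[OF K_obj[OF o(1)] o(2,3,1) h g d] by simp

text \<open>An endomorphism \<open>e\<close> of \<open>K X\<close> is adjoint to an endomorphism of \<open>X\<close>, under which \<open>F\<close> is stable.\<close>

lemma ann_right_submodule:
  assumes o: "X \<in> obj C" "Y \<in> obj C"
    and F: "End_submodule X Y F"
  shows "right_submodule (K X) Y (ann X Y F)"
proof -
  have sub: "additive_subgroup F (ext E Y X)" and st: "\<And>g \<delta>. \<lbrakk>g \<in> Mor C X X; \<delta> \<in> F\<rbrakk> \<Longrightarrow> push E Y X X g \<delta> \<in> F"
    using F ext_End_submodule_iff[OF o] by auto
  have FE: "\<delta> \<in> Ext E Y X" if "\<delta> \<in> F" for \<delta> using additive_subgroup.a_subset[OF sub] that by blast
  have KX: "K X \<in> obj C" using K_obj o by simp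
  interpret J: module k J by (rule J_module)
  show ?thesis unfolding right_submodule_def
  proof (intro conjI ballI)
    show "ann X Y F \<subseteq> Mor C (K X) Y" unfolding ann_def by blast
    show "proj_trivial C E (K X) Y \<subseteq> ann X Y F"
      using pairing_proj_trivial[OF o] FE unfolding ann_def proj_trivial_def by blast
    show "h \<oplus>\<^bsub>mor C (K X) Y\<^esub> h' \<in> ann X Y F" if "h \<in> ann X Y F" "h' \<in> ann X Y F" for h h'
      using that pairing_add[OF o] FE add_mor_closed[OF KX o(2)] unfolding ann_def by simp
    show "cmp C (K X) (K X) Y h e \<in> ann X Y F" if h: "h \<in> ann X Y F" and e: "e \<in> Mor C (K X) (K X)" for h e
    proof -
      have hm: "h \<in> Mor C (K X) Y" using h unfolding ann_def by blast
      obtain g where g: "g \<in> Mor C X X" "\<forall>\<epsilon>\<in>Ext E (K X) X.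
          t X (pull E (K X) (K X) X e \<epsilon>) = t X (push E (K X) X X g \<epsilon>)"
        using transposed[OF o(1,1) e] by blast
      have "pairing X Y (cmp C (K X) (K X) Y h e) \<delta> = \<zero>\<^bsub>J\<^esub>" if d: "\<delta> \<in> F" for \<delta>
      proof -
        have "pairing X Y (cmp C (K X) (K X) Y h e) \<delta> = t X (pull E (K X) (K X) X e (pull E (K X) Y X h \<delta>))"
          using pull_cmp[OF KX KX o(2,1) e hm FE[OF d]] by simp
        also have "\<dots> = pairing X Y h (push E Y X X g \<delta>)"
          using g(2) pull_closed[OF KX o(2,1) hm FE[OF d]] pairing_push[OF o o(1) hm FE[OF d] g(1)] by simp
        also have "\<dots> = \<zero>\<^bsub>J\<^esub>" using h st[OF g(1) d] unfolding ann_def by blast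
        finally show ?thesis .
      qed
      then show ?thesis unfolding ann_def using cmp_closed[OF KX KX o(2) e hm] by blast
    qed
  qed
qed

text \<open>The converse adjunction: for \<open>g : X \<rightarrow> X\<close> the functional \<open>t X (g\<^sub>*-)\<close> on \<open>\<bbbE>(K X, X)\<close> is represented by
an endomorphism of \<open>K X\<close>.\<close>

lemma coann_submodule:
  assumes o: "X \<in> obj C" "Y \<in> obj C" and H: "right_submodule (K X) Y H"
  shows "End_submodule X Y (coann X Y H)"
  unfolding ext_End_submodule_iff[OF o]
proof
  have Hm: "h \<in> Mor C (K X) Y" if "h \<in> H" for h using H that unfolding right_submodule_def by blast
  have KX: "K X \<in> obj C" using K_obj o by simp
  interpret J: module k J by (rule J_module)
  interpret YX: abelian_group "ext E Y X" using ext_group o by simp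
  show "additive_subgroup (coann X Y H) (ext E Y X)"
  proof (rule additive_subgroup_if_minus_closed[OF ext_group[OF o(2,1)]])
    show "coann X Y H \<subseteq> Ext E Y X" unfolding coann_def by blast
    show "zext E Y X \<in> coann X Y H"
      unfolding coann_def using pull_zext[OF KX o(2,1)] Hm t_zero[OF o(1)] by simp
    fix x y assume xy: "x \<in> coann X Y H" "y \<in> coann X Y H"
    then have c: "x \<in> Ext E Y X" "y \<in> Ext E Y X" unfolding coann_def by auto
    have "pairing X Y h (x \<ominus>\<^bsub>ext E Y X\<^esub> y) = \<zero>\<^bsub>J\<^esub>" if h: "h \<in> H" for h
    proof -
      have "pairing X Y h (x \<ominus>\<^bsub>ext E Y X\<^esub> y) = pairing X Y h x \<ominus>\<^bsub>J\<^esub> pairing X Y h y"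
        by (rule additive_map_minus[of _ _ "pairing X Y h"])
          (use pairing_linear[OF o Hm[OF h]] c o J_abelian ext_group in \<open>auto simp: linear_map_def\<close>)
      then show ?thesis using xy h unfolding coann_def by (simp add: J.M.minus_eq)
    qed
    then show "x \<ominus>\<^bsub>ext E Y X\<^esub> y \<in> coann X Y H" unfolding coann_def using c by simp
  qed
  show "\<forall>g\<in>Mor C X X. \<forall>\<delta>\<in>coann X Y H. push E Y X X g \<delta> \<in> coann X Y H"
  proof (intro ballI)
    fix g \<delta> assume g: "g \<in> Mor C X X" and d: "\<delta> \<in> coann X Y H"
    have dE: "\<delta> \<in> Ext E Y X" using d unfolding coann_def by blast
    have "linear_map k (ext E (K X) X) J (\<lambda>\<epsilon>. t X (push E (K X) X X g \<epsilon>))"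
      using t_linear[OF o(1)] o g KX
      by (auto simp: linear_map_def push_closed t_closed push_add_ext t_add push_smult_ext)
    then obtain e where e: "e \<in> Mor C (K X) (K X)"
      "\<forall>\<epsilon>\<in>Ext E (K X) X. t X (push E (K X) X X g \<epsilon>) = t X (pull E (K X) (K X) X e \<epsilon>)"
      using functional_represented[OF o(1) KX] by blast
    have "pairing X Y h (push E Y X X g \<delta>) = \<zero>\<^bsub>J\<^esub>" if h: "h \<in> H" for h
    proof -
      have "pairing X Y h (push E Y X X g \<delta>) = t X (pull E (K X) (K X) X e (pull E (K X) Y X h \<delta>))"
        using e(2) pull_closed[OF KX o(2,1) Hm[OF h] dE] pairing_push[OF o o(1) Hm[OF h] dE g] by simp
      also have "\<dots> = pairing X Y (cmp C (K X) (K X) Y h e) \<delta>"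
        using pull_cmp[OF KX KX o(2,1) e(1) Hm[OF h] dE] by simp
      also have "\<dots> = \<zero>\<^bsub>J\<^esub>"
        using d h e(1) H unfolding coann_def right_submodule_def by blast
      finally show ?thesis .
    qed
    then show "push E Y X X g \<delta> \<in> coann X Y H"
      unfolding coann_def using push_closed[OF o(2,1,1) g dE] by blast
  qed
qed

lemma ann_coann:
  assumes o: "X \<in> obj C" "Y \<in> obj C" and H: "right_submodule (K X) Y H"
  shows "ann X Y (coann X Y H) = H"
proof
  show "ann X Y (coann X Y H) \<subseteq> H"
    using right_submodule_closed_and_finite[OF o H] H by blast
  show "H \<subseteq> ann X Y (coann X Y H)"
    using H unfolding right_submodule_def coann_def ann_def by blast
qed

lemma ext_submodule_fg:
  assumes o: "X \<in> obj C" "Y \<in> obj C"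
    and F: "End_submodule X Y F"
  shows "finitely_generated (End_ring C X) (ext_End_module E Y X) F"
proof -
  have "finitely_generated k (ext E Y X) F"
    by (rule submodule_finitely_generated[OF ext_module[OF o(2,1)] artinian ext_fg[OF o(2,1)]
          ext_End_submodule_linear[OF o F]])
  then obtain G where "finite G" "G \<subseteq> F"
    and gen: "\<forall>H. submodule H k (ext E Y X) \<and> G \<subseteq> H \<longrightarrow> F \<subseteq> H"
    unfolding finitely_generated_def by (elim exE conjE)
  then show ?thesis unfolding finitely_generated_def
    using ext_End_submodule_linear[OF o] by (intro exI[of _ G] conjI allI impI) simp_all
qed

text \<open>The heart of the matter: the right-hand side consists of the morphisms that factor through the
deflation with extension \<open>\<delta>\<close>. If \<open>h\<^sup>*\<delta> \<noteq> 0\<close>, some functional on \<open>\<bbbE>(K X, A)\<close> detects it. That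
functional is represented by an \<open>e : K A \<rightarrow> K X\<close>, which is adjoint to a \<open>g : A \<rightarrow> X\<close>, and then \<open>h\<close> does
not annihilate \<open>g\<^sub>*\<delta>\<close>.\<close>

lemma ann_orbit:
  assumes o: "A \<in> obj C" "X \<in> obj C" "Y \<in> obj C" and d: "\<delta> \<in> Ext E Y A"
  shows "ann X Y (orbit A X Y \<delta>) = {h \<in> Mor C (K X) Y. pull E (K X) Y A h \<delta> = zext E (K X) A}"
proof (intro subset_antisym subsetI)
  have K: "K X \<in> obj C" "K A \<in> obj C" using K_obj o by auto
  fix h
  {
    assume h: "h \<in> ann X Y (orbit A X Y \<delta>)"
    then have hm: "h \<in> Mor C (K X) Y" unfolding ann_def by blast
    have p: "pull E (K X) Y A h \<delta> \<in> Ext E (K X) A" using pull_closed[OF K(1) o(3,1) hm d] .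
    have "pull E (K X) Y A h \<delta> = zext E (K X) A"
    proof (rule ext_zero_if_pairing_zero[OF o(1) K(1) p])
      fix e assume e: "e \<in> Mor C (K A) (K X)"
      obtain g where g: "g \<in> Mor C A X" "\<forall>\<epsilon>\<in>Ext E (K X) A.
          t A (pull E (K A) (K X) A e \<epsilon>) = t X (push E (K X) A X g \<epsilon>)"
        using transposed[OF o(1,2) e] by blast
      have "pairing A (K X) e (pull E (K X) Y A h \<delta>) = pairing X Y h (push E Y A X g \<delta>)"
        using g(2) p pairing_push[OF o(2,3,1) hm d g(1)] by simp
      also have "\<dots> = \<zero>\<^bsub>J\<^esub>" using h g(1) unfolding ann_def orbit_def by blast
      finally show "pairing A (K X) e (pull E (K X) Y A h \<delta>) = \<zero>\<^bsub>J\<^esub>" .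
    qed
    then show "h \<in> {h \<in> Mor C (K X) Y. pull E (K X) Y A h \<delta> = zext E (K X) A}" using hm by blast
  next
    assume "h \<in> {h \<in> Mor C (K X) Y. pull E (K X) Y A h \<delta> = zext E (K X) A}"
    then have h: "h \<in> Mor C (K X) Y" "pull E (K X) Y A h \<delta> = zext E (K X) A" by auto
    have "pairing X Y h (push E Y A X g \<delta>) = \<zero>\<^bsub>J\<^esub>" if g: "g \<in> Mor C A X" for g
      using pairing_push[OF o(2,3,1) h(1) d g] h(2) push_zext[OF K(1) o(1,2) g] t_zero[OF o(2)] by simp
    then show "h \<in> ann X Y (orbit A X Y \<delta>)" unfolding ann_def orbit_def using h(1) by blast
  }
qed

text \<open>If \<open>g h\<close> factors through the deflation for all \<open>h : K X \<rightarrow> L\<close>, then \<open>h\<^sup>*(g\<^sup>*\<delta>) = 0\<close> for all these \<open>h\<close>. So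
all functionals on \<open>\<bbbE>(L, X)\<close> vanish at \<open>q\<^sub>*(g\<^sup>*\<delta>)\<close> for each \<open>q : Z\<^sub>0 \<rightarrow> X\<close>, and since \<open>Z\<^sub>0\<close> lies in \<open>add X\<close>
this forces \<open>g\<^sup>*\<delta> = 0\<close>.\<close>

lemma add_closure_determined:
  assumes Z: "distinguished n C E s Z \<delta>" and Y: "Ob Z (n+1) = Y" and X: "X \<in> obj C"
    and add: "Ob Z 0 \<in> add_closure C X"
  shows "right_determined C (K X) Y (Ob Z n, dif Z n)"
  unfolding right_determined_def
proof (intro ballI impI)
  fix L g assume L: "L \<in> obj C" and g: "g \<in> Mor C L Y"
    and fac: "\<forall>h\<in>Mor C (K X) L. factors_through C Y (K X, cmp C (K X) L Y g h) (Ob Z n, dif Z n)"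
  note Zo = distinguished_obj[OF Z, unfolded Y]
  have KX: "K X \<in> obj C" using K_obj X by simp
  let ?A = "Ob Z 0"
  have p: "pull E L Y ?A g \<delta> \<in> Ext E L ?A" using pull_closed[OF L Zo(3,1) g Zo(5)] .
  have "pull E L Y ?A g \<delta> = zext E L ?A"
  proof (rule add_closure_detects_zero[OF add L X p])
    fix q assume q: "q \<in> Mor C ?A X"
    have qp: "push E L ?A X q (pull E L Y ?A g \<delta>) \<in> Ext E L X" using push_closed[OF L Zo(1) X q p] .
    show "push E L ?A X q (pull E L Y ?A g \<delta>) = zext E L X"
    proof (rule ext_zero_if_pairing_zero[OF X L qp])
      fix h assume h: "h \<in> Mor C (K X) L"
      have "pull E (K X) Y ?A (cmp C (K X) L Y g h) \<delta> = zext E (K X) ?A"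
        using factors_iff_pull_zero[OF Z Y KX cmp_closed[OF KX L Zo(3) h g]] fac h by blast
      then have "pull E (K X) L ?A h (pull E L Y ?A g \<delta>) = zext E (K X) ?A"
        using pull_cmp[OF KX L Zo(3,1) h g Zo(5)] by simp
      then show "pairing X L h (push E L ?A X q (pull E L Y ?A g \<delta>)) = \<zero>\<^bsub>J\<^esub>"
        using pairing_push[OF X L Zo(1) h p q] push_zext[OF KX Zo(1) X q] t_zero[OF X] by simp
    qed
  qed
  then show "factors_through C Y (L, g) (Ob Z n, dif Z n)"
    using factors_iff_pull_zero[OF Z Y L g] by blast
qed

end

section \<open>The trace functionals of Auslander-Reiten-Serre duality\<close>

locale ars_category = exact_realization n C E s + linear_bifunctor k C E
  for n :: nat and C :: "('o, 'm, 'k) cat" and E :: "('o, 'm, 'k, 'e) ext_data"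
    and s :: "('o, 'm, 'e) realization" and k :: "'k ring" +
  fixes J :: "('k, 'j) module" and \<tau> \<tau>' :: "('o, 'm set, 'o, 'm set) fun_data"
    and \<Phi> :: "'o \<Rightarrow> 'o \<Rightarrow> ('e \<Rightarrow> 'j) \<Rightarrow> 'm set" and \<theta> u :: "'o \<Rightarrow> 'm set"
  assumes artinian: "artinian_ring k"
    and cogenerator: "injective_cogenerator k J"
    and ext_finite: "ext_finite k C E"
    and duality: "ARS_duality k J C E \<tau> \<Phi>"
    and inverse: "quasi_inverse (proj_stable C E) (inj_stable C E) \<tau> \<tau>'"
    and adjoint: "adjunction (inj_stable C E) (proj_stable C E) \<tau>' \<tau> u \<theta>"
begin

abbreviation "K \<equiv> fob \<tau>'"
abbreviation "PC \<equiv> proj_stable C E"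
abbreviation "IC \<equiv> inj_stable C E"
abbreviation "\<Psi> \<equiv> Psi C E \<tau> \<tau>' \<theta> \<Phi>"
abbreviation "DE Y X \<equiv> carrier (dual_module k J (ext E Y X))"

interpretation P: category_ideal C "proj_trivial C E" by (rule proj_trivial_ideal)
interpretation I: category_ideal C "inj_trivial C E" by (rule inj_trivial_ideal)
interpretation PC: plain_category PC by (rule P.quotient_plain_category)
interpretation IC: plain_category IC by (rule I.quotient_plain_category)

lemma \<tau>_obj: "X \<in> obj C \<Longrightarrow> fob \<tau> X \<in> obj C"
  and \<tau>_mor: "\<lbrakk>X \<in> obj C; Y \<in> obj C; f \<in> Mor PC X Y\<rbrakk> \<Longrightarrow> fmor \<tau> X Y f \<in> Mor IC (fob \<tau> X) (fob \<tau> Y)"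
  and \<tau>'_obj: "X \<in> obj C \<Longrightarrow> K X \<in> obj C"
  and \<tau>'_mor: "\<lbrakk>X \<in> obj C; Y \<in> obj C; f \<in> Mor IC X Y\<rbrakk> \<Longrightarrow> fmor \<tau>' X Y f \<in> Mor PC (K X) (K Y)"
  and \<tau>'_cmp: "\<lbrakk>X \<in> obj C; Y \<in> obj C; Z \<in> obj C; f \<in> Mor IC X Y; g \<in> Mor IC Y Z\<rbrakk> \<Longrightarrow>
    fmor \<tau>' X Z (cmp IC X Y Z g f) = cmp PC (K X) (K Y) (K Z) (fmor \<tau>' Y Z g) (fmor \<tau>' X Y f)"
  and \<theta>_mor: "X \<in> obj C \<Longrightarrow> \<theta> X \<in> Mor PC (K (fob \<tau> X)) X"
  and \<theta>_natural: "\<lbrakk>X \<in> obj C; Y \<in> obj C; f \<in> Mor PC X Y\<rbrakk> \<Longrightarrow>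
    cmp PC (K (fob \<tau> X)) (K (fob \<tau> Y)) Y (\<theta> Y) (fmor \<tau>' (fob \<tau> X) (fob \<tau> Y) (fmor \<tau> X Y f)) =
    cmp PC (K (fob \<tau> X)) X Y f (\<theta> X)"
  using adjoint unfolding adjunction_def is_functor_def nat_transformation_def P.obj_quotient I.obj_quotient
  by (simp_all add: comp_functor_def id_functor_def Pi_iff)

lemma \<tau>_functor: "is_functor PC IC \<tau>"
  using adjoint unfolding adjunction_def by blast

lemma \<Phi>_bij: "\<lbrakk>X \<in> obj C; Y \<in> obj C\<rbrakk> \<Longrightarrow> bij_betw (\<Phi> X Y) (DE X Y) (Mor IC Y (fob \<tau> X))"
  using duality unfolding ARS_duality_def by blast

lemma \<Phi>_mor: "\<lbrakk>X \<in> obj C; Y \<in> obj C; \<phi> \<in> DE X Y\<rbrakk> \<Longrightarrow> \<Phi> X Y \<phi> \<in> Mor IC Y (fob \<tau> X)"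
  using \<Phi>_bij bij_betwE by blast

lemma \<Phi>_natural_left: "\<lbrakk>X \<in> obj C; X' \<in> obj C; Y \<in> obj C; x \<in> Mor C X X'; \<phi> \<in> DE X Y\<rbrakk> \<Longrightarrow>
    \<Phi> X' Y (\<lambda>\<delta>\<in>Ext E X' Y. \<phi> (pull E X X' Y x \<delta>)) =
    cmp IC Y (fob \<tau> X) (fob \<tau> X') (fmor \<tau> X X' (P.coset X X' x)) (\<Phi> X Y \<phi>)"
  using duality unfolding ARS_duality_def by (elim conjE) blast

lemma \<Phi>_natural_right: "\<lbrakk>X \<in> obj C; Y \<in> obj C; Y' \<in> obj C; y \<in> Mor C Y Y'; \<phi> \<in> DE X Y'\<rbrakk> \<Longrightarrow>
    \<Phi> X Y (\<lambda>\<delta>\<in>Ext E X Y. \<phi> (push E X Y Y' y \<delta>)) =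
    cmp IC Y Y' (fob \<tau> X) (\<Phi> X Y' \<phi>) (I.coset Y Y' y)"
  using duality unfolding ARS_duality_def by (elim conjE) blast

lemma coset_mor: "\<lbrakk>X \<in> obj C; Y \<in> obj C; f \<in> Mor C X Y\<rbrakk> \<Longrightarrow> P.coset X Y f \<in> Mor PC X Y"
  "\<lbrakk>X \<in> obj C; Y \<in> obj C; f \<in> Mor C X Y\<rbrakk> \<Longrightarrow> I.coset X Y f \<in> Mor IC X Y"
  unfolding P.Mor_quotient I.Mor_quotient by (auto intro: imageI)

lemma Psi_bij:
  assumes "X \<in> obj C" "Y \<in> obj C"
  shows "bij_betw (\<Psi> Y X) (DE Y X) (Mor PC (K X) Y)"
proof -
  have "bij_betw (adj_iso C E \<tau> \<tau>' \<theta> Y X) (Mor IC X (fob \<tau> Y)) (Mor PC (K X) Y)"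
    using adjunction_bijective[OF IC.plain_category_axioms PC.plain_category_axioms adjoint, of X Y] assms
    unfolding adj_iso_def P.obj_quotient I.obj_quotient by simp
  then show ?thesis unfolding Psi_def using bij_betw_trans[OF \<Phi>_bij[OF assms(2,1)]] by blast
qed

lemma Psi_pull:
  assumes o: "X \<in> obj C" "Y \<in> obj C" "Y' \<in> obj C" and y: "y \<in> Mor C Y Y'" and \<phi>: "\<phi> \<in> DE Y X"
  shows "\<Psi> Y' X (\<lambda>\<delta>\<in>Ext E Y' X. \<phi> (pull E Y Y' X y \<delta>)) =
    cmp PC (K X) Y Y' (P.coset Y Y' y) (\<Psi> Y X \<phi>)"
proof -
  let ?y = "P.coset Y Y' y" and ?f = "\<Phi> Y X \<phi>"
  note oo = o \<tau>_obj[OF o(2)] \<tau>_obj[OF o(3)] \<tau>'_obj[OF o(1)] \<tau>'_obj[OF \<tau>_obj[OF o(2)]] \<tau>'_obj[OF \<tau>_obj[OF o(3)]]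
  note ob = oo[folded P.obj_quotient]
  have ym: "?y \<in> Mor PC Y Y'" using coset_mor o y by simp
  have fm: "?f \<in> Mor IC X (fob \<tau> Y)" using \<Phi>_mor o \<phi> by simp
  have \<tau>y: "fmor \<tau> Y Y' ?y \<in> Mor IC (fob \<tau> Y) (fob \<tau> Y')" using \<tau>_mor o ym by simp
  have "\<Psi> Y' X (\<lambda>\<delta>\<in>Ext E Y' X. \<phi> (pull E Y Y' X y \<delta>)) =
      cmp PC (K X) (K (fob \<tau> Y')) Y' (\<theta> Y') (fmor \<tau>' X (fob \<tau> Y')
        (cmp IC X (fob \<tau> Y) (fob \<tau> Y') (fmor \<tau> Y Y' ?y) ?f))"
    unfolding Psi_def adj_iso_def comp_def using \<Phi>_natural_left[OF o(2,3,1) y \<phi>] by simp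
  also have "\<dots> = cmp PC (K X) (K (fob \<tau> Y')) Y' (\<theta> Y') (cmp PC (K X) (K (fob \<tau> Y)) (K (fob \<tau> Y'))
        (fmor \<tau>' (fob \<tau> Y) (fob \<tau> Y') (fmor \<tau> Y Y' ?y)) (fmor \<tau>' X (fob \<tau> Y) ?f))"
    using \<tau>'_cmp[OF oo(1,4,5) fm \<tau>y] by simp
  also have "\<dots> = cmp PC (K X) (K (fob \<tau> Y)) Y' (cmp PC (K (fob \<tau> Y)) (K (fob \<tau> Y')) Y' (\<theta> Y')
        (fmor \<tau>' (fob \<tau> Y) (fob \<tau> Y') (fmor \<tau> Y Y' ?y))) (fmor \<tau>' X (fob \<tau> Y) ?f)"
    by (rule PC.assoc[symmetric]) (use ob \<tau>'_mor[OF oo(1,4) fm] \<tau>'_mor[OF oo(4,5) \<tau>y] \<theta>_mor[OF o(3)] in auto)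
  also have "\<dots> = cmp PC (K X) (K (fob \<tau> Y)) Y' (cmp PC (K (fob \<tau> Y)) Y Y' ?y (\<theta> Y)) (fmor \<tau>' X (fob \<tau> Y) ?f)"
    using \<theta>_natural[OF o(2,3) ym] by simp
  also have "\<dots> = cmp PC (K X) Y Y' ?y (cmp PC (K X) (K (fob \<tau> Y)) Y (\<theta> Y) (fmor \<tau>' X (fob \<tau> Y) ?f))"
    by (rule PC.assoc) (use ob ym \<tau>'_mor[OF oo(1,4) fm] \<theta>_mor[OF o(2)] in auto)
  finally show ?thesis unfolding Psi_def adj_iso_def comp_def .
qed

lemma Psi_push:
  assumes o: "X \<in> obj C" "X' \<in> obj C" "Y \<in> obj C" and g: "g \<in> Mor C X X'" and \<phi>: "\<phi> \<in> DE Y X'"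
  shows "\<Psi> Y X (\<lambda>\<delta>\<in>Ext E Y X. \<phi> (push E Y X X' g \<delta>)) =
    cmp PC (K X) (K X') Y (\<Psi> Y X' \<phi>) (fmor \<tau>' X X' (I.coset X X' g))"
proof -
  let ?g = "I.coset X X' g" and ?f = "\<Phi> Y X' \<phi>"
  note oo = o \<tau>_obj[OF o(3)] \<tau>'_obj[OF o(1)] \<tau>'_obj[OF o(2)] \<tau>'_obj[OF \<tau>_obj[OF o(3)]]
  note ob = oo[folded P.obj_quotient]
  have gm: "?g \<in> Mor IC X X'" using coset_mor o g by simp
  have fm: "?f \<in> Mor IC X' (fob \<tau> Y)" using \<Phi>_mor o \<phi> by simp
  have "\<Psi> Y X (\<lambda>\<delta>\<in>Ext E Y X. \<phi> (push E Y X X' g \<delta>)) =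
      cmp PC (K X) (K (fob \<tau> Y)) Y (\<theta> Y) (fmor \<tau>' X (fob \<tau> Y) (cmp IC X X' (fob \<tau> Y) ?f ?g))"
    unfolding Psi_def adj_iso_def comp_def using \<Phi>_natural_right[OF o(3,1,2) g \<phi>] by simp
  also have "\<dots> = cmp PC (K X) (K (fob \<tau> Y)) Y (\<theta> Y)
      (cmp PC (K X) (K X') (K (fob \<tau> Y)) (fmor \<tau>' X' (fob \<tau> Y) ?f) (fmor \<tau>' X X' ?g))"
    using \<tau>'_cmp[OF oo(1,2,4) gm fm] by simp
  also have "\<dots> = cmp PC (K X) (K X') Y (cmp PC (K X') (K (fob \<tau> Y)) Y (\<theta> Y) (fmor \<tau>' X' (fob \<tau> Y) ?f))
      (fmor \<tau>' X X' ?g)"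
    by (rule PC.assoc[symmetric]) (use ob \<tau>'_mor[OF oo(1,2) gm] \<tau>'_mor[OF oo(2,4) fm] \<theta>_mor[OF o(3)] in auto)
  finally show ?thesis unfolding Psi_def adj_iso_def comp_def .
qed

definition trace :: "'o \<Rightarrow> 'e \<Rightarrow> 'j" where
  "trace X = inv_into (DE (K X) X) (\<Psi> (K X) X) (P.coset (K X) (K X) (idm C (K X)))"

lemma DE_iff: "\<phi> \<in> DE Y X \<longleftrightarrow> \<phi> \<in> extensional (Ext E Y X) \<and> linear_map k (ext E Y X) J \<phi>"
  by (simp add: dual_module_def)

lemma trace_DE:
  assumes X: "X \<in> obj C" shows "trace X \<in> DE (K X) X"
    and "\<Psi> (K X) X (trace X) = P.coset (K X) (K X) (idm C (K X))"
proof -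
  have K: "K X \<in> obj C" using \<tau>'_obj X .
  have "P.coset (K X) (K X) (idm C (K X)) \<in> \<Psi> (K X) X ` DE (K X) X"
    using coset_mor(1)[OF K K idm_closed[OF K]] bij_betw_imp_surj_on[OF Psi_bij[OF X K]] by simp
  then show "trace X \<in> DE (K X) X"
    and "\<Psi> (K X) X (trace X) = P.coset (K X) (K X) (idm C (K X))"
    unfolding trace_def by (rule inv_into_into, rule f_inv_into_f)
qed

text \<open>Yoneda's lemma for the natural bijection \<open>\<Psi>\<close>: it is determined by what it does to the trace.\<close>

lemma functional_of_trace:
  assumes o: "X \<in> obj C" "Y \<in> obj C" and h: "h \<in> Mor C (K X) Y"
  shows "(\<lambda>\<delta>\<in>Ext E Y X. trace X (pull E (K X) Y X h \<delta>)) \<in> DE Y X"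
    and "\<Psi> Y X (\<lambda>\<delta>\<in>Ext E Y X. trace X (pull E (K X) Y X h \<delta>)) = P.coset (K X) Y h"
proof -
  have K: "K X \<in> obj C" using \<tau>'_obj o by simp
  interpret YX: module k "ext E Y X" using ext_module o by simp
  have "linear_map k (ext E (K X) X) J (trace X)" using trace_DE(1)[OF o(1)] DE_iff by blast
  then show "(\<lambda>\<delta>\<in>Ext E Y X. trace X (pull E (K X) Y X h \<delta>)) \<in> DE Y X"
    unfolding DE_iff linear_map_def using pull_closed[OF K o(2,1) h] pull_add_ext[OF K o(2,1) h]
      pull_smult_ext[OF K o(2,1) h] by (auto simp: Pi_iff)
  show "\<Psi> Y X (\<lambda>\<delta>\<in>Ext E Y X. trace X (pull E (K X) Y X h \<delta>)) = P.coset (K X) Y h"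
    using Psi_pull[OF o(1) K o(2) h trace_DE(1)[OF o(1)]] trace_DE(2)[OF o(1)]
      P.cmp_coset[OF K K o(2) idm_closed[OF K] h] cmp_idm_right[OF K o(2) h] by simp
qed

lemma Psi_inverse_coset:
  assumes o: "X \<in> obj C" "Y \<in> obj C" and h: "h \<in> Mor C (K X) Y"
  shows "inv_into (DE Y X) (\<Psi> Y X) (P.coset (K X) Y h) =
    (\<lambda>\<delta>\<in>Ext E Y X. trace X (pull E (K X) Y X h \<delta>))"
  using inv_into_f_f[OF bij_betw_imp_inj_on[OF Psi_bij[OF o]] functional_of_trace(1)[OF o h]]
  unfolding functional_of_trace(2)[OF o h] .

text \<open>Fullness of \<open>\<tau>\<^sup>-\<close> enters in the last axiom: the class of \<open>e\<close> is \<open>\<tau>\<^sup>-\<close> of the class of some \<open>g\<close>, and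
naturality of \<open>\<Psi>\<close> in its second variable turns composition with \<open>\<tau>\<^sup>- g\<close> into \<open>g\<^sub>*\<close>.\<close>

lemma trace_is_serre_trace: "serre_trace n C E s k J K trace"
proof
  show "artinian_ring k" by (rule artinian)
  show "injective_cogenerator k J" by (rule cogenerator)
  show "ext_finite k C E" by (rule ext_finite)
  show "K X \<in> obj C" if "X \<in> obj C" for X using \<tau>'_obj that .
  show "linear_map k (ext E (K X) X) J (trace X)" if "X \<in> obj C" for X
    using trace_DE(1)[OF that] DE_iff by blast
next
  fix X Y \<phi> assume o: "X \<in> obj C" "Y \<in> obj C" and \<phi>: "linear_map k (ext E Y X) J \<phi>"
  interpret YX: module k "ext E Y X" using ext_module o by simp
  let ?\<phi> = "restrict \<phi> (Ext E Y X)"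
  have r: "?\<phi> \<in> DE Y X" unfolding DE_iff using \<phi> by (auto simp: linear_map_def)
  then have "\<Psi> Y X ?\<phi> \<in> Mor PC (K X) Y" using bij_betwE[OF Psi_bij[OF o]] by blast
  then obtain h where h: "h \<in> Mor C (K X) Y" "\<Psi> Y X ?\<phi> = P.coset (K X) Y h"
    unfolding P.Mor_quotient by blast
  have eq: "?\<phi> = (\<lambda>\<delta>\<in>Ext E Y X. trace X (pull E (K X) Y X h \<delta>))"
    by (rule inj_onD[OF bij_betw_imp_inj_on[OF Psi_bij[OF o]] _ r functional_of_trace(1)[OF o h(1)]])
      (use functional_of_trace(2)[OF o h(1)] h(2) in simp)
  have "\<phi> \<delta> = trace X (pull E (K X) Y X h \<delta>)" if "\<delta> \<in> Ext E Y X" for \<delta>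
    using fun_cong[OF eq, of \<delta>] that by simp
  then show "\<exists>h\<in>Mor C (K X) Y. \<forall>\<delta>\<in>Ext E Y X. \<phi> \<delta> = trace X (pull E (K X) Y X h \<delta>)"
    using h(1) by blast
next
  fix X Y h assume o: "X \<in> obj C" "Y \<in> obj C" and h: "h \<in> Mor C (K X) Y"
    and z: "\<forall>\<delta>\<in>Ext E Y X. trace X (pull E (K X) Y X h \<delta>) = \<zero>\<^bsub>J\<^esub>"
  have K: "K X \<in> obj C" using \<tau>'_obj o by simp
  let ?z = "zmor C (K X) Y"
  have zm: "?z \<in> Mor C (K X) Y" using zmor_closed K o by simp
  have J: "abelian_group J" using cogenerator module.axioms(2)
    unfolding injective_cogenerator_def injective_module_def by blast
  have lin: "linear_map k (ext E (K X) X) J (trace X)" using trace_DE(1)[OF o(1)] DE_iff by blast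
  have "trace X (zext E (K X) X) = \<zero>\<^bsub>J\<^esub>"
    by (rule additive_map_zero[of _ _ "trace X"]) (use lin ext_group[OF K o(1)] J in \<open>auto simp: linear_map_def\<close>)
  then have "(\<lambda>\<delta>\<in>Ext E Y X. trace X (pull E (K X) Y X h \<delta>)) =
      (\<lambda>\<delta>\<in>Ext E Y X. trace X (pull E (K X) Y X ?z \<delta>))"
    using z pull_zmor[OF K o(2,1)] by (auto simp: restrict_def)
  then have "P.coset (K X) Y h = P.coset (K X) Y ?z"
    using functional_of_trace(2)[OF o h] functional_of_trace(2)[OF o zm] by simp
  then have hz: "h \<ominus>\<^bsub>mor C (K X) Y\<^esub> ?z \<in> proj_trivial C E (K X) Y"
    using P.coset_eq_iff[OF K o(2) h zm] by simp
  interpret KY: abelian_group "mor C (K X) Y" using mor_group K o by simp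
  have "h \<ominus>\<^bsub>mor C (K X) Y\<^esub> ?z = h" using h by (simp add: KY.minus_eq)
  then show "h \<in> proj_trivial C E (K X) Y" using hz by simp
next
  fix X X' e assume o: "X \<in> obj C" "X' \<in> obj C" and e: "e \<in> Mor C (K X) (K X')"
  have K: "K X \<in> obj C" "K X' \<in> obj C" using \<tau>'_obj o by auto
  \<comment> \<open>The functor \<open>\<tau>\<^sup>-\<close> is full, being a quasi-inverse.\<close>
  obtain G where G: "G \<in> Mor IC X X'" "fmor \<tau>' X X' G = P.coset (K X) (K X') e"
    using quasi_inverse_full[OF PC.plain_category_axioms IC.plain_category_axioms \<tau>_functor inverse, of X X'
        "P.coset (K X) (K X') e"] o coset_mor(1)[OF K e] I.obj_quotient by auto
  then obtain g where g: "g \<in> Mor C X X'" "G = I.coset X X' g" unfolding I.Mor_quotient by blast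
  let ?a = "\<lambda>\<delta>\<in>Ext E (K X') X. trace X' (push E (K X') X X' g \<delta>)"
  let ?b = "\<lambda>\<delta>\<in>Ext E (K X') X. trace X (pull E (K X) (K X') X e \<delta>)"
  have "\<Psi> (K X') X ?a = cmp PC (K X) (K X') (K X')
      (P.coset (K X') (K X') (idm C (K X'))) (P.coset (K X) (K X') e)"
    using Psi_push[OF o K(2) g(1) trace_DE(1)[OF o(2)]] trace_DE(2)[OF o(2)] G(2) g(2) by simp
  also have "\<dots> = P.coset (K X) (K X') e"
    using P.cmp_coset[OF K K(2) e idm_closed[OF K(2)]] cmp_idm_left[OF K e] by simp
  also have "\<dots> = \<Psi> (K X') X ?b" using functional_of_trace(2)[OF o(1) K(2) e] by simp
  finally have eq: "\<Psi> (K X') X ?a = \<Psi> (K X') X ?b" .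
  have aD: "?a \<in> DE (K X') X"
  proof -
    interpret KX: module k "ext E (K X') X" using ext_module K o by simp
    have "linear_map k (ext E (K X') X') J (trace X')" using trace_DE(1)[OF o(2)] DE_iff by blast
    then show ?thesis
      unfolding DE_iff linear_map_def using push_closed[OF K(2) o g(1)] push_add_ext[OF K(2) o g(1)]
        push_smult_ext[OF K(2) o g(1)] by (auto simp: Pi_iff)
  qed
  have ab: "?a = ?b"
    by (rule inj_onD[OF bij_betw_imp_inj_on[OF Psi_bij[OF o(1) K(2)]] eq aD functional_of_trace(1)[OF o(1) K(2) e]])
  have "trace X (pull E (K X) (K X') X e \<epsilon>) = trace X' (push E (K X') X X' g \<epsilon>)"
    if "\<epsilon> \<in> Ext E (K X') X" for \<epsilon>
    using fun_cong[OF ab, of \<epsilon>] that by simp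
  then show "\<exists>g\<in>Mor C X X'. \<forall>\<epsilon>\<in>Ext E (K X') X.
      trace X (pull E (K X) (K X') X e \<epsilon>) = trace X' (push E (K X') X X' g \<epsilon>)"
    using g(1) by blast
qed

end

section \<open>Right equivalence classes and determined morphisms\<close>

context preadditive_category
begin

text \<open>A pair is a morphism of the category with target \<open>Y\<close>; \<open>factors_through\<close> by itself does not require
this.\<close>

definition over :: "'o \<Rightarrow> 'o \<times> 'm \<Rightarrow> bool" where
  "over Y p \<longleftrightarrow> fst p \<in> obj C \<and> snd p \<in> Mor C (fst p) Y"

definition maps_through :: "'o \<Rightarrow> 'o \<Rightarrow> 'o \<times> 'm \<Rightarrow> 'm set" where
  "maps_through A Y p = {h \<in> Mor C A Y. factors_through C Y (A, h) p}"

lemma factors_through_refl: "\<lbrakk>Y \<in> obj C; over Y p\<rbrakk> \<Longrightarrow> factors_through C Y p p"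
  unfolding factors_through_def over_def
  by (auto simp: cmp_idm_right intro!: bexI[of _ "idm C (fst p)"] idm_closed split: prod.splits)

lemma factors_through_trans:
  assumes Y: "Y \<in> obj C" and o: "over Y p" "over Y q" "over Y r"
    and pq: "factors_through C Y p q" and qr: "factors_through C Y q r"
  shows "factors_through C Y p r"
proof -
  obtain A f B g D h where p: "p = (A, f)" and q: "q = (B, g)" and r: "r = (D, h)"
    by (metis surj_pair)
  have c: "A \<in> obj C" "B \<in> obj C" "D \<in> obj C" "h \<in> Mor C D Y" using o p q r by (auto simp: over_def)
  obtain x where x: "x \<in> Mor C A B" "f = cmp C A B Y g x"
    using pq unfolding p q factors_through_def by auto
  obtain y where y: "y \<in> Mor C B D" "g = cmp C B D Y h y"
    using qr unfolding q r factors_through_def by auto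
  have "f = cmp C A D Y h (cmp C A B D y x)"
    using cmp_assoc[OF c(1,2,3) Y x(1) y(1) c(4)] x(2) y(2) by simp
  moreover have "cmp C A B D y x \<in> Mor C A D" using cmp_closed[OF c(1,2,3) x(1) y(1)] .
  ultimately show ?thesis unfolding p r factors_through_def by auto
qed

lemma maps_through_mono:
  assumes Y: "Y \<in> obj C" and A: "A \<in> obj C" and o: "over Y p" "over Y q"
    and pq: "factors_through C Y p q"
  shows "maps_through A Y p \<subseteq> maps_through A Y q"
  unfolding maps_through_def
  using factors_through_trans[OF Y _ o _ pq] A by (auto simp: over_def)

lemma image_eq_maps_through:
  assumes "Y \<in> obj C" "A \<in> obj C" "over Y (W, f)"
  shows "cmp C A W Y f ` Mor C A W = maps_through A Y (W, f)"
proof -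
  have "W \<in> obj C" "f \<in> Mor C W Y" using assms(3) by (simp_all add: over_def)
  then have "cmp C A W Y f g \<in> Mor C A Y" if "g \<in> Mor C A W" for g
    using cmp_closed[OF assms(2) _ assms(1) that] by blast
  moreover have "factors_through C Y (A, h) (W, f) \<longleftrightarrow> (\<exists>g\<in>Mor C A W. h = cmp C A W Y f g)" for h
    by (simp add: factors_through_def)
  ultimately show ?thesis unfolding maps_through_def by blast
qed

text \<open>Determinedness reduces the comparison of two morphisms ending at \<open>Y\<close> to the comparison of the
morphisms from \<open>A\<close> that factor through them.\<close>

lemma right_determined_factors:
  assumes det: "right_determined C A Y p" and q: "over Y q" and Y: "Y \<in> obj C" and A: "A \<in> obj C"
    and sub: "maps_through A Y q \<subseteq> maps_through A Y p"
  shows "factors_through C Y q p"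
proof -
  obtain L g where Lg: "q = (L, g)" by (cases q)
  have L: "L \<in> obj C" "g \<in> Mor C L Y" using q Lg by (auto simp: over_def)
  have "factors_through C Y (A, cmp C A L Y g h) p" if h: "h \<in> Mor C A L" for h
  proof -
    have "cmp C A L Y g h \<in> maps_through A Y q"
      unfolding Lg using image_eq_maps_through[OF Y A q[unfolded Lg]] h by blast
    then show ?thesis using sub unfolding maps_through_def by blast
  qed
  then show ?thesis using det L unfolding right_determined_def Lg by blast
qed

lemma right_classD:
  assumes Y: "Y \<in> obj C" and w: "over Y w" and p: "p \<in> right_class C Y w" and q: "q \<in> right_class C Y w"
  shows "over Y p" and "factors_through C Y p q"
proof -
  show op: "over Y p" using p unfolding right_class_def over_def by blast
  have "over Y q" using q unfolding right_class_def over_def by blast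
  then show "factors_through C Y p q"
    using factors_through_trans[OF Y op w] p q unfolding right_class_def by blast
qed

lemma right_class_eqI:
  assumes Y: "Y \<in> obj C" and w: "over Y w" "over Y w'"
    and p: "p \<in> right_class C Y w" and q: "q \<in> right_class C Y w'"
    and pq: "factors_through C Y p q" and qp: "factors_through C Y q p"
  shows "right_class C Y w = right_class C Y w'"
proof -
  have ww: "w \<in> right_class C Y w" "w' \<in> right_class C Y w'"
    using w factors_through_refl[OF Y] unfolding right_class_def over_def by auto
  note p' = right_classD[OF Y w(1) p ww(1)] right_classD[OF Y w(1) ww(1) p]
  note q' = right_classD[OF Y w(2) q ww(2)] right_classD[OF Y w(2) ww(2) q]
  have 1: "factors_through C Y w w'"
    using factors_through_trans[OF Y w(1) p'(1) w(2) p'(4) factors_through_trans[OF Y p'(1) q'(1) w(2) pq q'(2)]] .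
  have 2: "factors_through C Y w' w"
    using factors_through_trans[OF Y w(2) q'(1) w(1) q'(4) factors_through_trans[OF Y q'(1) p'(1) w(1) qp p'(2)]] .
  show ?thesis
    unfolding right_class_def
    using factors_through_trans[OF Y _ w(1) w(2) _ 1] factors_through_trans[OF Y w(2) w(1) _ 2]
      factors_through_trans[OF Y _ w(2) w(1) _ 2] factors_through_trans[OF Y w(1) w(2) _ 1]
    unfolding over_def by blast
qed

end

section \<open>The commutative triangle\<close>

context ars_category
begin

interpretation P: category_ideal C "proj_trivial C E" by (rule proj_trivial_ideal)
interpretation T: serre_trace n C E s k J K trace by (rule trace_is_serre_trace)

text \<open>A right submodule contains all projectively trivial morphisms, so it is a union of cosets and
can be read off from its image in the stable category.\<close>

lemma coset_image_mono_iff: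
  assumes o: "A \<in> obj C" "Y \<in> obj C" and H: "T.right_submodule A Y H" "H' \<subseteq> Mor C A Y"
  shows "P.coset A Y ` H' \<subseteq> P.coset A Y ` H \<longleftrightarrow> H' \<subseteq> H"
proof
  assume sub: "P.coset A Y ` H' \<subseteq> P.coset A Y ` H"
  show "H' \<subseteq> H"
  proof
    fix h assume h: "h \<in> H'"
    then obtain h' where h': "h' \<in> H" "P.coset A Y h = P.coset A Y h'" using sub by blast
    have m: "h \<in> Mor C A Y" "h' \<in> Mor C A Y" using h h' H unfolding T.right_submodule_def by auto
    interpret AY: abelian_group "mor C A Y" using mor_group o by simp
    have "h \<ominus>\<^bsub>mor C A Y\<^esub> h' \<in> proj_trivial C E A Y" using P.coset_eq_iff[OF o m] h'(2) by simp
    then have "h \<ominus>\<^bsub>mor C A Y\<^esub> h' \<in> H" using H(1) unfolding T.right_submodule_def by blast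
    then have "(h \<ominus>\<^bsub>mor C A Y\<^esub> h') \<oplus>\<^bsub>mor C A Y\<^esub> h' \<in> H"
      using h'(1) H(1) unfolding T.right_submodule_def by blast
    moreover have "(h \<ominus>\<^bsub>mor C A Y\<^esub> h') \<oplus>\<^bsub>mor C A Y\<^esub> h' = h"
      using m by (simp add: AY.minus_eq AY.add.m_assoc AY.l_neg)
    ultimately show "h \<in> H" by simp
  qed
qed blast

lemma stable_End_group:
  assumes "A \<in> obj C" "Y \<in> obj C"
  shows "group (add_monoid (stable_End_module C E A Y))"
proof -
  have "group (add_monoid (stable_End_module C E A Y)) \<longleftrightarrow> group (add_monoid (mor PC A Y))"
    by (rule group_cong) (simp_all add: stable_End_module_def)
  then show ?thesis using P.quotient_add_group[OF assms] by simp
qed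

lemma coset_image_submodule:
  assumes o: "A \<in> obj C" "Y \<in> obj C" and H: "T.right_submodule A Y H"
  shows "submodule (P.coset A Y ` H) (op_ring (End_ring C A)) (stable_End_module C E A Y)"
proof (intro submodule.intro submodule_axioms.intro)
  let ?M = "stable_End_module C E A Y"
  have Hm: "h \<in> Mor C A Y" if "h \<in> H" for h using H that unfolding T.right_submodule_def by blast
  have z: "zmor C A Y \<in> H"
  proof -
    have "zmor C A Y \<in> proj_trivial C E A Y" using o by (simp add: proj_trivial_def zmor_closed pull_zmor)
    then show ?thesis using H unfolding T.right_submodule_def by blast
  qed
  interpret G: group "add_monoid ?M" by (rule stable_End_group[OF o])
  have add: "P.coset A Y h \<oplus>\<^bsub>?M\<^esub> P.coset A Y h' = P.coset A Y (h \<oplus>\<^bsub>mor C A Y\<^esub> h')"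
    if "h \<in> Mor C A Y" "h' \<in> Mor C A Y" for h h'
    using P.add_coset[OF o that] by (simp add: stable_End_module_def)
  have zero: "\<zero>\<^bsub>?M\<^esub> = P.coset A Y (zmor C A Y)"
    using P.zmor_quotient[OF o] by (simp add: stable_End_module_def)
  have car: "P.coset A Y h \<in> carrier ?M" if "h \<in> Mor C A Y" for h
    using that by (auto simp: stable_End_module_def P.Mor_quotient)
  show "subgroup (P.coset A Y ` H) (add_monoid ?M)"
  proof (rule G.subgroupI)
    show "P.coset A Y ` H \<subseteq> carrier (add_monoid ?M)" using car Hm by auto
    show "P.coset A Y ` H \<noteq> {}" using z by blast
    show "a \<otimes>\<^bsub>add_monoid ?M\<^esub> b \<in> P.coset A Y ` H" if ab: "a \<in> P.coset A Y ` H" "b \<in> P.coset A Y ` H" for a b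
    proof -
      obtain h h' where h: "h \<in> H" "h' \<in> H" "a = P.coset A Y h" "b = P.coset A Y h'" using ab by blast
      then have "h \<oplus>\<^bsub>mor C A Y\<^esub> h' \<in> H" using H unfolding T.right_submodule_def by blast
      then show ?thesis using add[OF Hm[OF h(1)] Hm[OF h(2)]] h(3,4) by simp
    qed
    show "inv\<^bsub>add_monoid ?M\<^esub> a \<in> P.coset A Y ` H" if a: "a \<in> P.coset A Y ` H" for a
    proof -
      obtain h where h: "h \<in> H" "a = P.coset A Y h" using a by blast
      have hm: "h \<in> Mor C A Y" by (rule Hm[OF h(1)])
      interpret AY: abelian_group "mor C A Y" using mor_group o by simp
      \<comment> \<open>Right submodules are closed under precomposition, so \<open>-h\<close> is obtained as \<open>h \<circ> (-id)\<close>.\<close>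
      let ?i = "zmor C A A \<ominus>\<^bsub>mor C A A\<^esub> idm C A"
      have i: "?i \<in> Mor C A A" using minus_mor_closed o zmor_closed idm_closed by simp
      have "cmp C A A Y h ?i = zmor C A Y \<ominus>\<^bsub>mor C A Y\<^esub> h"
        using cmp_minus_right[OF o(1,1,2) zmor_closed[OF o(1,1)] idm_closed[OF o(1)] hm]
          cmp_zmor_right[OF o(1,1,2) hm] cmp_idm_right[OF o hm] by simp
      moreover have "cmp C A A Y h ?i \<in> H" using H h(1) i unfolding T.right_submodule_def by blast
      ultimately have m: "zmor C A Y \<ominus>\<^bsub>mor C A Y\<^esub> h \<in> H" by simp
      have "P.coset A Y (zmor C A Y \<ominus>\<^bsub>mor C A Y\<^esub> h) \<oplus>\<^bsub>?M\<^esub> a = \<zero>\<^bsub>?M\<^esub>"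
        unfolding h(2) zero using add[OF Hm[OF m] hm] hm by (simp add: AY.minus_eq AY.l_neg)
      then have "inv\<^bsub>add_monoid ?M\<^esub> a = P.coset A Y (zmor C A Y \<ominus>\<^bsub>mor C A Y\<^esub> h)"
        using G.inv_equality car[OF Hm[OF m]] car[OF hm] h(2) by simp
      then show ?thesis using m by blast
    qed
  qed
  fix e x assume e: "e \<in> carrier (op_ring (End_ring C A))" and "x \<in> P.coset A Y ` H"
  then obtain h where h: "h \<in> H" "x = P.coset A Y h" by blast
  have e': "e \<in> Mor C A A" using e by (simp add: op_ring_def End_ring_def)
  have "e \<odot>\<^bsub>?M\<^esub> x = P.coset A Y (cmp C A A Y h e)"
    using P.cmp_coset[OF o(1,1,2) e' Hm[OF h(1)]] h(2) by (simp add: stable_End_module_def)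
  moreover have "cmp C A A Y h e \<in> H" using H h(1) e' unfolding T.right_submodule_def by blast
  ultimately show "e \<odot>\<^bsub>?M\<^esub> x \<in> P.coset A Y ` H" by simp
qed

lemma submodule_preimage:
  assumes o: "A \<in> obj C" "Y \<in> obj C"
    and S: "submodule S (op_ring (End_ring C A)) (stable_End_module C E A Y)"
  shows "T.right_submodule A Y {h \<in> Mor C A Y. P.coset A Y h \<in> S}"
    and "P.coset A Y ` {h \<in> Mor C A Y. P.coset A Y h \<in> S} = S"
proof -
  let ?M = "stable_End_module C E A Y" and ?H = "{h \<in> Mor C A Y. P.coset A Y h \<in> S}"
  have sg: "subgroup S (add_monoid ?M)" using S by (rule submodule.axioms)
  have zero: "P.coset A Y (zmor C A Y) \<in> S"
    using subgroup.one_closed[OF sg] P.zmor_quotient[OF o] by (simp add: stable_End_module_def)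
  have add: "P.coset A Y (h \<oplus>\<^bsub>mor C A Y\<^esub> h') \<in> S" if "h \<in> ?H" "h' \<in> ?H" for h h'
    using subgroup.m_closed[OF sg, of "P.coset A Y h" "P.coset A Y h'"] that P.add_coset[OF o, of h h']
    by (simp add: stable_End_module_def)
  have smult: "P.coset A Y (cmp C A A Y h e) \<in> S" if "h \<in> ?H" "e \<in> Mor C A A" for h e
    using submodule.smult_closed[OF S, of e "P.coset A Y h"] that P.cmp_coset[OF o(1,1,2), of e h]
    by (simp add: stable_End_module_def op_ring_def End_ring_def)
  have proj: "P.coset A Y h \<in> S" if h: "h \<in> proj_trivial C E A Y" for h
  proof -
    have hm: "h \<in> Mor C A Y" using h unfolding proj_trivial_def by blast
    interpret AY: abelian_group "mor C A Y" using mor_group o by simp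
    have "h \<ominus>\<^bsub>mor C A Y\<^esub> zmor C A Y = h" using hm by (simp add: AY.minus_eq)
    then have "P.coset A Y h = P.coset A Y (zmor C A Y)"
      using P.coset_eq_iff[OF o hm zmor_closed[OF o]] h by simp
    then show ?thesis using zero by simp
  qed
  show "T.right_submodule A Y ?H"
    unfolding T.right_submodule_def
    using add smult proj add_mor_closed[OF o] cmp_closed[OF o(1,1,2)] by (auto simp: proj_trivial_def)
  show "P.coset A Y ` ?H = S"
    using subgroup.subset[OF sg] by (auto simp: stable_End_module_def P.Mor_quotient)
qed

text \<open>No condition of finite generation appears on the right-hand side, because
\<open>right_submodule_closed_and_finite\<close> supplies it.\<close>

lemma sub_stable_iff:
  assumes o: "X \<in> obj C" "Y \<in> obj C"
  shows "S \<in> sub_stable C E (K X) Y \<longleftrightarrow>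
    (\<exists>H. T.right_submodule (K X) Y H \<and> S = P.coset (K X) Y ` H)"
proof
  assume "S \<in> sub_stable C E (K X) Y"
  then have "submodule S (op_ring (End_ring C (K X))) (stable_End_module C E (K X) Y)"
    unfolding fg_submodules_def by blast
  note pre = submodule_preimage[OF \<tau>'_obj[OF o(1)] o(2) this]
  show "\<exists>H. T.right_submodule (K X) Y H \<and> S = P.coset (K X) Y ` H"
    by (intro exI conjI, rule pre(1), rule pre(2)[symmetric])
next
  let ?A = "K X"
  have A: "?A \<in> obj C" using \<tau>'_obj o by simp
  assume "\<exists>H. T.right_submodule ?A Y H \<and> S = P.coset ?A Y ` H"
  then obtain H where H: "T.right_submodule ?A Y H" and S: "S = P.coset ?A Y ` H" by blast
  obtain G where G: "finite G" "G \<subseteq> H"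
    and gen: "\<forall>H'. T.right_submodule ?A Y H' \<and> G \<subseteq> H' \<longrightarrow> T.ann X Y (T.coann X Y H) \<subseteq> H'"
    using T.right_submodule_closed_and_finite[OF o H] by (elim exE conjE)
  have "S \<subseteq> R" if R: "submodule R (op_ring (End_ring C ?A)) (stable_End_module C E ?A Y)"
    and GR: "P.coset ?A Y ` G \<subseteq> R" for R
  proof -
    let ?H' = "{h \<in> Mor C ?A Y. P.coset ?A Y h \<in> R}"
    note R' = submodule_preimage[OF A o(2) R]
    have "G \<subseteq> ?H'" using GR G(2) H unfolding T.right_submodule_def by blast
    then have "H \<subseteq> ?H'" using gen R'(1) unfolding T.ann_coann[OF o H] by simp
    then show ?thesis using S by blast
  qed
  then have "finitely_generated (op_ring (End_ring C ?A)) (stable_End_module C E ?A Y) S"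
    unfolding finitely_generated_def S using G by (intro exI[of _ "P.coset ?A Y ` G"] conjI allI impI) auto
  then show "S \<in> sub_stable C E ?A Y"
    unfolding fg_submodules_def using coset_image_submodule[OF A o(2) H] S by simp
qed

text \<open>Under \<open>\<Psi>\<^sup>-\<^sup>1\<close> the class of \<open>h\<close> becomes the functional \<open>\<delta> \<mapsto> t(h\<^sup>*\<delta>)\<close>, so the kernel that defines \<open>\<Upsilon>(F)\<close>
consists of the classes that annihilate \<open>F\<close>.\<close>

lemma Upsilon_eq:
  assumes o: "X \<in> obj C" "Y \<in> obj C" and F: "F \<subseteq> Ext E Y X"
  shows "Upsilon k J C E \<tau> \<tau>' \<theta> \<Phi> X Y F = P.coset (K X) Y ` T.ann X Y F"
proof -
  have "restrict (inv_into (DE Y X) (\<Psi> Y X) (P.coset (K X) Y h)) F =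
      \<zero>\<^bsub>dual_module k J ((ext E Y X)\<lparr>carrier := F\<rparr>)\<^esub> \<longleftrightarrow>
      (\<forall>\<delta>\<in>F. trace X (pull E (K X) Y X h \<delta>) = \<zero>\<^bsub>J\<^esub>)"
    if h: "h \<in> Mor C (K X) Y" for h
    unfolding Psi_inverse_coset[OF o h] using F
    by (auto simp: dual_module_def restrict_def fun_eq_iff subset_iff)
  then show ?thesis
    unfolding Upsilon_def T.ann_def P.Mor_quotient by (auto intro!: imageI)
qed

lemma def_classes_rep:
  assumes Y: "Y \<in> obj C" and c: "c \<in> def_classes n C E s Y"
  shows "\<exists>Z \<delta>. distinguished n C E s Z \<delta> \<and> Ob Z (n+1) = Y \<and> over Y (Ob Z n, dif Z n) \<and>
    c = right_class C Y (Ob Z n, dif Z n) \<and> (Ob Z n, dif Z n) \<in> c"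
proof -
  obtain W f where c_eq: "c = right_class C Y (W, f)" and "deflation n C E s W Y f"
    using c unfolding def_classes_def by blast
  then obtain Z \<delta> where Z: "distinguished n C E s Z \<delta>" "Ob Z n = W" "Ob Z (n+1) = Y" "dif Z n = f"
    unfolding deflation_def by blast
  have ov: "over Y (Ob Z n, dif Z n)" using distinguished_obj[OF Z(1)] Z(3) unfolding over_def by simp
  then have "(Ob Z n, dif Z n) \<in> right_class C Y (Ob Z n, dif Z n)"
    using factors_through_refl[OF Y ov] unfolding right_class_def over_def by simp
  then show ?thesis using Z c_eq ov by blast
qed

lemma distinguished_def_class:
  assumes Y: "Y \<in> obj C" and Z: "distinguished n C E s Z \<delta>" "Ob Z (n+1) = Y"
  shows "right_class C Y (Ob Z n, dif Z n) \<in> def_classes n C E s Y"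
    and "(Ob Z n, dif Z n) \<in> right_class C Y (Ob Z n, dif Z n)"
    and "over Y (Ob Z n, dif Z n)"
proof -
  show "right_class C Y (Ob Z n, dif Z n) \<in> def_classes n C E s Y"
    unfolding def_classes_def deflation_def using Z by blast
  show ov: "over Y (Ob Z n, dif Z n)" using distinguished_obj[OF Z(1)] Z(2) unfolding over_def by simp
  then show "(Ob Z n, dif Z n) \<in> right_class C Y (Ob Z n, dif Z n)"
    using factors_through_refl[OF Y ov] unfolding right_class_def over_def by simp
qed

lemma class_members:
  assumes Y: "Y \<in> obj C" and c: "c \<in> def_classes n C E s Y" and p: "p \<in> c" and q: "q \<in> c"
  shows "over Y p" and "factors_through C Y p q"
proof -
  obtain w where "over Y w" "c = right_class C Y w" using def_classes_rep[OF Y c] by blast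
  then show "over Y p" "factors_through C Y p q" using right_classD[OF Y] p q by blast+
qed

lemma class_eqI:
  assumes Y: "Y \<in> obj C" and c: "c \<in> def_classes n C E s Y" "c' \<in> def_classes n C E s Y"
    and p: "p \<in> c" and q: "q \<in> c'" and pq: "factors_through C Y p q" "factors_through C Y q p"
  shows "c = c'"
proof -
  obtain w w' where "over Y w" "c = right_class C Y w" "over Y w'" "c' = right_class C Y w'"
    using def_classes_rep[OF Y c(1)] def_classes_rep[OF Y c(2)] by blast
  then show ?thesis using right_class_eqI[OF Y _ _ _ _ pq] p q by blast
qed

lemma maps_through_class:
  assumes Y: "Y \<in> obj C" and A: "A \<in> obj C" and c: "c \<in> def_classes n C E s Y" and p: "p \<in> c" and q: "q \<in> c"
  shows "maps_through A Y p = maps_through A Y q"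
  using maps_through_mono[OF Y A] class_members[OF Y c] p q by blast

lemma maps_through_eq_ann:
  assumes o: "X \<in> obj C" and Z: "distinguished n C E s Z \<delta>" and Y: "Ob Z (n+1) = Y"
  shows "maps_through (K X) Y (Ob Z n, dif Z n) = T.ann X Y (orbit (Ob Z 0) X Y \<delta>)"
proof -
  note Zo = distinguished_obj[OF Z, unfolded Y]
  show ?thesis
    unfolding maps_through_def T.ann_orbit[OF Zo(1) o Zo(3,5)]
    using factors_iff_pull_zero[OF Z Y \<tau>'_obj[OF o]] by blast
qed

text \<open>By \<open>coann_ann\<close>, the orbit of the extension depends only on which morphisms factor through the
deflation. This is why \<open>\<xi>\<close> is well defined on right equivalence classes.\<close>

lemma orbit_eq_coann:
  assumes o: "X \<in> obj C" and Z: "distinguished n C E s Z \<delta>" and Y: "Ob Z (n+1) = Y"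
  shows "orbit (Ob Z 0) X Y \<delta> = T.coann X Y (maps_through (K X) Y (Ob Z n, dif Z n))"
proof -
  note Zo = distinguished_obj[OF Z, unfolded Y]
  show ?thesis
    unfolding maps_through_eq_ann[OF o Z Y]
    using T.coann_ann[OF o Zo(3) ext_End_submodule_linear[OF o Zo(3) orbit_submodule[OF Zo(1) o Zo(3,5)]]] by simp
qed

lemma maps_through_right_submodule:
  assumes o: "X \<in> obj C" "Y \<in> obj C" and c: "c \<in> def_classes n C E s Y" and p: "p \<in> c"
  shows "T.right_submodule (K X) Y (maps_through (K X) Y p)"
proof -
  obtain Z \<delta> where Z: "distinguished n C E s Z \<delta>" "Ob Z (n+1) = Y" "(Ob Z n, dif Z n) \<in> c"
    using def_classes_rep[OF o(2) c] by blast
  note Zo = distinguished_obj[OF Z(1), unfolded Z(2)]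
  have "maps_through (K X) Y p = T.ann X Y (orbit (Ob Z 0) X Y \<delta>)"
    using maps_through_class[OF o(2) \<tau>'_obj[OF o(1)] c p Z(3)] maps_through_eq_ann[OF o(1) Z(1,2)] by simp
  then show ?thesis using T.ann_right_submodule[OF o orbit_submodule[OF Zo(1) o Zo(5)]] by simp
qed

lemma eta_eq:
  assumes o: "X \<in> obj C" "Y \<in> obj C" and c: "c \<in> def_classes n C E s Y" and p: "p \<in> c"
  shows "eta C E (K X) Y c = P.coset (K X) Y ` maps_through (K X) Y p"
proof -
  have A: "K X \<in> obj C" using \<tau>'_obj o by simp
  have val: "P.coset (K X) Y ` (cmp C (K X) W Y f ` Mor C (K X) W) =
      P.coset (K X) Y ` maps_through (K X) Y p" if Wf: "(W, f) \<in> c" for W f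
    using image_eq_maps_through[OF o(2) A class_members(1)[OF o(2) c Wf Wf]]
      maps_through_class[OF o(2) A c Wf p] by simp
  obtain W f where Wf: "(W, f) \<in> c" using p by (cases p) simp
  show ?thesis unfolding eta_def
  proof (rule the_equality)
    show "\<exists>W f. (W, f) \<in> c \<and> P.coset (K X) Y ` maps_through (K X) Y p =
        P.coset (K X) Y ` (cmp C (K X) W Y f ` Mor C (K X) W)"
      by (intro exI conjI, rule Wf, rule val[OF Wf, symmetric])
  next
    fix H assume "\<exists>W f. (W, f) \<in> c \<and> H = P.coset (K X) Y ` (cmp C (K X) W Y f ` Mor C (K X) W)"
    then show "H = P.coset (K X) Y ` maps_through (K X) Y p" using val by (elim exE conjE) simp
  qed
qed

lemma xi_eq:
  assumes o: "X \<in> obj C" "Y \<in> obj C" and c: "c \<in> def_classes n C E s Y"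
    and Z: "distinguished n C E s Z \<delta>" "Ob Z (n+1) = Y" "(Ob Z n, dif Z n) \<in> c"
  shows "xi n C E s X Y c = orbit (Ob Z 0) X Y \<delta>"
  unfolding xi_def
proof (rule the_equality)
  show "\<exists>Z' \<delta>'. distinguished n C E s Z' \<delta>' \<and> Ob Z' (n+1) = Y \<and> (Ob Z' n, dif Z' n) \<in> c \<and>
      orbit (Ob Z 0) X Y \<delta> = (\<lambda>g. push E Y (Ob Z' 0) X g \<delta>') ` Mor C (Ob Z' 0) X"
    using Z unfolding orbit_def by blast
next
  fix F assume "\<exists>Z' \<delta>'. distinguished n C E s Z' \<delta>' \<and> Ob Z' (n+1) = Y \<and> (Ob Z' n, dif Z' n) \<in> c \<and>
      F = (\<lambda>g. push E Y (Ob Z' 0) X g \<delta>') ` Mor C (Ob Z' 0) X"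
  then obtain Z' \<delta>' where Z': "distinguished n C E s Z' \<delta>'" "Ob Z' (n+1) = Y" "(Ob Z' n, dif Z' n) \<in> c"
    and F: "F = orbit (Ob Z' 0) X Y \<delta>'" unfolding orbit_def by blast
  show "F = orbit (Ob Z 0) X Y \<delta>"
    unfolding F orbit_eq_coann[OF o(1) Z'(1,2)] orbit_eq_coann[OF o(1) Z(1,2)]
      maps_through_class[OF o(2) \<tau>'_obj[OF o(1)] c Z'(3) Z(3)] ..
qed

lemma sub_ext_realized:
  assumes o: "X \<in> obj C" "Y \<in> obj C" and F: "End_submodule X Y F"
  shows "\<exists>Z \<delta>. distinguished n C E s Z \<delta> \<and> Ob Z (n+1) = Y \<and> Ob Z 0 \<in> add_closure C X \<and>
    orbit (Ob Z 0) X Y \<delta> = F"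
proof -
  obtain S \<delta> where S: "S \<in> add_closure C X" "\<delta> \<in> Ext E Y S" "orbit S X Y \<delta> = F"
    using submodule_is_orbit[OF o F T.ext_submodule_fg[OF o F]] by blast
  then show ?thesis using ex_distinguished[OF add_closure_obj[OF S(1)] o(2) S(2)] by metis
qed

text \<open>For a determined deflation, realize its \<open>\<xi>\<close>-value by an exangle with first term in \<open>add X\<close>. Both
deflations are determined, and by \<open>ann_orbit\<close> the same morphisms from \<open>K X\<close> factor through them, so
they are right equivalent.\<close>

lemma add_def_classes_eq:
  assumes o: "X \<in> obj C" "Y \<in> obj C"
  shows "add_def_classes n C E s X Y = determined_def_classes n C E s (K X) Y"
proof (intro subset_antisym subsetI)
  fix c assume "c \<in> add_def_classes n C E s X Y"
  then obtain Z \<delta> where c: "c \<in> def_classes n C E s Y" and Z: "distinguished n C E s Z \<delta>"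
    "Ob Z (n+1) = Y" "(Ob Z n, dif Z n) \<in> c" "Ob Z 0 \<in> add_closure C X"
    unfolding add_def_classes_def by blast
  then show "c \<in> determined_def_classes n C E s (K X) Y"
    using T.add_closure_determined[OF Z(1,2) o(1) Z(4)] unfolding determined_def_classes_def by blast
next
  fix c assume "c \<in> determined_def_classes n C E s (K X) Y"
  then obtain p where c: "c \<in> def_classes n C E s Y" and p: "p \<in> c" "right_determined C (K X) Y p"
    unfolding determined_def_classes_def by blast
  have A: "K X \<in> obj C" using \<tau>'_obj o by simp
  obtain Z \<delta> where Z: "distinguished n C E s Z \<delta>" "Ob Z (n+1) = Y" "(Ob Z n, dif Z n) \<in> c"
    using def_classes_rep[OF o(2) c] by blast
  note Zo = distinguished_obj[OF Z(1), unfolded Z(2)]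
  obtain Z' \<delta>' where Z': "distinguished n C E s Z' \<delta>'" "Ob Z' (n+1) = Y" "Ob Z' 0 \<in> add_closure C X"
    and orb: "orbit (Ob Z' 0) X Y \<delta>' = orbit (Ob Z 0) X Y \<delta>"
    using sub_ext_realized[OF o orbit_submodule[OF Zo(1) o Zo(5)]] by blast
  let ?q = "(Ob Z' n, dif Z' n)"
  note q = distinguished_def_class[OF o(2) Z'(1,2)]
  have eq: "maps_through (K X) Y ?q = maps_through (K X) Y p"
    using maps_through_eq_ann[OF o(1) Z'(1,2)] maps_through_eq_ann[OF o(1) Z(1,2)] orb
      maps_through_class[OF o(2) A c p(1) Z(3)] by simp
  have "factors_through C Y p ?q"
    by (rule right_determined_factors[OF T.add_closure_determined[OF Z'(1,2) o(1) Z'(3)]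
          class_members(1)[OF o(2) c p(1,1)] o(2) A]) (use eq in simp)
  moreover have "factors_through C Y ?q p"
    by (rule right_determined_factors[OF p(2) q(3) o(2) A]) (use eq in simp)
  ultimately have "c = right_class C Y ?q" by (rule class_eqI[OF o(2) c q(1) p(1) q(2)])
  then show "c \<in> add_def_classes n C E s X Y"
    unfolding add_def_classes_def using c Z' q(2) by blast
qed

lemma eta_mono_iff:
  assumes o: "X \<in> obj C" "Y \<in> obj C"
    and c: "c \<in> def_classes n C E s Y" and c': "c' \<in> determined_def_classes n C E s (K X) Y"
  shows "right_class_le C Y c c' \<longleftrightarrow> eta C E (K X) Y c \<subseteq> eta C E (K X) Y c'"
proof -
  have A: "K X \<in> obj C" using \<tau>'_obj o by simp
  obtain q where cd': "c' \<in> def_classes n C E s Y" and q: "q \<in> c'" "right_determined C (K X) Y q"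
    using c' unfolding determined_def_classes_def by blast
  obtain p where p: "p \<in> c" using def_classes_rep[OF o(2) c] by blast
  have pm: "maps_through (K X) Y p \<subseteq> Mor C (K X) Y" unfolding maps_through_def by blast
  have eta_iff: "eta C E (K X) Y c \<subseteq> eta C E (K X) Y c' \<longleftrightarrow>
      maps_through (K X) Y p \<subseteq> maps_through (K X) Y q"
    unfolding eta_eq[OF o c p] eta_eq[OF o cd' q(1)]
    by (rule coset_image_mono_iff[OF A o(2) maps_through_right_submodule[OF o cd' q(1)] pm])
  show ?thesis unfolding eta_iff
  proof
    assume "right_class_le C Y c c'"
    then obtain p' q' where pq: "p' \<in> c" "q' \<in> c'" "factors_through C Y p' q'"
      unfolding right_class_le_def by blast
    then have "maps_through (K X) Y p' \<subseteq> maps_through (K X) Y q'"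
      using maps_through_mono[OF o(2) A] class_members(1)[OF o(2) c] class_members(1)[OF o(2) cd'] by blast
    then show "maps_through (K X) Y p \<subseteq> maps_through (K X) Y q"
      using maps_through_class[OF o(2) A c p pq(1)] maps_through_class[OF o(2) A cd' q(1) pq(2)] by simp
  next
    assume "maps_through (K X) Y p \<subseteq> maps_through (K X) Y q"
    then have "factors_through C Y p q"
      by (rule right_determined_factors[OF q(2) class_members(1)[OF o(2) c p p] o(2) A])
    then show "right_class_le C Y c c'" unfolding right_class_le_def using p q(1) by blast
  qed
qed

lemma eta_sub_stable:
  assumes o: "X \<in> obj C" "Y \<in> obj C" and c: "c \<in> def_classes n C E s Y"
  shows "eta C E (K X) Y c \<in> sub_stable C E (K X) Y"
proof -
  obtain p where p: "p \<in> c" using def_classes_rep[OF o(2) c] by blast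
  show ?thesis
    using sub_stable_iff[OF o] eta_eq[OF o c p] maps_through_right_submodule[OF o c p] by blast
qed

lemma eta_injective:
  assumes o: "X \<in> obj C" "Y \<in> obj C"
  shows "inj_on (eta C E (K X) Y) (determined_def_classes n C E s (K X) Y)"
proof (rule inj_onI)
  fix c c' assume c: "c \<in> determined_def_classes n C E s (K X) Y"
    and c': "c' \<in> determined_def_classes n C E s (K X) Y"
    and eq: "eta C E (K X) Y c = eta C E (K X) Y c'"
  have d: "c \<in> def_classes n C E s Y" "c' \<in> def_classes n C E s Y"
    using c c' unfolding determined_def_classes_def by auto
  obtain p q where p: "p \<in> c" and q: "q \<in> c'" and pq: "factors_through C Y p q"
    using eta_mono_iff[OF o d(1) c'] eq unfolding right_class_le_def by blast
  obtain p' q' where p': "p' \<in> c" and q': "q' \<in> c'" and qp: "factors_through C Y q' p'"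
    using eta_mono_iff[OF o d(2) c] eq unfolding right_class_le_def by blast
  note m = class_members[OF o(2) d(1)] and m' = class_members[OF o(2) d(2)]
  have "factors_through C Y q p'"
    by (rule factors_through_trans[OF o(2) m'(1)[OF q q] m'(1)[OF q' q'] m(1)[OF p' p'] m'(2)[OF q q'] qp])
  then have "factors_through C Y q p"
    by (rule factors_through_trans[OF o(2) m'(1)[OF q q] m(1)[OF p' p'] m(1)[OF p p] _ m(2)[OF p' p]])
  then show "c = c'" by (rule class_eqI[OF o(2) d p q pq])
qed

lemma eta_surjective:
  assumes o: "X \<in> obj C" "Y \<in> obj C" and S: "S \<in> sub_stable C E (K X) Y"
  shows "S \<in> eta C E (K X) Y ` determined_def_classes n C E s (K X) Y"
proof -
  obtain H where H: "T.right_submodule (K X) Y H" and S_eq: "S = P.coset (K X) Y ` H"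
    using S sub_stable_iff[OF o] by blast
  obtain Z \<delta> where Z: "distinguished n C E s Z \<delta>" "Ob Z (n+1) = Y" "Ob Z 0 \<in> add_closure C X"
    and orb: "orbit (Ob Z 0) X Y \<delta> = T.coann X Y H"
    using sub_ext_realized[OF o T.coann_submodule[OF o H]] by blast
  let ?q = "(Ob Z n, dif Z n)"
  note q = distinguished_def_class[OF o(2) Z(1,2)]
  have "maps_through (K X) Y ?q = H"
    using maps_through_eq_ann[OF o(1) Z(1,2)] T.ann_coann[OF o H] orb by simp
  then have "eta C E (K X) Y (right_class C Y ?q) = S" using eta_eq[OF o q(1,2)] S_eq by simp
  moreover have "right_class C Y ?q \<in> determined_def_classes n C E s (K X) Y"
    using T.add_closure_determined[OF Z(1,2) o(1) Z(3)] q unfolding determined_def_classes_def by blast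
  ultimately show ?thesis by blast
qed

lemma triangle_commutes:
  assumes o: "X \<in> obj C" "Y \<in> obj C" and c: "c \<in> def_classes n C E s Y"
  shows "eta C E (K X) Y c = Upsilon k J C E \<tau> \<tau>' \<theta> \<Phi> X Y (xi n C E s X Y c)"
proof -
  obtain Z \<delta> where Z: "distinguished n C E s Z \<delta>" "Ob Z (n+1) = Y" "(Ob Z n, dif Z n) \<in> c"
    using def_classes_rep[OF o(2) c] by blast
  note Zo = distinguished_obj[OF Z(1), unfolded Z(2)]
  have "orbit (Ob Z 0) X Y \<delta> \<subseteq> Ext E Y X"
    unfolding orbit_def using push_closed[OF o(2) Zo(1) o(1) _ Zo(5)] by blast
  then show ?thesis
    using xi_eq[OF o c Z] Upsilon_eq[OF o] eta_eq[OF o c Z(3)] maps_through_eq_ann[OF o(1) Z(1,2)] by simp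
qed

lemma xi_sub_ext:
  assumes o: "X \<in> obj C" "Y \<in> obj C" and c: "c \<in> def_classes n C E s Y"
  shows "xi n C E s X Y c \<in> sub_ext C E Y X"
proof -
  obtain Z \<delta> where Z: "distinguished n C E s Z \<delta>" "Ob Z (n+1) = Y" "(Ob Z n, dif Z n) \<in> c"
    using def_classes_rep[OF o(2) c] by blast
  note Zo = distinguished_obj[OF Z(1), unfolded Z(2)]
  show ?thesis
    unfolding xi_eq[OF o c Z] fg_submodules_def
    using orbit_submodule[OF Zo(1) o Zo(5)] T.ext_submodule_fg[OF o] by blast
qed

lemma Upsilon_sub_stable:
  assumes o: "X \<in> obj C" "Y \<in> obj C" and F: "F \<in> sub_ext C E Y X"
  shows "Upsilon k J C E \<tau> \<tau>' \<theta> \<Phi> X Y F \<in> sub_stable C E (K X) Y"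
proof -
  have F': "End_submodule X Y F" using F unfolding fg_submodules_def by blast
  then have FE: "F \<subseteq> Ext E Y X"
    using ext_End_submodule_iff[OF o] additive_subgroup.a_subset by blast
  show ?thesis
    unfolding sub_stable_iff[OF o]
    by (intro exI[of _ "T.ann X Y F"] conjI T.ann_right_submodule[OF o F'] Upsilon_eq[OF o FE])
qed

end

theorem theorem1p3:
  fixes k :: "'k ring" and J :: "('k, 'j) module" and n :: nat
    and C :: "('o, 'm, 'k) cat" and E :: "('o, 'm, 'k, 'e) ext_data"
    and s :: "('o, 'm, 'e) realization"
    and \<tau> \<tau>' :: "('o, 'm set, 'o, 'm set) fun_data"
    and \<Phi> :: "'o \<Rightarrow> 'o \<Rightarrow> ('e \<Rightarrow> 'j) \<Rightarrow> 'm set"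
    and \<theta> u :: "'o \<Rightarrow> 'm set"
    and X Y :: 'o
  assumes "cring k" and "artinian_ring k"
    and "minimal_injective_cogenerator k J"
    and "n \<ge> 1"
    and "n_exangulated_category n C E s"
    and "linear_bifunctor k C E"
    and "ext_finite k C E"
    and "krull_schmidt C"
    and "ARS_duality k J C E \<tau> \<Phi>"
    and "quasi_inverse (proj_stable C E) (inj_stable C E) \<tau> \<tau>'"
    and "adjunction (inj_stable C E) (proj_stable C E) \<tau>' \<tau> u \<theta>"
    and "\<And>A B D f g. \<lbrakk>A \<in> obj C; B \<in> obj C; D \<in> obj C; f \<in> Mor C A B; g \<in> Mor C B D;
           deflation n C E s A D (cmp C A B D g f)\<rbrakk> \<Longrightarrow> deflation n C E s B D g"
    and "\<And>A B D f g. \<lbrakk>A \<in> obj C; B \<in> obj C; D \<in> obj C; f \<in> Mor C A B; g \<in> Mor C B D;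
           inflation n C E s A D (cmp C A B D g f)\<rbrakk> \<Longrightarrow> inflation n C E s A B f"
    and "X \<in> obj C" and "Y \<in> obj C"
  shows "add_def_classes n C E s X Y = determined_def_classes n C E s (fob \<tau>' X) Y
    \<and> xi n C E s X Y \<in> add_def_classes n C E s X Y \<rightarrow> sub_ext C E Y X
    \<and> Upsilon k J C E \<tau> \<tau>' \<theta> \<Phi> X Y \<in> sub_ext C E Y X \<rightarrow> sub_stable C E (fob \<tau>' X) Y
    \<and> eta C E (fob \<tau>' X) Y \<in> determined_def_classes n C E s (fob \<tau>' X) Y \<rightarrow> sub_stable C E (fob \<tau>' X) Y
    \<and> (\<forall>c \<in> determined_def_classes n C E s (fob \<tau>' X) Y.
         eta C E (fob \<tau>' X) Y c = Upsilon k J C E \<tau> \<tau>' \<theta> \<Phi> X Y (xi n C E s X Y c))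
    \<and> bij_betw (eta C E (fob \<tau>' X) Y) (determined_def_classes n C E s (fob \<tau>' X) Y) (sub_stable C E (fob \<tau>' X) Y)
    \<and> (\<forall>c \<in> determined_def_classes n C E s (fob \<tau>' X) Y.
         \<forall>c' \<in> determined_def_classes n C E s (fob \<tau>' X) Y.
           right_class_le C Y c c' \<longleftrightarrow> eta C E (fob \<tau>' X) Y c \<subseteq> eta C E (fob \<tau>' X) Y c')"
proof -
  interpret exangulated: n_exangulated_category n C E s by fact
  interpret bifunctor: linear_bifunctor k C E by fact
  interpret ars_category n C E s k J \<tau> \<tau>' \<Phi> \<theta> u
  proof
    show "injective_cogenerator k J"
      using \<open>minimal_injective_cogenerator k J\<close> unfolding minimal_injective_cogenerator_def by blast
  qed fact+
  note o = \<open>X \<in> obj C\<close> \<open>Y \<in> obj C\<close>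
  have def_class: "c \<in> def_classes n C E s Y" if "c \<in> determined_def_classes n C E s (fob \<tau>' X) Y" for c
    using that unfolding determined_def_classes_def by blast
  have "bij_betw (eta C E (fob \<tau>' X) Y) (determined_def_classes n C E s (fob \<tau>' X) Y) (sub_stable C E (fob \<tau>' X) Y)"
    unfolding bij_betw_def using eta_injective[OF o] eta_surjective[OF o] eta_sub_stable[OF o def_class] by blast
  then show ?thesis
    unfolding add_def_classes_eq[OF o]
    using xi_sub_ext[OF o def_class] Upsilon_sub_stable[OF o] eta_sub_stable[OF o def_class]
      triangle_commutes[OF o def_class] eta_mono_iff[OF o def_class]
    by (intro conjI ballI Pi_I refl)
qed

end
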